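(* Assume $n\ge2$, $r\ge 1$, and let $M$ be an irreducible $U_v$-submodule of $\widetilde{\mathcal Q}_v(n,r)$ with highest weight $\omega=(r,0,\dots,0)\in\Lambda(n,r)$. Then $\dim_{\mathbb Q(v)} M_\omega=2$ when $r>1$, and $\dim_{\mathbb Q(v)} M_\omega=1$ when $r=1$.
   Context: Ground field $\mathbb Q(v)$, $v$ an indeterminate, $q=v^2$; $\mathbb N=\{0,1,2,\dots\}$; $\Lambda(n,r)=\{\lambda\in\mathbb N^n:\sum_i\lambda_i=r\}$. $E_{a,b}$ are the $n\times n$ matrix units, $O$ is the zero matrix. Hecke–Clifford superalgebra $\mathcal H^c_r$: the $\mathbb Q(v)$-superalgebra with even generators $T_1,\dots,T_{r-1}$, odd generators $c_1,\dots,c_r$ and relations $(T_i-q)(T_i+1)=0$; $T_iT_j=T_jT_i$ for $|i-j|>1$; $T_iT_{i+1}T_i=T_{i+1}T_iT_{i+1}$; $c_i^2=-1$; $c_ic_j=-c_jc_i$ for $i\ne j$; $T_ic_j=c_jT_i$ for $j\ne i,i+1$; $T_ic_i=c_{i+1}T_i$; $T_ic_{i+1}=c_iT_i-(q-1)(c_i-c_{i+1})$. For $w\in\mathfrak S_r$ with reduced expression $s_{i_1}\cdots s_{i_k}$ put $T_w=T_{i_1}\cdots T_{i_k}$. For a composition $\lambda$ of $r$, $\mathfrak S_\lambda$ is the standard Young subgroup, $x_\lambda=\sum_{w\in\mathfrak S_\lambda}T_w$, $\tilde\lambda_k=\lambda_1+\cdots+\lambda_k$. Put $c_{q,i,j}=\sum_{t=i}^{j}q^{j-t}c_t$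 and, for a composition $\lambda$ with $N$ parts and $\alpha\in\{0,1\}^N$, $c_\lambda^\alpha=(c_{q,1,\tilde\lambda_1})^{\alpha_1}(c_{q,\tilde\lambda_1+1,\tilde\lambda_2})^{\alpha_2}\cdots(c_{q,\tilde\lambda_{N-1}+1,\tilde\lambda_N})^{\alpha_N}$. $M_n(\mathbb N|\mathbb Z_2)_r$ is the set of pairs $A^\star=(A^{\bar0}|A^{\bar1})$ with $A^{\bar0}=(a^{\bar0}_{i,j})\in M_n(\mathbb N)$, $A^{\bar1}=(a^{\bar1}_{i,j})\in M_n(\{0,1\})$, such that $A=A^{\bar0}+A^{\bar1}=(a_{i,j})$ has entry sum $r$. Parity: $p(A^\star)=\sum a^{\bar1}_{i,j}\bmod 2$. $\mathrm{ro}(A),\mathrm{co}(A)\in\Lambda(n,r)$ are the vectors of row sums and column sums of $A$. Put $\nu_A=(a_{1,1},\dots,a_{n,1},\dots,a_{1,n},\dots,a_{n,n})$, $\nu_{A^{\bar1}}$ the same reading of $A^{\bar1}$, $c_{A^\star}=c_{\nu_A}^{\nu_{A^{\bar1}}}$. With $\lambda=\mathrm{ro}(A)$, $\mu=\mathrm{co}(A)$, let $d_A\in\mathfrak S_r$ be the shortest element of the double coset $\mathfrak S_\lambda d_A\mathfrak S_\mu$ determined by $|R^\lambda_i\cap d_A(R^\mu_j)|=a_{i,j}$, where $R^\lambda_i=\{\tilde\lambda_{i-1}+1,\dots,\tilde\lambda_i\}$; let $\mathcal D_{\nu}$ be the set of shortest representatives of the right cosets $\mathfrak S_\nu w$ in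 $\mathfrak S_r$. Put $T_{A^\star}=x_\lambda T_{d_A}c_{A^\star}\sum_{\sigma\in\mathcal D_{\nu_A}\cap\mathfrak S_\mu}T_\sigma$. Twisted queer $q$-Schur superalgebra: $\widetilde{\mathcal Q}_v(n,r)=\mathrm{End}^s_{\mathcal H^c_r}\big(\bigoplus_{\lambda\in\Lambda(n,r)}x_\lambda\mathcal H^c_r\big)$, the superalgebra (under composition) spanned by homogeneous linear maps $f$ with $f(mh)=(-1)^{p(f)p(h)}f(m)h$ for homogeneous $h$. It has the $\mathbb Q(v)$-basis $\{\Phi_{A^\star}: A^\star\in M_n(\mathbb N|\mathbb Z_2)_r\}$, where $\Phi_{A^\star}(x_\mu w)=(-1)^{p(A^\star)p(w)}\delta_{\mu,\mathrm{co}(A)}T_{A^\star}w$. Put $[A^\star]=v^{-\partial(A^\star)}\Phi_{A^\star}$, $\partial(A^\star)=\sum_{i\ge k,\,j<l}a_{i,j}a_{k,l}+\sum_{i,j}a^{\bar1}_{i,j}a^{\bar0}_{i,j}$. $U_v$-action: $U_v=U_v(\mathfrak q_n)$ is the quantum queer superalgebra, with even generators $\mathsf K_i^{\pm1},\mathsf E_j,\mathsf F_j$ and odd generators $\mathsf K_{\bar i},\mathsf E_{\bar j},\mathsf F_{\bar j}$ ($1\le i\le n$, $1\le j\le n-1$). It acts on $\widetilde{\mathcal Q}_v(n,r)$ by left multiplication through the superalgebra homomorphism $U_v\to\widetilde{\mathcal Q}_v(n,r)$ with $\mathsf K_i^{\pm1}\mapsto\sum_{\lambda\in\Lambda(n,r)}v^{\pm\lambda_i}[\mathrm{diag}(\lambda)|O]$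 and, with all sums over $\lambda\in\Lambda(n,r-1)$, $\mathsf K_{\bar i}\mapsto\sum[\mathrm{diag}(\lambda)|E_{i,i}]$, $\mathsf E_j\mapsto\sum[\mathrm{diag}(\lambda)+E_{j,j+1}|O]$, $\mathsf E_{\bar j}\mapsto\sum[\mathrm{diag}(\lambda)|E_{j,j+1}]$, $\mathsf F_j\mapsto\sum[\mathrm{diag}(\lambda)+E_{j+1,j}|O]$, $\mathsf F_{\bar j}\mapsto\sum[\mathrm{diag}(\lambda)|E_{j+1,j}]$. Thus a $U_v$-submodule of $\widetilde{\mathcal Q}_v(n,r)$ is a subspace stable under left multiplication by all these elements (no grading required). For $\lambda\in\Lambda(n,r)$ (identified, as a weight, with $v^\lambda=(v^{\lambda_1},\dots,v^{\lambda_n})$), $M_\lambda=\{m\in M:\mathsf K_im=v^{\lambda_i}m\ \text{for all } i\}$. A nonzero $m\in M_\lambda$ with $\mathsf E_jm=\mathsf E_{\bar j}m=0$ for all $1\le j\le n-1$ is a highest weight vector of weight $\lambda$; $M$ has highest weight $\lambda$ if it is generated by such a vector. *)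

theory Defs
  imports
    "HOL-Library.Function_Algebras"
    "HOL-Library.Cardinality"
    "HOL-Computational_Algebra.Polynomial"
    "HOL-Computational_Algebra.Fraction_Field"
    "HOL-Combinatorics.Permutations"
begin

type_synonym qv = "rat poly fract"

definition vv :: qv where "vv = Fract [:0, 1:] 1"

definition qq :: qv where "qq = vv\<^sup>2"

text \<open>
  The algebra is presented by generators and relations: it is the set of formal algebra
  expressions in the generators modulo the least congruence that contains the laws of a unital
  associative algebra over the ground field and the defining relations.
\<close>

datatype hc_term =
    Scal qv
  | TGen nat
  | CGen nat
  | Add hc_term hc_term  (infixl "\<boxplus>" 65)
  | Mul hc_term hc_term  (infixl "\<boxtimes>" 70)

text \<open>
  For rank \<open>r\<close> the generators are \<open>TGen i\<close> for \<open>1 \<le> i < r\<close> and \<open>CGen j\<close> for \<open>1 \<le> j \<le> r\<close>. The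
  remaining symbols are not generators of the algebra of rank \<open>r\<close>; the relations \<open>rel_no_T\<close> and
  \<open>rel_no_C\<close> remove them by setting them to zero.
\<close>

inductive hc_rel :: "nat \<Rightarrow> hc_term \<Rightarrow> hc_term \<Rightarrow> bool" for r where
  rel_no_T: "\<not> (1 \<le> i \<and> i < r) \<Longrightarrow> hc_rel r (TGen i) (Scal 0)"
| rel_no_C: "\<not> (1 \<le> j \<and> j \<le> r) \<Longrightarrow> hc_rel r (CGen j) (Scal 0)"
| rel_quadratic: "1 \<le> i \<Longrightarrow> i < r \<Longrightarrow>
    hc_rel r ((TGen i \<boxplus> Scal (- qq)) \<boxtimes> (TGen i \<boxplus> Scal 1)) (Scal 0)"
| rel_TT_comm: "1 \<le> i \<Longrightarrow> i < r \<Longrightarrow> 1 \<le> j \<Longrightarrow> j < r \<Longrightarrow> i + 1 < j \<or> j + 1 < i \<Longrightarrow>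
    hc_rel r (TGen i \<boxtimes> TGen j) (TGen j \<boxtimes> TGen i)"
| rel_braid: "1 \<le> i \<Longrightarrow> i + 1 < r \<Longrightarrow>
    hc_rel r (TGen i \<boxtimes> TGen (i + 1) \<boxtimes> TGen i) (TGen (i + 1) \<boxtimes> TGen i \<boxtimes> TGen (i + 1))"
| rel_C_square: "1 \<le> i \<Longrightarrow> i \<le> r \<Longrightarrow> hc_rel r (CGen i \<boxtimes> CGen i) (Scal (- 1))"
| rel_CC_anticomm: "1 \<le> i \<Longrightarrow> i \<le> r \<Longrightarrow> 1 \<le> j \<Longrightarrow> j \<le> r \<Longrightarrow> i \<noteq> j \<Longrightarrow>
    hc_rel r (CGen i \<boxtimes> CGen j) (Scal (- 1) \<boxtimes> (CGen j \<boxtimes> CGen i))"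
| rel_TC_comm: "1 \<le> i \<Longrightarrow> i < r \<Longrightarrow> 1 \<le> j \<Longrightarrow> j \<le> r \<Longrightarrow> j \<noteq> i \<Longrightarrow> j \<noteq> i + 1 \<Longrightarrow>
    hc_rel r (TGen i \<boxtimes> CGen j) (CGen j \<boxtimes> TGen i)"
| rel_TC_left: "1 \<le> i \<Longrightarrow> i < r \<Longrightarrow>
    hc_rel r (TGen i \<boxtimes> CGen i) (CGen (i + 1) \<boxtimes> TGen i)"
| rel_TC_right: "1 \<le> i \<Longrightarrow> i < r \<Longrightarrow>
    hc_rel r (TGen i \<boxtimes> CGen (i + 1))
      (CGen i \<boxtimes> TGen i \<boxplus> Scal (- (qq - 1)) \<boxtimes> (CGen i \<boxplus> Scal (- 1) \<boxtimes> CGen (i + 1)))"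

inductive hc_cong :: "nat \<Rightarrow> hc_term \<Rightarrow> hc_term \<Rightarrow> bool" for r where
  hcc_base: "hc_rel r s t \<Longrightarrow> hc_cong r s t"
| hcc_refl: "hc_cong r s s"
| hcc_sym: "hc_cong r s t \<Longrightarrow> hc_cong r t s"
| hcc_trans: "hc_cong r s t \<Longrightarrow> hc_cong r t u \<Longrightarrow> hc_cong r s u"
| hcc_add: "hc_cong r s s' \<Longrightarrow> hc_cong r t t' \<Longrightarrow> hc_cong r (s \<boxplus> t) (s' \<boxplus> t')"
| hcc_mult: "hc_cong r s s' \<Longrightarrow> hc_cong r t t' \<Longrightarrow> hc_cong r (s \<boxtimes> t) (s' \<boxtimes> t')"
| hcc_add_assoc: "hc_cong r (s \<boxplus> t \<boxplus> u) (s \<boxplus> (t \<boxplus> u))"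
| hcc_add_comm: "hc_cong r (s \<boxplus> t) (t \<boxplus> s)"
| hcc_add_zero: "hc_cong r (Scal 0 \<boxplus> s) s"
| hcc_add_neg: "hc_cong r (Scal (- 1) \<boxtimes> s \<boxplus> s) (Scal 0)"
| hcc_mult_assoc: "hc_cong r (s \<boxtimes> t \<boxtimes> u) (s \<boxtimes> (t \<boxtimes> u))"
| hcc_mult_one: "hc_cong r (Scal 1 \<boxtimes> s) s"
| hcc_distrib_right: "hc_cong r ((s \<boxplus> t) \<boxtimes> u) (s \<boxtimes> u \<boxplus> t \<boxtimes> u)"
| hcc_distrib_left: "hc_cong r (s \<boxtimes> (t \<boxplus> u)) (s \<boxtimes> t \<boxplus> s \<boxtimes> u)"
| hcc_scal_add: "hc_cong r (Scal a \<boxplus> Scal b) (Scal (a + b))"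
| hcc_scal_mult: "hc_cong r (Scal a \<boxtimes> Scal b) (Scal (a * b))"
| hcc_scal_central: "hc_cong r (Scal a \<boxtimes> s) (s \<boxtimes> Scal a)"

lemma equivp_hc_cong: "equivp (hc_cong r)"
  by (intro equivpI reflpI sympI transpI) (blast intro: hc_cong.intros)+

text \<open>The rank is the cardinality of the index type.\<close>

quotient_type 'r hc = hc_term / "hc_cong CARD('r::finite)"
  by (rule equivp_hc_cong)

instantiation hc :: (finite) "{ring, monoid_mult}"
begin

lift_definition zero_hc :: "'a hc" is "Scal 0" .
lift_definition one_hc :: "'a hc" is "Scal 1" .
lift_definition plus_hc :: "'a hc \<Rightarrow> 'a hc \<Rightarrow> 'a hc" is Add
  by (rule hcc_add)
lift_definition times_hc :: "'a hc \<Rightarrow> 'a hc \<Rightarrow> 'a hc" is Mul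
  by (rule hcc_mult)
lift_definition uminus_hc :: "'a hc \<Rightarrow> 'a hc" is "\<lambda>s. Scal (- 1) \<boxtimes> s"
  by (rule hcc_mult[OF hcc_refl])
lift_definition minus_hc :: "'a hc \<Rightarrow> 'a hc \<Rightarrow> 'a hc" is "\<lambda>s t. s \<boxplus> Scal (- 1) \<boxtimes> t"
  by (intro hcc_add hcc_mult hcc_refl)

instance
proof
  fix a b c :: "'a hc"
  show "a + b + c = a + (b + c)" by transfer (rule hcc_add_assoc)
  show "a + b = b + a" by transfer (rule hcc_add_comm)
  show "0 + a = a" by transfer (rule hcc_add_zero)
  show "- a + a = 0" by transfer (rule hcc_add_neg)
  show "a - b = a + - b" by transfer (rule hcc_refl)
  show "a * b * c = a * (b * c)" by transfer (rule hcc_mult_assoc)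
  show "(a + b) * c = a * c + b * c" by transfer (rule hcc_distrib_right)
  show "a * (b + c) = a * b + a * c" by transfer (rule hcc_distrib_left)
  show "1 * a = a" by transfer (rule hcc_mult_one)
  show "a * 1 = a"
    by transfer (blast intro: hcc_trans hcc_sym hcc_mult_one hcc_scal_central)
qed

end

lift_definition hc_of_scalar :: "qv \<Rightarrow> 'r::finite hc" is Scal .
lift_definition hc_T :: "nat \<Rightarrow> 'r::finite hc" is TGen .
lift_definition hc_c :: "nat \<Rightarrow> 'r::finite hc" is CGen .

definition hc_scale :: "qv \<Rightarrow> 'r::finite hc \<Rightarrow> 'r hc"
  where "hc_scale a h = hc_of_scalar a * h"

lemma hc_of_scalar_add: "hc_of_scalar (a + b) = hc_of_scalar a + hc_of_scalar b"
  by transfer (rule hcc_sym[OF hcc_scal_add])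

lemma hc_of_scalar_mult: "hc_of_scalar (a * b) = hc_of_scalar a * hc_of_scalar b"
  by transfer (rule hcc_sym[OF hcc_scal_mult])

lemma hc_of_scalar_one: "hc_of_scalar 1 = 1"
  by transfer (rule hcc_refl)

lemma hc_scale_mult_left: "hc_scale a g * h = hc_scale a (g * h)"
  by (simp add: hc_scale_def mult.assoc)

lemma hc_of_scalar_central: "hc_of_scalar a * h = h * hc_of_scalar a"
  by transfer (rule hcc_scal_central)

lemma hc_scale_mult_right: "g * hc_scale a h = hc_scale a (g * h)"
  by (metis hc_of_scalar_central hc_scale_def mult.assoc)

global_interpretation hc: vector_space hc_scale
  by standard
    (simp_all add: hc_scale_def hc_of_scalar_add hc_of_scalar_mult hc_of_scalar_one
      distrib_left distrib_right mult.assoc)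

text \<open>
  The homogeneous components of parity \<open>0\<close> and \<open>1\<close> of the grading in which the \<open>T\<^sub>i\<close> are even and
  the \<open>c\<^sub>j\<close> are odd.
\<close>

inductive hc_homogeneous :: "nat \<Rightarrow> 'r::finite hc \<Rightarrow> bool" where
  hom_scalar: "hc_homogeneous 0 (hc_of_scalar a)"
| hom_T: "hc_homogeneous 0 (hc_T i)"
| hom_c: "hc_homogeneous 1 (hc_c j)"
| hom_add: "hc_homogeneous p g \<Longrightarrow> hc_homogeneous p h \<Longrightarrow> hc_homogeneous p (g + h)"
| hom_mult: "hc_homogeneous p g \<Longrightarrow> hc_homogeneous p' h \<Longrightarrow> hc_homogeneous ((p + p') mod 2) (g * h)"

definition hc_part :: "nat \<Rightarrow> 'r::finite hc set"
  where "hc_part p = {h. hc_homogeneous p h}"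

text \<open>
  A composition with \<open>N\<close> parts is a function on the indices \<open>1, \<dots>, N\<close>, extended by zero. A matrix
  of size \<open>n\<close> is a function on pairs of indices in \<open>1, \<dots>, n\<close>, extended by zero.
\<close>

type_synonym comp = "nat \<Rightarrow> nat"
type_synonym matr = "nat \<Rightarrow> nat \<Rightarrow> nat"

definition Lam :: "nat \<Rightarrow> nat \<Rightarrow> comp set"
  where "Lam n r = {lam. (\<forall>i. i \<notin> {1..n} \<longrightarrow> lam i = 0) \<and> (\<Sum>i=1..n. lam i) = r}"

definition psum :: "comp \<Rightarrow> nat \<Rightarrow> nat"
  where "psum lam k = (\<Sum>i=1..k. lam i)"

definition block :: "comp \<Rightarrow> nat \<Rightarrow> nat set"
  where "block lam i = {psum lam (i - 1) + 1..psum lam i}"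

definition young :: "nat \<Rightarrow> nat \<Rightarrow> comp \<Rightarrow> (nat \<Rightarrow> nat) set"
  where "young r N lam =
    {w. w permutes {1..r} \<and> (\<forall>k\<in>{1..N}. w ` block lam k = block lam k)}"

fun word_perm :: "nat list \<Rightarrow> nat \<Rightarrow> nat" where
  "word_perm [] = id"
| "word_perm (i # ws) = Transposition.transpose i (i + 1) \<circ> word_perm ws"

definition expression :: "nat \<Rightarrow> (nat \<Rightarrow> nat) \<Rightarrow> nat list \<Rightarrow> bool"
  where "expression r w ws \<longleftrightarrow> set ws \<subseteq> {1..<r} \<and> word_perm ws = w"

definition perm_length :: "nat \<Rightarrow> (nat \<Rightarrow> nat) \<Rightarrow> nat"
  where "perm_length r w = (LEAST k. \<exists>ws. expression r w ws \<and> length ws = k)"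

definition reduced_expression :: "nat \<Rightarrow> (nat \<Rightarrow> nat) \<Rightarrow> nat list \<Rightarrow> bool"
  where "reduced_expression r w ws \<longleftrightarrow> expression r w ws \<and> length ws = perm_length r w"

definition shortest_right_reps :: "nat \<Rightarrow> nat \<Rightarrow> comp \<Rightarrow> (nat \<Rightarrow> nat) set"
  where "shortest_right_reps r N nu =
    {w. w permutes {1..r} \<and> (\<forall>x\<in>young r N nu. perm_length r w \<le> perm_length r (x \<circ> w))}"

definition ro :: "nat \<Rightarrow> matr \<Rightarrow> comp"
  where "ro n A = (\<lambda>i. \<Sum>j=1..n. A i j)"

definition co :: "nat \<Rightarrow> matr \<Rightarrow> comp"
  where "co n A = (\<lambda>j. \<Sum>i=1..n. A i j)"

definition dperm :: "nat \<Rightarrow> nat \<Rightarrow> matr \<Rightarrow> (nat \<Rightarrow> nat)"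
  where "dperm r n A = (SOME d. d permutes {1..r} \<and>
    (\<forall>i\<in>{1..n}. \<forall>j\<in>{1..n}. card (block (ro n A) i \<inter> d ` block (co n A) j) = A i j) \<and>
    (\<forall>x\<in>young r n (ro n A). \<forall>y\<in>young r n (co n A). perm_length r d \<le> perm_length r (x \<circ> d \<circ> y)))"

text \<open>The entries read column by column, as a composition with \<open>n * n\<close> parts.\<close>

definition colread :: "nat \<Rightarrow> matr \<Rightarrow> comp"
  where "colread n A =
    (\<lambda>k. if k \<in> {1..n * n} then A ((k - 1) mod n + 1) ((k - 1) div n + 1) else 0)"

definition Tperm :: "(nat \<Rightarrow> nat) \<Rightarrow> 'r::finite hc"
  where "Tperm w = prod_list (map hc_T (SOME ws. reduced_expression CARD('r) w ws))"

definition xx :: "nat \<Rightarrow> comp \<Rightarrow> 'r::finite hc"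
  where "xx N lam = (\<Sum>w\<in>young CARD('r) N lam. Tperm w)"

definition cq :: "nat \<Rightarrow> nat \<Rightarrow> 'r::finite hc"
  where "cq i j = (\<Sum>t=i..j. hc_scale (qq ^ (j - t)) (hc_c t))"

definition cpow :: "nat \<Rightarrow> comp \<Rightarrow> comp \<Rightarrow> 'r::finite hc"
  where "cpow N lam alpha =
    prod_list (map (\<lambda>k. cq (psum lam (k - 1) + 1) (psum lam k) ^ alpha k) [1..<N + 1])"

text \<open>In the following, the pair \<open>(A0, A1)\<close> of matrices stands for the supermatrix \<open>(A0 | A1)\<close>.\<close>

definition Tmat :: "nat \<Rightarrow> matr \<Rightarrow> matr \<Rightarrow> 'r::finite hc"
  where "Tmat n A0 A1 =
    (let A = A0 + A1; nu = colread n A in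
      xx n (ro n A) * Tperm (dperm CARD('r) n A) * cpow (n * n) nu (colread n A1) *
      (\<Sum>w \<in> shortest_right_reps CARD('r) (n * n) nu \<inter> young CARD('r) n (co n A). Tperm w))"

definition mparity :: "nat \<Rightarrow> matr \<Rightarrow> nat"
  where "mparity n A1 = (\<Sum>i=1..n. \<Sum>j=1..n. A1 i j) mod 2"

text \<open>
  The external direct sum of the right ideals \<open>x\<^sub>\<lambda> H\<close> consists of the families of elements of
  \<open>H\<close> indexed by compositions whose component at \<open>\<lambda> \<in> \<Lambda>(n,r)\<close> lies in \<open>x\<^sub>\<lambda> H\<close> and which vanish
  at all other indices.
\<close>

type_synonym 'r vfam = "comp \<Rightarrow> 'r hc"

definition vspace :: "nat \<Rightarrow> 'r::finite vfam set"
  where "vspace n = {m. (\<forall>lam\<in>Lam n CARD('r). m lam \<in> range (\<lambda>h. xx n lam * h)) \<and>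
    (\<forall>lam. lam \<notin> Lam n CARD('r) \<longrightarrow> m lam = 0)}"

definition vpart :: "nat \<Rightarrow> nat \<Rightarrow> 'r::finite vfam set"
  where "vpart n p = {m \<in> vspace n. \<forall>lam. m lam \<in> hc_part p}"

definition vscale :: "qv \<Rightarrow> 'r::finite vfam \<Rightarrow> 'r vfam"
  where "vscale a m = (\<lambda>lam. hc_scale a (m lam))"

definition vact :: "'r::finite vfam \<Rightarrow> 'r hc \<Rightarrow> 'r vfam"
  where "vact m h = (\<lambda>lam. m lam * h)"

definition vsingle :: "comp \<Rightarrow> 'r::finite hc \<Rightarrow> 'r vfam"
  where "vsingle mu h = (\<lambda>lam. if lam = mu then h else 0)"

text \<open>
  Endomorphisms of the direct sum are extended by zero outside \<open>vspace n\<close>, so that they are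
  determined by their values on \<open>vspace n\<close>; sums, scalar multiples and composites have the same
  property.
\<close>

type_synonym 'r endo = "'r vfam \<Rightarrow> 'r vfam"

definition endo_scale :: "qv \<Rightarrow> 'r::finite endo \<Rightarrow> 'r endo"
  where "endo_scale a f = (\<lambda>m. vscale a (f m))"

global_interpretation endo: vector_space endo_scale
  by standard
    (simp_all add: fun_eq_iff endo_scale_def vscale_def hc.scale_right_distrib
      hc.scale_left_distrib)

definition super_endo :: "nat \<Rightarrow> nat \<Rightarrow> 'r::finite endo set"
  where "super_endo n p = {f.
    (\<forall>m. m \<notin> vspace n \<longrightarrow> f m = 0) \<and>
    (\<forall>m\<in>vspace n. f m \<in> vspace n) \<and>
    (\<forall>m\<in>vspace n. \<forall>m'\<in>vspace n. f (m + m') = f m + f m') \<and>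
    (\<forall>a. \<forall>m\<in>vspace n. f (vscale a m) = vscale a (f m)) \<and>
    (\<forall>a\<in>{0,1}. \<forall>m\<in>vpart n a. f m \<in> vpart n ((p + a) mod 2)) \<and>
    (\<forall>a\<in>{0,1}. \<forall>m\<in>vspace n. \<forall>h\<in>hc_part a. f (vact m h) = vscale ((- 1) ^ (p * a)) (vact (f m) h))}"

definition qschur :: "nat \<Rightarrow> 'r::finite endo set"
  where "qschur n = endo.span (super_endo n 0 \<union> super_endo n 1)"

text \<open>
  The prescribed values determine \<open>Phi n A0 A1\<close> uniquely, because the elements \<open>x\<^sub>\<mu> h\<close> with \<open>h\<close>
  homogeneous span the direct sum. That a map with these values exists (for \<open>(A0 | A1)\<close> a
  supermatrix with entry sum \<open>r\<close>) is part of the basis theorem of the superalgebra.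
\<close>

definition Phi :: "nat \<Rightarrow> matr \<Rightarrow> matr \<Rightarrow> 'r::finite endo"
  where "Phi n A0 A1 = (THE f. f \<in> qschur n \<and>
    (\<forall>mu\<in>Lam n CARD('r). \<forall>a\<in>{0,1}. \<forall>h\<in>hc_part a.
      f (vsingle mu (xx n mu * h)) =
        (if mu = co n (A0 + A1)
         then vscale ((- 1) ^ (mparity n A1 * a)) (vsingle (ro n (A0 + A1)) (Tmat n A0 A1 * h))
         else 0)))"

definition pdeg :: "nat \<Rightarrow> matr \<Rightarrow> matr \<Rightarrow> nat"
  where "pdeg n A0 A1 =
    (let A = A0 + A1 in
      (\<Sum>i=1..n. \<Sum>j=1..n. \<Sum>k=1..i. \<Sum>l=j + 1..n. A i j * A k l) +
      (\<Sum>i=1..n. \<Sum>j=1..n. A1 i j * A0 i j))"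

definition std :: "nat \<Rightarrow> matr \<Rightarrow> matr \<Rightarrow> 'r::finite endo"
  where "std n A0 A1 = endo_scale (vv powi (- int (pdeg n A0 A1))) (Phi n A0 A1)"

definition diagm :: "comp \<Rightarrow> matr"
  where "diagm lam = (\<lambda>i j. if i = j then lam i else 0)"

definition munit :: "nat \<Rightarrow> nat \<Rightarrow> matr"
  where "munit a b = (\<lambda>i j. if i = a \<and> j = b then 1 else 0)"

text \<open>
  The quantum queer superalgebra acts through left multiplication by the images of its
  generators, so these images are all that is needed to define submodules, weights and highest
  weight vectors. A suffix \<open>bar\<close> marks the images of the odd generators.
\<close>

definition K_gen :: "nat \<Rightarrow> nat \<Rightarrow> 'r::finite endo"
  where "K_gen n i = (\<Sum>lam\<in>Lam n CARD('r). endo_scale (vv powi int (lam i)) (std n (diagm lam) 0))"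

definition Kinv_gen :: "nat \<Rightarrow> nat \<Rightarrow> 'r::finite endo"
  where "Kinv_gen n i =
    (\<Sum>lam\<in>Lam n CARD('r). endo_scale (vv powi (- int (lam i))) (std n (diagm lam) 0))"

definition Kbar_gen :: "nat \<Rightarrow> nat \<Rightarrow> 'r::finite endo"
  where "Kbar_gen n i = (\<Sum>lam\<in>Lam n (CARD('r) - 1). std n (diagm lam) (munit i i))"

definition E_gen :: "nat \<Rightarrow> nat \<Rightarrow> 'r::finite endo"
  where "E_gen n j = (\<Sum>lam\<in>Lam n (CARD('r) - 1). std n (diagm lam + munit j (j + 1)) 0)"

definition Ebar_gen :: "nat \<Rightarrow> nat \<Rightarrow> 'r::finite endo"
  where "Ebar_gen n j = (\<Sum>lam\<in>Lam n (CARD('r) - 1). std n (diagm lam) (munit j (j + 1)))"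

definition F_gen :: "nat \<Rightarrow> nat \<Rightarrow> 'r::finite endo"
  where "F_gen n j = (\<Sum>lam\<in>Lam n (CARD('r) - 1). std n (diagm lam + munit (j + 1) j) 0)"

definition Fbar_gen :: "nat \<Rightarrow> nat \<Rightarrow> 'r::finite endo"
  where "Fbar_gen n j = (\<Sum>lam\<in>Lam n (CARD('r) - 1). std n (diagm lam) (munit (j + 1) j))"

definition Uv_gens :: "nat \<Rightarrow> 'r::finite endo set"
  where "Uv_gens n =
    (\<Union>i\<in>{1..n}. {K_gen n i, Kinv_gen n i, Kbar_gen n i}) \<union>
    (\<Union>j\<in>{1..n - 1}. {E_gen n j, Ebar_gen n j, F_gen n j, Fbar_gen n j})"

definition Uv_submodule :: "nat \<Rightarrow> 'r::finite endo set \<Rightarrow> bool"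
  where "Uv_submodule n M \<longleftrightarrow>
    M \<subseteq> qschur n \<and> endo.subspace M \<and> (\<forall>u\<in>Uv_gens n. \<forall>m\<in>M. u \<circ> m \<in> M)"

definition Uv_generated :: "nat \<Rightarrow> 'r::finite endo \<Rightarrow> 'r endo set"
  where "Uv_generated n m = \<Inter> {N. Uv_submodule n N \<and> m \<in> N}"

definition irreducible_Uv_submodule :: "nat \<Rightarrow> 'r::finite endo set \<Rightarrow> bool"
  where "irreducible_Uv_submodule n M \<longleftrightarrow>
    Uv_submodule n M \<and> M \<noteq> {0} \<and> (\<forall>N. Uv_submodule n N \<and> N \<subseteq> M \<longrightarrow> N = {0} \<or> N = M)"

definition weight_space :: "nat \<Rightarrow> 'r::finite endo set \<Rightarrow> comp \<Rightarrow> 'r endo set"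
  where "weight_space n M lam =
    {m \<in> M. \<forall>i\<in>{1..n}. K_gen n i \<circ> m = endo_scale (vv ^ lam i) m}"

definition highest_weight_vector :: "nat \<Rightarrow> 'r::finite endo set \<Rightarrow> comp \<Rightarrow> 'r endo \<Rightarrow> bool"
  where "highest_weight_vector n M lam m \<longleftrightarrow>
    m \<noteq> 0 \<and> m \<in> weight_space n M lam \<and>
    (\<forall>j\<in>{1..n - 1}. E_gen n j \<circ> m = 0 \<and> Ebar_gen n j \<circ> m = 0)"

definition has_highest_weight :: "nat \<Rightarrow> 'r::finite endo set \<Rightarrow> comp \<Rightarrow> bool"
  where "has_highest_weight n M lam \<longleftrightarrow>
    (\<exists>m. highest_weight_vector n M lam m \<and> M = Uv_generated n m)"

definition omega :: "nat \<Rightarrow> comp"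
  where "omega r = (\<lambda>i. if i = 1 then r else 0)"

end

theory Submission
  imports Defs "HOL-Computational_Algebra.Field_as_Ring"
    "HOL-Computational_Algebra.Polynomial_Factorial"
begin

text \<open>
  Write \<open>H\<close> for the Hecke--Clifford superalgebra, \<open>x = x\<^sub>\<omega>\<close> for the sum of all \<open>T\<^sub>w\<close>, and \<open>Q\<close> for the
  twisted queer Schur superalgebra. The images of the generators of the quantum group lie in \<open>Q\<close>, so
  for a nonzero \<open>m\<close> in the \<open>\<omega>\<close>-weight space of an irreducible \<open>M\<close> the nonzero submodule \<open>M \<inter> Q m\<close>
  is all of \<open>M\<close>. The weight space consists of the elements of \<open>M\<close> with image in the summand \<open>x H\<close>.
  If \<open>e\<close> is the projection onto this summand, the weight space is therefore contained in
  \<open>e Q e m\<close>, where \<open>e Q e\<close> is the algebra of endomorphisms of \<open>x H\<close>.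

  A homogeneous endomorphism of \<open>x H\<close> is given by the image \<open>z\<close> of \<open>x\<close>, which satisfies
  \<open>z T\<^sub>s = q z\<close> for all \<open>s\<close>. Then \<open>z x\<close> is a nonzero multiple of \<open>z\<close>, namely by the Poincare
  polynomial, so \<open>z\<close> lies in \<open>x H x\<close>. Inside \<open>x H x\<close> a product of Clifford generators can be
  shortened by moving \<open>T\<^sub>s\<close> through it, and what remains is spanned by \<open>x x\<close> and \<open>x c\<^sub>1 x\<close>, or
  equivalently by \<open>x\<close> and \<open>x c\<^sub>q\<close> (\<open>T_eigen_in_full_ideal\<close>). The second vector belongs to the
  odd generator \<open>K\<close> with index \<open>1\<close>. Hence the weight space is spanned by \<open>m\<close> and \<open>K m\<close>
  (\<open>weight_space_omega_subset_span\<close>).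

  On the weight space \<open>K\<^sup>2\<close> is a nonzero square times \<open>1 + v\<^sup>4 + \<dots> + v\<^bsup>4(r-1)\<^esup>\<close>. For \<open>r > 1\<close> this
  scalar is not a square in the ground field, so \<open>K\<close> has no eigenvector and \<open>m\<close>, \<open>K m\<close> are
  independent. For \<open>r = 1\<close> it is a square, so \<open>K\<close> has an eigenvector \<open>m'\<close> in the weight space,
  which is then spanned by \<open>m'\<close> alone.

  That the generators act through \<open>Q\<close> requires the existence of \<open>\<Phi>\<^bsub>A\<^esub>\<close> for their matrices,
  that is, \<open>T\<^bsub>A\<^esub> \<in> H x\<^sub>\<mu>\<close>. For these matrices \<open>d\<^sub>A\<close> is the identity
  (\<open>dperm_identity_coset\<close>), and \<open>x\<^sub>\<lambda> c\<^bsub>A\<^esub>\<close> is again a common eigenvector of the \<open>T\<^sub>s\<close> of the Young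
  subgroup of \<open>\<nu>\<close>, so that the trick with the Poincare polynomial applies once more
  (\<open>Tmat_in_left_ideal\<close>). The combinatorial input is Matsumoto's theorem and the
  factorisation of a Young subgroup through shortest coset representatives.
\<close>

section \<open>Lengths and reduced words of permutations\<close>

abbreviation adj :: "nat \<Rightarrow> nat \<Rightarrow> nat"
  where "adj i \<equiv> Transposition.transpose i (Suc i)"

lemma word_perm_Cons: "word_perm (i # ws) = adj i \<circ> word_perm ws"
  by simp

lemma adj_adj: "adj i \<circ> (adj i \<circ> w) = w"
  by (simp add: fun_eq_iff)

lemma adj_permutes: "1 \<le> i \<Longrightarrow> i < r \<Longrightarrow> adj i permutes {1..r}"
  by (rule permutes_swap_id) auto

lemma word_perm_append: "word_perm (us @ vs) = word_perm us \<circ> word_perm vs"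
  by (induction us) (simp_all add: comp_assoc word_perm_Cons)

lemma word_perm_permutes: "set ws \<subseteq> {1..<r} \<Longrightarrow> word_perm ws permutes {1..r}"
proof (induction ws)
  case Nil
  then show ?case by (simp add: permutes_id id_def[symmetric])
next
  case (Cons i ws)
  then show ?case
    unfolding word_perm_Cons by (intro permutes_compose adj_permutes) auto
qed

definition inversions :: "nat \<Rightarrow> (nat \<Rightarrow> nat) \<Rightarrow> (nat \<times> nat) set"
  where "inversions r w = {(a, b). 1 \<le> a \<and> a < b \<and> b \<le> r \<and> w b < w a}"

lemma finite_inversions [simp]: "finite (inversions r w)"
  by (rule finite_subset[of _ "{1..r} \<times> {1..r}"]) (auto simp: inversions_def)

lemma inversions_id [simp]: "inversions r id = {}"
  by (auto simp: inversions_def)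

lemma adj_comp_permutes: "w permutes {1..r} \<Longrightarrow> 1 \<le> i \<Longrightarrow> i < r \<Longrightarrow> adj i \<circ> w permutes {1..r}"
  by (intro permutes_compose adj_permutes)

lemma card_inversions_adj_ascent:
  assumes w: "w permutes {1..r}" and i: "1 \<le> i" "i < r"
    and asc: "inv w i < inv w (Suc i)"
  shows "card (inversions r (adj i \<circ> w)) = Suc (card (inversions r w))"
proof -
  define p q where "p = inv w i" and "q = inv w (Suc i)"
  have bij: "bij w" using w by (rule permutes_bij)
  have wp: "w p = i" "w q = Suc i"
    by (simp_all add: p_def q_def bij bij_is_surj surj_f_inv_f)
  have iff: "w x = i \<longleftrightarrow> x = p" "w x = Suc i \<longleftrightarrow> x = q" for x
    using inj_eq[OF bij_is_inj[OF bij], of x p] inj_eq[OF bij_is_inj[OF bij], of x q] wp by auto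
  have pq: "1 \<le> p" "p < q" "q \<le> r"
    using asc i permutes_in_image[OF permutes_inv[OF w], of i]
      permutes_in_image[OF permutes_inv[OF w], of "Suc i"] by (auto simp: p_def q_def)
  have sm: "adj i x < adj i y \<longleftrightarrow> (x < y \<or> (x = Suc i \<and> y = i)) \<and> \<not> (x = i \<and> y = Suc i)"
    for x y by (auto simp: transpose_def)
  have "inversions r (adj i \<circ> w) = insert (p, q) (inversions r w)"
    using pq by (auto simp: inversions_def sm iff wp)
  moreover have "(p, q) \<notin> inversions r w"
    by (simp add: inversions_def wp)
  ultimately show ?thesis by simp
qed

lemma inv_adj_comp:
  assumes "w permutes S"
  shows "inv (adj i \<circ> w) = inv w \<circ> adj i"
  using assms by (subst o_inv_distrib) (auto intro: permutes_bij)

lemma card_inversions_adj_descent: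
  assumes w: "w permutes {1..r}" and i: "1 \<le> i" "i < r"
    and desc: "inv w (Suc i) < inv w i"
  shows "card (inversions r w) = Suc (card (inversions r (adj i \<circ> w)))"
proof -
  have "card (inversions r (adj i \<circ> (adj i \<circ> w))) = Suc (card (inversions r (adj i \<circ> w)))"
    by (rule card_inversions_adj_ascent[OF permutes_compose[OF w adj_permutes[OF i]] i])
      (simp add: inv_adj_comp[OF w] desc)
  then show ?thesis by (simp only: adj_adj)
qed

lemma inv_adjacent_neq: "w permutes S \<Longrightarrow> inv w i \<noteq> inv w (Suc i)"
  by (metis n_not_Suc_n permutes_inverses(1))

text \<open>
  A permutation without descents is increasing on \<open>{1..r}\<close>; squeezing its values from below and
  from above leaves only the identity.
\<close>

lemma permutes_without_descent:
  assumes u: "u permutes {1..r}" and asc: "\<And>i. 1 \<le> i \<Longrightarrow> i < r \<Longrightarrow> u i < u (Suc i)"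
  shows "u = id"
proof -
  have low: "1 \<le> a \<Longrightarrow> a \<le> r \<Longrightarrow> a \<le> u a" for a
  proof (induction a rule: nat_induct_at_least[of 1])
    case base
    then show ?case using permutes_in_image[OF u, of 1] by auto
  next
    case (Suc a)
    then show ?case using asc[of a] by fastforce
  qed
  have up: "d < r \<Longrightarrow> u (r - d) \<le> r - d" for d
  proof (induction d)
    case 0
    then show ?case using permutes_in_image[OF u, of r] by auto
  next
    case (Suc d)
    then have "u (r - Suc d) < u (Suc (r - Suc d))"
      by (intro asc) auto
    also have "Suc (r - Suc d) = r - d"
      using Suc.prems by simp
    finally show ?case using Suc by simp
  qed
  show ?thesis
  proof
    fix a
    show "u a = id a"
      using low[of a] up[of "r - a"] permutes_not_in[OF u, of a]
      by (cases "a \<in> {1..r}") force+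
  qed
qed

lemma card_inversions_word_perm_le:
  "set ws \<subseteq> {1..<r} \<Longrightarrow> card (inversions r (word_perm ws)) \<le> length ws"
proof (induction ws)
  case Nil
  then show ?case by (simp del: id_apply)
next
  case (Cons i ws)
  then have p: "word_perm ws permutes {1..r}" by (intro word_perm_permutes) auto
  from Cons.prems have i: "1 \<le> i" "i < r" by auto
  have "card (inversions r (adj i \<circ> word_perm ws)) \<le> Suc (card (inversions r (word_perm ws)))"
    using card_inversions_adj_ascent[OF p i] card_inversions_adj_descent[OF p i]
      inv_adjacent_neq[OF p, of i]
    by (cases "inv (word_perm ws) i < inv (word_perm ws) (Suc i)") auto
  also have "card (inversions r (word_perm ws)) \<le> length ws"
    using Cons by simp
  finally show ?case
    by (simp only: word_perm_Cons length_Cons)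
qed

text \<open>
  Bubble sort: as long as \<open>w\<close> is not the identity, \<open>w\<^sup>-\<^sup>1\<close> has a descent, and the adjacent
  transposition there removes one inversion.
\<close>

lemma exists_expression_of_inversions:
  assumes "w permutes {1..r}"
  shows "\<exists>ws. expression r w ws \<and> length ws = card (inversions r w)"
  using assms
proof (induction "card (inversions r w)" arbitrary: w)
  case 0
  have "inv w = id"
  proof (rule permutes_without_descent)
    show "inv w permutes {1..r}" using 0 by (intro permutes_inv)
    show "inv w i < inv w (Suc i)" if "1 \<le> i" "i < r" for i
      using that 0 card_inversions_adj_descent[of w r i] inv_adjacent_neq[of w _ i]
      by (metis linorder_neqE_nat nat.distinct(1))
  qed
  then have "w = id"
    using 0 by (metis inv_id permutes_inv_inv)
  then show ?case
    using 0 by (intro exI[of _ "[]"]) (auto simp: expression_def)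
next
  case (Suc k)
  have "\<exists>i. 1 \<le> i \<and> i < r \<and> inv w (Suc i) < inv w i"
  proof (rule ccontr)
    assume *: "\<not> ?thesis"
    have "inv w = id"
    proof (rule permutes_without_descent)
      show "inv w permutes {1..r}" using Suc by (intro permutes_inv)
      show "inv w i < inv w (Suc i)" if "1 \<le> i" "i < r" for i
        using * that inv_adjacent_neq[OF Suc.prems, of i] by (metis linorder_neqE_nat)
    qed
    then have "w = id"
      using Suc.prems by (metis inv_id permutes_inv_inv)
    then show False
      using Suc.hyps(2) by simp
  qed
  then obtain i where i: "1 \<le> i" "i < r" "inv w (Suc i) < inv w i" by blast
  then have "k = card (inversions r (adj i \<circ> w))"
    using card_inversions_adj_descent[OF Suc.prems i] Suc.hyps by simp
  moreover have "adj i \<circ> w permutes {1..r}"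
    using i Suc.prems by (intro permutes_compose adj_permutes)
  ultimately obtain ws where ws: "expression r (adj i \<circ> w) ws" "length ws = k"
    using Suc.hyps(1) by metis
  then have "word_perm (i # ws) = w"
    unfolding expression_def word_perm_Cons by (simp only: adj_adj)
  then show ?case
    using ws i Suc.hyps(2) by (intro exI[of _ "i # ws"]) (auto simp: expression_def)
qed

lemma perm_length_eq_inversions:
  assumes "w permutes {1..r}"
  shows "perm_length r w = card (inversions r w)"
  unfolding perm_length_def
proof (rule Least_equality)
  show "\<exists>ws. expression r w ws \<and> length ws = card (inversions r w)"
    by (rule exists_expression_of_inversions[OF assms])
next
  fix k
  assume "\<exists>ws. expression r w ws \<and> length ws = k"
  then show "card (inversions r w) \<le> k"
    using card_inversions_word_perm_le by (auto simp: expression_def)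
qed

lemma perm_length_adj_ascent:
  assumes "w permutes {1..r}" "1 \<le> i" "i < r" "inv w i < inv w (Suc i)"
  shows "perm_length r (adj i \<circ> w) = Suc (perm_length r w)"
  using card_inversions_adj_ascent[OF assms]
  by (simp only: perm_length_eq_inversions[OF assms(1)]
      perm_length_eq_inversions[OF adj_comp_permutes[OF assms(1-3)]])

lemma perm_length_adj_descent:
  assumes "w permutes {1..r}" "1 \<le> i" "i < r" "inv w (Suc i) < inv w i"
  shows "perm_length r w = Suc (perm_length r (adj i \<circ> w))"
  using card_inversions_adj_descent[OF assms]
  by (simp only: perm_length_eq_inversions[OF assms(1)]
      perm_length_eq_inversions[OF adj_comp_permutes[OF assms(1-3)]])

lemma ascent_iff_perm_length:
  assumes "w permutes {1..r}" "1 \<le> i" "i < r"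
  shows "inv w i < inv w (Suc i) \<longleftrightarrow> perm_length r w < perm_length r (adj i \<circ> w)"
  using perm_length_adj_ascent[OF assms] perm_length_adj_descent[OF assms]
    inv_adjacent_neq[OF assms(1), of i] by fastforce

lemma exists_reduced_expression:
  "w permutes {1..r} \<Longrightarrow> \<exists>ws. reduced_expression r w ws"
  using exists_expression_of_inversions
  by (auto simp: reduced_expression_def perm_length_eq_inversions)

lemma perm_length_le: "expression r w ws \<Longrightarrow> perm_length r w \<le> length ws"
  unfolding perm_length_def by (rule Least_le) auto

lemma perm_length_id [simp]: "perm_length r id = 0"
  using perm_length_le[of r id "[]"] by (simp add: expression_def)

lemma perm_length_eq_0_iff: "w permutes {1..r} \<Longrightarrow> perm_length r w = 0 \<longleftrightarrow> w = id"
  using exists_reduced_expression[of w r]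
  by (auto simp: reduced_expression_def expression_def)

lemma word_perm_rev:
  assumes "set ws \<subseteq> {1..<r}"
  shows "word_perm (rev ws) = inv (word_perm ws)"
  using assms
proof (induction ws)
  case Nil
  then show ?case by simp
next
  case (Cons i ws)
  then have p: "word_perm ws permutes {1..r}" by (intro word_perm_permutes) auto
  then have "inv (word_perm (i # ws)) = inv (word_perm ws) \<circ> adj i"
    unfolding word_perm_Cons by (rule inv_adj_comp)
  moreover have "word_perm (rev (i # ws)) = word_perm (rev ws) \<circ> adj i"
    by (simp add: word_perm_append)
  ultimately show ?case
    using Cons by (simp only: list.set(2) insert_subset)
qed

lemma perm_length_inv_le: "w permutes {1..r} \<Longrightarrow> perm_length r (inv w) \<le> perm_length r w"
proof -
  assume "w permutes {1..r}"
  then obtain ws where ws: "reduced_expression r w ws"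
    using exists_reduced_expression by blast
  then have "expression r (inv w) (rev ws)"
    using word_perm_rev[of ws r] by (auto simp: reduced_expression_def expression_def)
  then show ?thesis
    using perm_length_le ws by (fastforce simp: reduced_expression_def)
qed

lemma perm_length_inv: "w permutes {1..r} \<Longrightarrow> perm_length r (inv w) = perm_length r w"
  by (metis antisym perm_length_inv_le permutes_inv permutes_inv_inv)

lemma reduced_expression_Cons:
  assumes "reduced_expression r w (i # ws)"
  shows "w permutes {1..r}" "1 \<le> i" "i < r" "reduced_expression r (adj i \<circ> w) ws"
    "inv w (Suc i) < inv w i"
proof -
  have w: "w = adj i \<circ> word_perm ws" and s: "set (i # ws) \<subseteq> {1..<r}"
    and l: "perm_length r w = Suc (length ws)"
    using assms by (auto simp: reduced_expression_def expression_def)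
  show p: "w permutes {1..r}"
    using word_perm_permutes[OF s] w by (simp only: word_perm_Cons)
  show i: "1 \<le> i" "i < r" using s by auto
  have aw: "adj i \<circ> w = word_perm ws" by (simp only: w adj_adj)
  have le: "perm_length r (adj i \<circ> w) \<le> length ws"
    by (rule perm_length_le) (use s aw in \<open>auto simp: expression_def\<close>)
  then show d: "inv w (Suc i) < inv w i"
    using l ascent_iff_perm_length[OF p i] inv_adjacent_neq[OF p, of i]
    by (metis le_imp_less_Suc linorder_neqE_nat order_less_asym)
  show "reduced_expression r (adj i \<circ> w) ws"
    using perm_length_adj_descent[OF p i d] l s aw
    by (auto simp: reduced_expression_def expression_def)
qed

lemma reduced_expression_ConsI:
  assumes "w permutes {1..r}" "1 \<le> i" "i < r" "inv w (Suc i) < inv w i"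
    and "reduced_expression r (adj i \<circ> w) ws"
  shows "reduced_expression r w (i # ws)"
proof -
  have "adj i \<circ> word_perm ws = w"
    using assms(5) by (simp only: reduced_expression_def expression_def adj_adj)
  then have "word_perm (i # ws) = w" by (simp only: word_perm_Cons)
  then show ?thesis
    using assms perm_length_adj_descent[OF assms(1-4)]
    by (auto simp: reduced_expression_def expression_def simp del: word_perm.simps)
qed

text \<open>
  Matsumoto's theorem. If two reduced words of \<open>w\<close> begin with different letters \<open>i\<close> and \<open>j\<close>, both
  are descents of \<open>w\<close>, so \<open>w\<close> also has reduced words that begin with the two sides of the braid
  relation between \<open>i\<close> and \<open>j\<close> and agree afterwards. Each given word shares its first letter with
  one of these, and the induction hypothesis applies to the tails.
\<close>

theorem prod_list_reduced_expression_unique: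
  fixes f :: "nat \<Rightarrow> 'a::monoid_mult"
  assumes comm: "\<And>i j. 1 \<le> i \<Longrightarrow> j < r \<Longrightarrow> Suc i < j \<Longrightarrow> f i * f j = f j * f i"
    and braid: "\<And>i. 1 \<le> i \<Longrightarrow> Suc i < r \<Longrightarrow> f i * f (Suc i) * f i = f (Suc i) * f i * f (Suc i)"
    and "reduced_expression r w us" and "reduced_expression r w vs"
  shows "prod_list (map f us) = prod_list (map f vs)"
  using assms(3,4)
proof (induction "length us" arbitrary: w us vs rule: less_induct)
  case less
  have len: "length vs = length us"
    using less.prems by (simp add: reduced_expression_def)
  show ?case
  proof (cases us)
    case Nil
    then show ?thesis using len by simp
  next
    case us: (Cons i u)
    then obtain j v where vs: "vs = j # v"
      using len by (cases vs) auto
    note I = reduced_expression_Cons[OF less.prems(1)[unfolded us]]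
    note J = reduced_expression_Cons[OF less.prems(2)[unfolded vs]]
    note p = I(1)
    have IHu: "prod_list (map f u) = prod_list (map f z)"
      if "reduced_expression r (adj i \<circ> w) z" for z
      by (rule less.hyps[OF _ I(4) that]) (simp add: us)
    have IHv: "prod_list (map f v) = prod_list (map f z)"
      if "reduced_expression r (adj j \<circ> w) z" for z
      by (rule less.hyps[OF _ J(4) that]) (use len in \<open>simp add: us vs\<close>)
    have pi: "adj i \<circ> w permutes {1..r}" and pj: "adj j \<circ> w permutes {1..r}"
      using permutes_compose[OF p adj_permutes[OF I(2,3)]]
        permutes_compose[OF p adj_permutes[OF J(2,3)]] by blast+
    \<comment> \<open>In the next two claims \<open>a\<close> and \<open>b\<close> are \<open>i\<close> and \<open>j\<close> in increasing order.\<close>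
    have far: "\<exists>z. reduced_expression r (adj a \<circ> w) (b # z) \<and> reduced_expression r (adj b \<circ> w) (a # z)"
      if "{a, b} = {i, j}" and ab: "Suc a < b" for a b
    proof -
      have A: "1 \<le> a" "a < r" "inv w (Suc a) < inv w a" "adj a \<circ> w permutes {1..r}"
        and B: "1 \<le> b" "b < r" "inv w (Suc b) < inv w b" "adj b \<circ> w permutes {1..r}"
        using that(1) I J pi pj by (auto simp: doubleton_eq_iff)
      have eq: "adj a \<circ> (adj b \<circ> w) = adj b \<circ> (adj a \<circ> w)"
        using ab by (auto simp: fun_eq_iff transpose_def)
      obtain z where z: "reduced_expression r (adj b \<circ> (adj a \<circ> w)) z"
        using exists_reduced_expression permutes_compose[OF A(4) adj_permutes[OF B(1,2)]] by blast
      have "reduced_expression r (adj a \<circ> w) (b # z)"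
        by (rule reduced_expression_ConsI[OF A(4) B(1,2) _ z])
          (use ab B in \<open>auto simp: inv_adj_comp[OF p] transpose_def\<close>)
      moreover have "reduced_expression r (adj b \<circ> w) (a # z)"
        by (rule reduced_expression_ConsI[OF B(4) A(1,2) _ z[folded eq]])
          (use ab A in \<open>auto simp: inv_adj_comp[OF p] transpose_def\<close>)
      ultimately show ?thesis by blast
    qed
    have near: "\<exists>z. reduced_expression r (adj a \<circ> w) (b # a # z) \<and>
        reduced_expression r (adj b \<circ> w) (a # b # z)"
      if "{a, b} = {i, j}" and ab: "b = Suc a" for a b
    proof -
      have A: "1 \<le> a" "a < r" "inv w (Suc a) < inv w a" "adj a \<circ> w permutes {1..r}"
        and B: "1 \<le> b" "b < r" "inv w (Suc b) < inv w b" "adj b \<circ> w permutes {1..r}"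
        using that(1) I J pi pj by (auto simp: doubleton_eq_iff)
      have pba: "adj b \<circ> (adj a \<circ> w) permutes {1..r}" and pab: "adj a \<circ> (adj b \<circ> w) permutes {1..r}"
        using permutes_compose[OF A(4) adj_permutes[OF B(1,2)]]
          permutes_compose[OF B(4) adj_permutes[OF A(1,2)]] by blast+
      have eq: "adj b \<circ> (adj a \<circ> (adj b \<circ> w)) = adj a \<circ> (adj b \<circ> (adj a \<circ> w))"
        using ab by (auto simp: fun_eq_iff transpose_def)
      obtain z where z: "reduced_expression r (adj a \<circ> (adj b \<circ> (adj a \<circ> w))) z"
        using exists_reduced_expression permutes_compose[OF pba adj_permutes[OF A(1,2)]] by blast
      have za: "reduced_expression r (adj b \<circ> (adj a \<circ> w)) (a # z)"
        by (rule reduced_expression_ConsI[OF pba A(1,2) _ z])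
          (unfold inv_adj_comp[OF A(4)] inv_adj_comp[OF p], use ab B in \<open>simp add: transpose_def\<close>)
      have zb: "reduced_expression r (adj a \<circ> (adj b \<circ> w)) (b # z)"
        by (rule reduced_expression_ConsI[OF pab B(1,2) _ z[folded eq]])
          (unfold inv_adj_comp[OF B(4)] inv_adj_comp[OF p], use ab A in \<open>simp add: transpose_def\<close>)
      have "reduced_expression r (adj a \<circ> w) (b # a # z)"
        by (rule reduced_expression_ConsI[OF A(4) B(1,2) _ za])
          (unfold inv_adj_comp[OF p], use ab A B in \<open>simp add: transpose_def\<close>)
      moreover have "reduced_expression r (adj b \<circ> w) (a # b # z)"
        by (rule reduced_expression_ConsI[OF B(4) A(1,2) _ zb])
          (unfold inv_adj_comp[OF p], use ab A B in \<open>simp add: transpose_def\<close>)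
      ultimately show ?thesis by blast
    qed
    consider "i = j" | "Suc i < j" | "Suc j < i" | "j = Suc i" | "i = Suc j"
      by linarith
    then show ?thesis
    proof cases
      case 1
      then show ?thesis using IHu[of v] J(4) by (simp add: us vs)
    next
      case 2
      then obtain z where "reduced_expression r (adj i \<circ> w) (j # z)"
        "reduced_expression r (adj j \<circ> w) (i # z)"
        using far[of i j] by auto
      then show ?thesis
        using IHu IHv comm[of i j] 2 I J by (simp add: us vs flip: mult.assoc)
    next
      case 3
      then obtain z where "reduced_expression r (adj i \<circ> w) (j # z)"
        "reduced_expression r (adj j \<circ> w) (i # z)"
        using far[of j i] by auto
      then show ?thesis
        using IHu IHv comm[of j i] 3 I J by (simp add: us vs flip: mult.assoc)
    next
      case 4
      then obtain z where "reduced_expression r (adj i \<circ> w) (j # i # z)"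
        "reduced_expression r (adj j \<circ> w) (i # j # z)"
        using near[of i j] by auto
      then show ?thesis
        using IHu IHv braid[of i] 4 I J by (simp add: us vs flip: mult.assoc)
    next
      case 5
      then obtain z where "reduced_expression r (adj i \<circ> w) (j # i # z)"
        "reduced_expression r (adj j \<circ> w) (i # j # z)"
        using near[of j i] by auto
      then show ?thesis
        using IHu IHv braid[of j] 5 I J by (simp add: us vs flip: mult.assoc)
    qed
  qed
qed

section \<open>Young subgroups\<close>

lemma psum_mono: "i \<le> j \<Longrightarrow> psum lam i \<le> psum lam j"
  unfolding psum_def by (intro sum_mono2) auto

lemma psum_0 [simp]: "psum lam 0 = 0"
  by (simp add: psum_def)

lemma psum_Suc: "psum lam (Suc k) = psum lam k + lam (Suc k)"
  by (simp add: psum_def)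

lemma ex_block:
  assumes "psum lam N = r" and "a \<in> {1..r}"
  shows "\<exists>k\<in>{1..N}. a \<in> block lam k"
proof -
  define k where "k = (LEAST k. a \<le> psum lam k)"
  have k: "a \<le> psum lam k"
    unfolding k_def by (rule LeastI[of _ N]) (use assms in auto)
  have "k \<le> N"
    unfolding k_def by (rule Least_le) (use assms in auto)
  moreover have "k \<noteq> 0"
    using k assms(2) by (cases k) auto
  moreover have "\<not> a \<le> psum lam (k - 1)"
    using not_less_Least[of "k - 1" "\<lambda>k. a \<le> psum lam k"] \<open>k \<noteq> 0\<close> unfolding k_def by auto
  ultimately show ?thesis
    using k by (intro bexI[of _ k]) (auto simp: block_def)
qed

lemma block_disjoint:
  assumes "a \<in> block lam k" and "a \<in> block lam l"
  shows "k = l"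
proof (rule ccontr)
  assume "k \<noteq> l"
  then have "psum lam k \<le> psum lam (l - 1) \<or> psum lam l \<le> psum lam (k - 1)"
    using psum_mono[of k "l - 1" lam] psum_mono[of l "k - 1" lam] by linarith
  then show False
    using assms by (auto simp: block_def)
qed

lemma block_subset: "psum lam N = r \<Longrightarrow> k \<le> N \<Longrightarrow> block lam k \<subseteq> {1..r}"
  using psum_mono[of k N lam] by (auto simp: block_def)

lemma young_permutes: "w \<in> young r N lam \<Longrightarrow> w permutes {1..r}"
  by (simp add: young_def)

lemma id_in_young [simp]: "id \<in> young r N lam"
  by (simp add: young_def permutes_id)

lemma finite_young [simp]: "finite (young r N lam)"
  by (rule finite_subset[OF _ finite_permutations[of "{1..r}"]]) (auto simp: young_def)

lemma young_comp:
  "u \<in> young r N lam \<Longrightarrow> v \<in> young r N lam \<Longrightarrow> u \<circ> v \<in> young r N lam"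
  unfolding young_def mem_Collect_eq image_comp[symmetric] by (simp add: permutes_compose)

lemma young_inv:
  assumes "u \<in> young r N lam"
  shows "inv u \<in> young r N lam"
proof -
  have p: "u permutes {1..r}" using assms by (rule young_permutes)
  have "inv u ` block lam k = block lam k" if "k \<in> {1..N}" for k
  proof -
    have "inv u ` (u ` block lam k) = block lam k"
      by (simp add: image_comp permutes_inv_o[OF p])
    then show ?thesis using assms that by (simp add: young_def)
  qed
  then show ?thesis
    using p by (simp add: young_def permutes_inv)
qed

text \<open>
  A composition of \<open>r\<close> is handled through the monotone function that sends a point to the index of
  its block, counted from \<open>0\<close>: elements of different blocks are then compared by comparing their
  indices.
\<close>

definition block_index :: "nat \<Rightarrow> comp \<Rightarrow> nat \<Rightarrow> nat"
  where "block_index N lam a = card {k \<in> {1..N}. psum lam k < a}"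

lemma block_index_mono: "a \<le> a' \<Longrightarrow> block_index N lam a \<le> block_index N lam a'"
  unfolding block_index_def by (intro card_mono) auto

lemma block_index_eq:
  assumes "k \<in> {1..N}" and "a \<in> block lam k"
  shows "block_index N lam a = k - 1"
proof -
  have "{k' \<in> {1..N}. psum lam k' < a} = {1..k - 1}"
  proof (intro equalityI subsetI)
    fix k' assume k': "k' \<in> {k' \<in> {1..N}. psum lam k' < a}"
    have "\<not> k \<le> k'"
      using psum_mono[of k k' lam] assms(2) k' by (auto simp: block_def)
    then show "k' \<in> {1..k - 1}" using k' by auto
  next
    fix k' assume k': "k' \<in> {1..k - 1}"
    then show "k' \<in> {k' \<in> {1..N}. psum lam k' < a}"
      using psum_mono[of k' "k - 1" lam] assms by (auto simp: block_def)
  qed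
  then show ?thesis by (simp add: block_index_def)
qed

lemma in_block_iff:
  assumes "psum lam N = r" and "k \<in> {1..N}" and "a \<in> {1..r}"
  shows "a \<in> block lam k \<longleftrightarrow> block_index N lam a = k - 1"
proof
  assume *: "block_index N lam a = k - 1"
  obtain l where l: "l \<in> {1..N}" "a \<in> block lam l"
    using ex_block[OF assms(1,3)] by blast
  then have "l = k" using block_index_eq[OF l] * assms(2) by auto
  then show "a \<in> block lam k" using l by simp
qed (rule block_index_eq[OF assms(2)])

lemma young_iff:
  assumes r: "psum lam N = r"
  shows "w \<in> young r N lam \<longleftrightarrow>
    w permutes {1..r} \<and> (\<forall>a\<in>{1..r}. block_index N lam (w a) = block_index N lam a)"
proof safe
  fix a assume w: "w \<in> young r N lam" and a: "a \<in> {1..r}"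
  obtain k where k: "k \<in> {1..N}" "a \<in> block lam k"
    using ex_block[OF r a] by blast
  then have "w a \<in> block lam k"
    using w unfolding young_def by blast
  then show "block_index N lam (w a) = block_index N lam a"
    using k block_index_eq by metis
next
  assume p: "w permutes {1..r}"
    and inv: "\<forall>a\<in>{1..r}. block_index N lam (w a) = block_index N lam a"
  have "w ` block lam k = block lam k" if k: "k \<in> {1..N}" for k
  proof (rule card_subset_eq)
    show "w ` block lam k \<subseteq> block lam k"
    proof
      fix y assume "y \<in> w ` block lam k"
      then obtain a where a: "a \<in> block lam k" "y = w a" by blast
      then have "a \<in> {1..r}" using block_subset[OF r, of k] k by auto
      then show "y \<in> block lam k"
        using a inv in_block_iff[OF r k] permutes_in_image[OF p] by metis
    qed
    show "card (w ` block lam k) = card (block lam k)"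
      using permutes_inj[OF p] by (intro card_image) (auto simp: inj_on_def inj_def)
  qed (simp add: block_def)
  then show "w \<in> young r N lam" using p by (simp add: young_def)
qed (rule young_permutes)

lemma adj_in_young_iff:
  assumes r: "psum lam N = r" and s: "1 \<le> s" "s < r"
  shows "adj s \<in> young r N lam \<longleftrightarrow> block_index N lam s = block_index N lam (Suc s)"
proof -
  have "(\<forall>a\<in>{1..r}. block_index N lam (adj s a) = block_index N lam a) \<longleftrightarrow>
      block_index N lam s = block_index N lam (Suc s)"
    using s by (auto simp: transpose_def)
  then show ?thesis
    using young_iff[OF r, of "adj s"] adj_permutes[OF s] by simp
qed

text \<open>
  Elements of a Young subgroup keep the order of any two points in different blocks, so a descent
  happens inside a block.
\<close>

lemma young_reduced_expression_letters:
  assumes r: "psum lam N = r" and "w \<in> young r N lam" and "reduced_expression r w ws"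
    and "s \<in> set ws"
  shows "1 \<le> s \<and> s < r \<and> adj s \<in> young r N lam"
  using assms(2-)
proof (induction ws arbitrary: w)
  case Nil
  then show ?case by simp
next
  case (Cons i ws)
  note d = reduced_expression_Cons[OF Cons.prems(2)]
  have in_r: "inv w a \<in> {1..r} \<longleftrightarrow> a \<in> {1..r}" for a
    using permutes_in_image[OF permutes_inv[OF d(1)]] .
  have "block_index N lam (inv w a) = block_index N lam a" if "a \<in> {1..r}" for a
    using young_inv[OF Cons.prems(1)] that young_iff[OF r] by blast
  then have "block_index N lam i = block_index N lam (Suc i)"
    using d block_index_mono[of "inv w (Suc i)" "inv w i" N lam] block_index_mono[of i "Suc i" N lam]
    by (simp add: antisym)
  then have i: "adj i \<in> young r N lam"
    using adj_in_young_iff[OF r d(2,3)] by blast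
  then have "adj i \<circ> w \<in> young r N lam"
    using Cons.prems(1) by (rule young_comp)
  from Cons.IH[OF this d(4)] show ?case
    using Cons.prems(3) i d(2,3) by auto
qed

text \<open>
  If \<open>\<sigma>\<close> is shortest in its coset, \<open>\<sigma>\<^sup>-\<^sup>1\<close> increases on every block. Along a reduced word of an
  element of the Young subgroup each letter therefore creates a new inversion, whether or not the
  word is followed by \<open>\<sigma>\<close>.
\<close>

lemma inv_shortest_right_rep_increasing:
  assumes r: "psum lam N = r" and sg: "sg \<in> shortest_right_reps r N lam"
    and "a < c" and "1 \<le> a" and "c \<le> r" and "block_index N lam a = block_index N lam c"
  shows "inv sg a < inv sg c"
  using assms(3-)
proof (induction c)
  case 0
  then show ?case by simp
next
  case (Suc c)
  have p: "sg permutes {1..r}"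
    using sg by (simp add: shortest_right_reps_def)
  have ic: "block_index N lam a = block_index N lam c \<and> block_index N lam c = block_index N lam (Suc c)"
    using Suc.prems block_index_mono[of a c N lam] block_index_mono[of c "Suc c" N lam] by auto
  have c: "1 \<le> c" "c < r" using Suc.prems by auto
  have "adj c \<in> young r N lam"
    using adj_in_young_iff[OF r c] ic by blast
  then have "perm_length r sg \<le> perm_length r (adj c \<circ> sg)"
    using sg by (simp add: shortest_right_reps_def)
  then have "inv sg c < inv sg (Suc c)"
    using perm_length_adj_descent[OF p c] inv_adjacent_neq[OF p, of c] by linarith
  then show ?case
    using Suc ic c by (cases "a = c") auto
qed

lemma perm_length_young_comp_rep:
  assumes r: "psum lam N = r" and x: "x \<in> young r N lam" and sg: "sg \<in> shortest_right_reps r N lam"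
  shows "perm_length r (x \<circ> sg) = perm_length r x + perm_length r sg"
proof -
  have p: "sg permutes {1..r}"
    using sg by (simp add: shortest_right_reps_def)
  obtain ws where "reduced_expression r x ws"
    using exists_reduced_expression young_permutes[OF x] by blast
  then show ?thesis
    using x
  proof (induction ws arbitrary: x)
    case Nil
    then have "x = id" by (simp add: reduced_expression_def expression_def)
    then show ?case by (simp only: perm_length_id id_comp add_0)
  next
    case (Cons i ws)
    note d = reduced_expression_Cons[OF Cons.prems(1)]
    define y where "y = adj i \<circ> x"
    have x_eq: "x = adj i \<circ> y"
      unfolding y_def by (simp only: adj_adj)
    have i: "adj i \<in> young r N lam"
      using young_reduced_expression_letters[OF r Cons.prems(2,1)] by simp
    have y: "y \<in> young r N lam"
      unfolding y_def using young_comp[OF i Cons.prems(2)] .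
    have yp: "y permutes {1..r}" using y by (rule young_permutes)
    have ysp: "y \<circ> sg permutes {1..r}" using p yp by (rule permutes_compose)
    have lx: "perm_length r x = Suc (perm_length r y)"
      using perm_length_adj_descent[OF d(1-3,5)] by (simp only: y_def)
    have "inv y i < inv y (Suc i)"
      using ascent_iff_perm_length[OF yp d(2,3)] lx x_eq by simp
    moreover have "block_index N lam (inv y i) = block_index N lam (inv y (Suc i))"
    proof -
      have "block_index N lam (inv y a) = block_index N lam a" if "a \<in> {1..r}" for a
        using young_inv[OF y] that young_iff[OF r] by blast
      moreover have "block_index N lam i = block_index N lam (Suc i)"
        using adj_in_young_iff[OF r d(2,3)] i by blast
      ultimately show ?thesis using d(2,3) by simp
    qed
    moreover have "1 \<le> inv y i" "inv y (Suc i) \<le> r"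
      using permutes_in_image[OF permutes_inv[OF yp], of i]
        permutes_in_image[OF permutes_inv[OF yp], of "Suc i"] d(2,3) by auto
    ultimately have "inv sg (inv y i) < inv sg (inv y (Suc i))"
      by (intro inv_shortest_right_rep_increasing[OF r sg])
    moreover have "inv (y \<circ> sg) = inv sg \<circ> inv y"
      using p yp by (intro o_inv_distrib) (auto intro: permutes_bij)
    ultimately have "inv (y \<circ> sg) i < inv (y \<circ> sg) (Suc i)" by simp
    then have "perm_length r (adj i \<circ> (y \<circ> sg)) = Suc (perm_length r (y \<circ> sg))"
      by (rule perm_length_adj_ascent[OF ysp d(2,3)])
    moreover have "perm_length r (y \<circ> sg) = perm_length r y + perm_length r sg"
      using Cons.IH[of y] d(4) y by (simp only: y_def)
    moreover have "x \<circ> sg = adj i \<circ> (y \<circ> sg)"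
      by (simp only: x_eq comp_assoc)
    ultimately have "perm_length r (x \<circ> sg) = perm_length r x + perm_length r sg"
      by (simp only: lx add_Suc)
    then show ?case .
  qed
qed

lemma bij_betw_young_coset_decomposition:
  assumes r: "psum nu N' = r" and sub: "young r N' nu \<subseteq> young r N mu"
  shows "bij_betw (\<lambda>(x, sg). x \<circ> sg)
    (young r N' nu \<times> (shortest_right_reps r N' nu \<inter> young r N mu)) (young r N mu)"
  unfolding bij_betw_def
proof
  let ?D = "shortest_right_reps r N' nu \<inter> young r N mu"
  show "inj_on (\<lambda>(x, sg). x \<circ> sg) (young r N' nu \<times> ?D)"
  proof (rule inj_onI, clarify)
    fix x x' sg sg'
    assume x: "x \<in> young r N' nu" "x' \<in> young r N' nu"
      and sg: "sg \<in> shortest_right_reps r N' nu" "sg' \<in> shortest_right_reps r N' nu"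
      and eq: "x \<circ> sg = x' \<circ> sg'"
    define y where "y = inv x' \<circ> x"
    have y: "y \<in> young r N' nu"
      unfolding y_def using x young_inv young_comp by blast
    have yp: "y permutes {1..r}" and xp: "x' permutes {1..r}"
      using y x by (auto dest: young_permutes)
    have "inv x' \<circ> (x' \<circ> sg') = sg'" "x' \<circ> (inv x' \<circ> x) = x"
      by (simp_all add: comp_assoc[symmetric] permutes_inv_o[OF xp])
    then have sg': "sg' = y \<circ> sg" and xy: "x = x' \<circ> y"
      unfolding y_def by (simp_all add: eq[symmetric] comp_assoc)
    then have "inv y \<circ> sg' = sg"
      by (simp add: comp_assoc[symmetric] permutes_inv_o[OF yp])
    then have "perm_length r y = 0"
      using perm_length_young_comp_rep[OF r y sg(1)]
        perm_length_young_comp_rep[OF r young_inv[OF y] sg(2)] sg' by simp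
    then have "y = id" using perm_length_eq_0_iff[OF yp] by simp
    then show "x = x' \<and> sg = sg'" using sg' xy by simp
  qed
  show "(\<lambda>(x, sg). x \<circ> sg) ` (young r N' nu \<times> ?D) = young r N mu"
  proof (intro equalityI subsetI)
    fix w assume "w \<in> (\<lambda>(x, sg). x \<circ> sg) ` (young r N' nu \<times> ?D)"
    then show "w \<in> young r N mu" using sub young_comp by fastforce
  next
    fix w assume w: "w \<in> young r N mu"
    obtain x where x: "x \<in> young r N' nu"
      and min: "\<And>x'. x' \<in> young r N' nu \<Longrightarrow> perm_length r (x \<circ> w) \<le> perm_length r (x' \<circ> w)"
      using ex_has_least_nat[of "\<lambda>x. x \<in> young r N' nu" id "\<lambda>x. perm_length r (x \<circ> w)"] by auto
    have xp: "x permutes {1..r}" using x by (rule young_permutes)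
    have xw: "x \<circ> w \<in> young r N mu"
      using young_comp sub x w by blast
    have "x \<circ> w \<in> shortest_right_reps r N' nu"
      unfolding shortest_right_reps_def
    proof (intro CollectI conjI ballI)
      show "x \<circ> w permutes {1..r}" using xw by (rule young_permutes)
      fix x' assume "x' \<in> young r N' nu"
      then have "x' \<circ> x \<in> young r N' nu" using x by (rule young_comp)
      then show "perm_length r (x \<circ> w) \<le> perm_length r (x' \<circ> (x \<circ> w))"
        using min[of "x' \<circ> x"] by (simp add: comp_assoc)
    qed
    moreover have "w = inv x \<circ> (x \<circ> w)"
      by (simp add: comp_assoc[symmetric] permutes_inv_o[OF xp])
    ultimately show "w \<in> (\<lambda>(x, sg). x \<circ> sg) ` (young r N' nu \<times> ?D)"
      using young_inv[OF x] xw by (intro image_eqI[of _ _ "(inv x, x \<circ> w)"]) auto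
  qed
qed

lemma shortest_right_reps_inter_young:
  "shortest_right_reps r N nu \<inter> young r N nu = {id}"
proof (intro equalityI subsetI)
  fix sg assume sg: "sg \<in> shortest_right_reps r N nu \<inter> young r N nu"
  then have p: "sg permutes {1..r}" by (auto dest: young_permutes)
  have "perm_length r sg \<le> perm_length r (inv sg \<circ> sg)"
    using sg young_inv by (auto simp: shortest_right_reps_def)
  then show "sg \<in> {id}"
    using perm_length_eq_0_iff[OF p] by (simp add: permutes_inv_o[OF p])
qed (auto simp: shortest_right_reps_def permutes_id)

section \<open>The ground field\<close>

lemma vv_power: "vv ^ k = Fract (monom 1 k) 1"
proof (induction k)
  case 0
  then show ?case by (simp add: One_fract_def flip: one_pCons)
next
  case (Suc k)
  have "[:0, 1:] * monom (1::rat) k = monom 1 (Suc k)"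
    by (simp add: monom_Suc)
  then show ?case
    using Suc by (simp add: vv_def)
qed

lemma sum_Fract_1: "finite A \<Longrightarrow> (\<Sum>a\<in>A. Fract (p a) 1) = Fract (\<Sum>a\<in>A. p a) (1 :: 'a::idom)"
  by (induction rule: finite_induct) (simp_all add: Zero_fract_def)

text \<open>A sum of powers of \<open>v\<close> specialises at \<open>v = 1\<close> to its number of terms.\<close>

lemma sum_vv_powers_neq_0:
  assumes "finite A" and "A \<noteq> {}"
  shows "(\<Sum>a\<in>A. vv ^ f a) \<noteq> 0"
proof
  assume "(\<Sum>a\<in>A. vv ^ f a) = 0"
  then have "Fract (\<Sum>a\<in>A. monom (1::rat) (f a)) 1 = Fract 0 1"
    by (simp add: vv_power sum_Fract_1[OF assms(1)] Zero_fract_def)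
  then have "(\<Sum>a\<in>A. monom (1::rat) (f a)) = 0"
    by (simp add: eq_fract)
  then have "poly (\<Sum>a\<in>A. monom (1::rat) (f a)) 1 = 0"
    by simp
  then have "of_nat (card A) = (0 :: rat)"
    by (simp add: poly_sum poly_monom)
  then show False using assms by simp
qed

lemma sum_qq_powers_neq_0: "finite A \<Longrightarrow> A \<noteq> {} \<Longrightarrow> (\<Sum>a\<in>A. qq ^ f a) \<noteq> 0"
  using sum_vv_powers_neq_0[of A "\<lambda>a. 2 * f a"] by (simp add: qq_def power_mult)

lemma qq_neq_0 [simp]: "qq \<noteq> 0"
  using sum_qq_powers_neq_0[of "{0::nat}" "\<lambda>_. 1"] by simp

lemma vv_neq_0 [simp]: "vv \<noteq> 0"
  using qq_neq_0 by (auto simp: qq_def)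

lemma qq_plus_1_neq_0: "qq + 1 \<noteq> 0"
  using sum_qq_powers_neq_0[of "{0, 1::nat}" id] by (simp add: add.commute)

lemma vv_power_inj: "vv ^ k = vv ^ l \<Longrightarrow> k = l"
  by (simp add: vv_power eq_fract monom_eq_iff')

lemma square_of_fract_is_square_of_poly:
  fixes p :: "rat poly"
  assumes "x * x = Fract p 1"
  shows "\<exists>s. s * s = p"
proof -
  obtain a b where ab: "x = Fract a b" "b \<noteq> 0"
    by (cases x)
  then have "a * a = p * (b * b)"
    using assms by (simp add: eq_fract)
  then have "b ^ 2 dvd a ^ 2"
    by (simp add: power2_eq_square)
  then obtain s where "a = b * s"
    using pow_divides_pow_iff[of 2 b a] by (auto simp: dvd_def)
  then have "b * b * (s * s) = b * b * p"
    using \<open>a * a = p * (b * b)\<close> by (simp add: algebra_simps)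
  then show ?thesis using ab(2) by (intro exI[of _ s]) simp
qed

text \<open>
  The polynomial \<open>p = 1 + X\<^sup>4 + \<dots> + X\<^bsup>4(r-1)\<^esup>\<close> divides \<open>X\<^bsup>4r\<^esup> - 1\<close>, which has no repeated factor
  because it is coprime to its derivative. So \<open>p = s\<^sup>2\<close> forces \<open>s\<close>, and with it \<open>p\<close>, to be
  constant.
\<close>

lemma sum_fourth_powers_not_square:
  assumes "1 < r"
  shows "x * x \<noteq> (\<Sum>k<r. vv ^ (4 * k))"
proof
  assume "x * x = (\<Sum>k<r. vv ^ (4 * k))"
  then have "x * x = Fract (\<Sum>k<r. monom (1::rat) (4 * k)) 1"
    by (simp add: vv_power sum_Fract_1)
  then obtain s where s: "s * s = (\<Sum>k<r. monom (1::rat) (4 * k))"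
    using square_of_fract_is_square_of_poly by blast
  have geo: "s * s * (monom 1 4 - 1) = monom 1 (4 * r) - 1"
  proof -
    have "monom (1::rat) (4 * k) = monom 1 4 ^ k" for k
      by (simp add: monom_power)
    then show ?thesis
      using power_diff_1_eq[of "monom (1::rat) 4" r]
      by (simp add: s mult.commute)
  qed
  have "pderiv (s * s * (monom 1 4 - 1)) = pderiv (monom 1 (4 * r) - 1)"
    by (simp only: geo)
  then have "s * (2 * pderiv s * (monom 1 4 - 1) + s * pderiv (monom 1 4 - 1)) =
      monom (of_nat (4 * r)) (4 * r - 1)"
    by (simp add: pderiv_mult pderiv_diff pderiv_monom algebra_simps)
  then have "s dvd monom (of_nat (4 * r)) (4 * r - 1)"
    by (metis dvd_triv_left)
  then have "s dvd monom 1 1 * monom (of_nat (4 * r)) (4 * r - 1)"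
    by (rule dvd_mult)
  then have "s dvd smult (of_nat (4 * r)) (monom 1 (4 * r))"
    using assms by (simp add: mult_monom smult_monom)
  moreover have "s dvd smult (of_nat (4 * r)) (monom 1 (4 * r) - 1)"
    by (intro dvd_smult) (metis geo dvd_triv_left mult.assoc)
  ultimately have "s dvd smult (of_nat (4 * r)) (monom 1 (4 * r)) -
      smult (of_nat (4 * r)) (monom 1 (4 * r) - 1)"
    by (rule dvd_diff)
  then have "s dvd [:of_nat (4 * r):]"
    by (simp add: smult_diff_right)
  then have "degree s = 0"
    using assms divides_degree[of s "[:of_nat (4 * r):]"] by simp
  then have "degree (s * s) = 0"
    using degree_mult_le[of s s] by simp
  moreover have "coeff (s * s) (4 * (r - 1)) = 1"
    using assms by (simp add: s coeff_sum)
  ultimately show False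
    using assms coeff_eq_0[of "s * s" "4 * (r - 1)"] by simp
qed

section \<open>The Hecke--Clifford superalgebra\<close>

lemma hc_of_scalar_0: "hc_of_scalar 0 = 0"
  by transfer (rule hcc_refl)

lemma hc_of_scalar_uminus: "hc_of_scalar (- a) = - hc_of_scalar a"
  by (simp add: eq_neg_iff_add_eq_0 hc_of_scalar_0 flip: hc_of_scalar_add)

lemma hc_of_scalar_mult_eq: "hc_of_scalar a * h = hc_scale a h"
  by (simp add: hc_scale_def)

lemma hc_T_out: "\<not> (1 \<le> i \<and> i < CARD('r)) \<Longrightarrow> (hc_T i :: 'r::finite hc) = 0"
  by transfer (rule hcc_base, rule rel_no_T)

lemma hc_c_out: "\<not> (1 \<le> j \<and> j \<le> CARD('r)) \<Longrightarrow> (hc_c j :: 'r::finite hc) = 0"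
  by transfer (rule hcc_base, rule rel_no_C)

lemma hc_T_quadratic:
  assumes "1 \<le> i" and "i < CARD('r::finite)"
  shows "(hc_T i :: 'r hc) * hc_T i = hc_scale (qq - 1) (hc_T i) + hc_scale qq 1"
proof -
  have "(hc_T i + hc_of_scalar (- qq)) * (hc_T i + hc_of_scalar 1) = (hc_of_scalar 0 :: 'r hc)"
    using assms by transfer (rule hcc_base, rule rel_quadratic)
  moreover have "hc_of_scalar (- qq) = - hc_scale qq (1 :: 'r hc)" "hc_of_scalar 1 = (1 :: 'r hc)"
    by (simp_all add: hc_of_scalar_uminus hc_of_scalar_one hc_scale_def)
  ultimately have "(hc_T i - hc_scale qq 1) * (hc_T i + 1) = (0 :: 'r hc)"
    by (simp add: hc_of_scalar_0)
  moreover have "(hc_T i - hc_scale qq 1) * (hc_T i + 1) =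
      (hc_T i * hc_T i - (hc_scale qq (hc_T i) - hc_T i + hc_scale qq 1) :: 'r hc)"
    by (simp add: distrib_left left_diff_distrib hc_scale_mult_left)
  ultimately show ?thesis
    by (simp add: hc.scale_left_diff_distrib)
qed

lemma hc_T_far_commute:
  assumes "1 \<le> i" "j < CARD('r::finite)" "Suc i < j"
  shows "(hc_T i :: 'r hc) * hc_T j = hc_T j * hc_T i"
  using assms by transfer (rule hcc_base, rule rel_TT_comm, auto)

lemma hc_T_braid:
  assumes "1 \<le> i" "Suc i < CARD('r::finite)"
  shows "(hc_T i :: 'r hc) * hc_T (Suc i) * hc_T i = hc_T (Suc i) * hc_T i * hc_T (Suc i)"
  using assms
proof transfer
  fix i assume "1 \<le> i" "Suc i < CARD('r)"
  then show "hc_cong CARD('r) (TGen i \<boxtimes> TGen (Suc i) \<boxtimes> TGen i) (TGen (Suc i) \<boxtimes> TGen i \<boxtimes> TGen (Suc i))"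
    using hcc_base[OF rel_braid[of i "CARD('r)"]] by simp
qed

lemma hc_c_square:
  assumes "1 \<le> i" "i \<le> CARD('r::finite)"
  shows "(hc_c i :: 'r hc) * hc_c i = - 1"
proof -
  have "(hc_c i :: 'r hc) * hc_c i = hc_of_scalar (- 1)"
    using assms by transfer (rule hcc_base, rule rel_C_square)
  then show ?thesis by (simp add: hc_of_scalar_uminus hc_of_scalar_one)
qed

lemma hc_c_anticommute:
  assumes "i \<noteq> j"
  shows "(hc_c i :: 'r::finite hc) * hc_c j = - (hc_c j * hc_c i)"
proof (cases "1 \<le> i \<and> i \<le> CARD('r) \<and> 1 \<le> j \<and> j \<le> CARD('r)")
  case True
  then have "hc_rel CARD('r) (CGen i \<boxtimes> CGen j) (Scal (- 1) \<boxtimes> (CGen j \<boxtimes> CGen i))"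
    using assms rel_CC_anticomm by blast
  then have "(hc_c i :: 'r hc) * hc_c j = hc_of_scalar (- 1) * (hc_c j * hc_c i)"
    by transfer (rule hcc_base)
  then show ?thesis by (simp add: hc_of_scalar_uminus hc_of_scalar_one)
next
  case False
  then have "(hc_c i :: 'r hc) = 0 \<or> (hc_c j :: 'r hc) = 0"
    using hc_c_out by blast
  then show ?thesis by auto
qed

lemma hc_T_c_commute:
  assumes "j \<noteq> i" "j \<noteq> Suc i"
  shows "(hc_T i :: 'r::finite hc) * hc_c j = hc_c j * hc_T i"
proof (cases "1 \<le> i \<and> i < CARD('r) \<and> 1 \<le> j \<and> j \<le> CARD('r)")
  case True
  then show ?thesis
    using assms by transfer (rule hcc_base, rule rel_TC_comm, auto)
next
  case False
  then have "(hc_T i :: 'r hc) = 0 \<or> (hc_c j :: 'r hc) = 0"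
    using hc_T_out hc_c_out by blast
  then show ?thesis by auto
qed

lemma hc_T_c_left: "(hc_T i :: 'r::finite hc) * hc_c i = hc_c (Suc i) * hc_T i"
proof (cases "1 \<le> i \<and> i < CARD('r)")
  case True
  then have "(hc_T i :: 'r::finite hc) * hc_c i = hc_c (i + 1) * hc_T i"
    by transfer (rule hcc_base, rule rel_TC_left, auto)
  then show ?thesis by simp
next
  case False
  then have "(hc_T i :: 'r hc) = 0" by (rule hc_T_out)
  then show ?thesis by simp
qed

lemma hc_T_c_right:
  assumes "1 \<le> i" "i < CARD('r::finite)"
  shows "(hc_T i :: 'r hc) * hc_c (Suc i) = hc_c i * hc_T i - hc_scale (qq - 1) (hc_c i - hc_c (Suc i))"
proof -
  have "hc_rel CARD('r) (TGen i \<boxtimes> CGen (i + 1))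
      (CGen i \<boxtimes> TGen i \<boxplus> Scal (- (qq - 1)) \<boxtimes> (CGen i \<boxplus> Scal (- 1) \<boxtimes> CGen (i + 1)))"
    using assms by (rule rel_TC_right)
  then have "(hc_T i :: 'r hc) * hc_c (i + 1) =
      hc_c i * hc_T i + hc_of_scalar (- (qq - 1)) * (hc_c i + hc_of_scalar (- 1) * hc_c (i + 1))"
    by (simp only: hc_T.abs_eq hc_c.abs_eq hc_of_scalar.abs_eq times_hc.abs_eq plus_hc.abs_eq
        hc.abs_eq_iff hcc_base)
  moreover have "hc_of_scalar (- (qq - 1)) * g = - hc_scale (qq - 1) g"
    "hc_of_scalar (- 1) * g = - g" for g :: "'r hc"
    by (simp_all only: hc_of_scalar_mult_eq hc.scale_minus_left hc.scale_one)
  ultimately show ?thesis by simp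
qed

lemma hc_induct [case_names scalar T c add mult]:
  fixes h :: "'r::finite hc"
  assumes scalar: "\<And>a. P (hc_of_scalar a)" and "\<And>i. P (hc_T i)" and "\<And>j. P (hc_c j)"
    and "\<And>g h. P g \<Longrightarrow> P h \<Longrightarrow> P (g + h)" and "\<And>g h. P g \<Longrightarrow> P h \<Longrightarrow> P (g * h)"
  shows "P h"
proof -
  have "P (abs_hc t)" for t
    by (induction t)
      (simp_all add: assms flip: hc_of_scalar.abs_eq hc_T.abs_eq hc_c.abs_eq plus_hc.abs_eq times_hc.abs_eq)
  then show ?thesis using hc.abs_induct[of P h] by blast
qed

lemma hc_scale_uminus_one: "hc_scale (- 1) h = - h"
  using hc.scale_minus_left[of 1 h] by simp

subsection \<open>The elements \<open>T\<^sub>w\<close>\<close>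

lemma Tperm_eq_prod_list:
  assumes "reduced_expression CARD('r::finite) w ws"
  shows "(Tperm w :: 'r hc) = prod_list (map hc_T ws)"
  unfolding Tperm_def
proof (rule prod_list_reduced_expression_unique)
  show "reduced_expression CARD('r) w (SOME ws. reduced_expression CARD('r) w ws)"
    using assms by (rule someI)
qed (use assms hc_T_far_commute hc_T_braid in auto)

lemma Tperm_id [simp]: "Tperm id = 1"
  using Tperm_eq_prod_list[of id "[]"] by (simp add: reduced_expression_def expression_def)

lemma Tperm_comp:
  assumes u: "u permutes {1..CARD('r::finite)}" and v: "v permutes {1..CARD('r)}"
    and l: "perm_length CARD('r) (u \<circ> v) = perm_length CARD('r) u + perm_length CARD('r) v"
  shows "(Tperm (u \<circ> v) :: 'r hc) = Tperm u * Tperm v"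
proof -
  obtain us vs where us: "reduced_expression CARD('r) u us" and vs: "reduced_expression CARD('r) v vs"
    using exists_reduced_expression u v by blast
  then have "reduced_expression CARD('r) (u \<circ> v) (us @ vs)"
    using l by (auto simp: reduced_expression_def expression_def word_perm_append)
  then show ?thesis
    using us vs by (simp add: Tperm_eq_prod_list)
qed

lemma reduced_expression_adj:
  assumes "1 \<le> s" "s < r"
  shows "reduced_expression r (adj s) [s]"
proof (rule reduced_expression_ConsI[OF adj_permutes[OF assms] assms])
  have "adj s \<circ> adj s = id" by simp
  then show "reduced_expression r (adj s \<circ> adj s) []"
    by (simp only: reduced_expression_def expression_def perm_length_id) simp
qed simp

lemma Tperm_adj: "1 \<le> s \<Longrightarrow> s < CARD('r) \<Longrightarrow> (Tperm (adj s) :: 'r::finite hc) = hc_T s"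
  by (simp add: Tperm_eq_prod_list[OF reduced_expression_adj])

lemma perm_length_adj: "1 \<le> s \<Longrightarrow> s < r \<Longrightarrow> perm_length r (adj s) = 1"
  using reduced_expression_adj[of s r] by (simp add: reduced_expression_def)

lemma perm_length_adj_cases:
  assumes "w permutes {1..r}" "1 \<le> s" "s < r"
  shows "perm_length r (adj s \<circ> w) = Suc (perm_length r w) \<or>
    perm_length r w = Suc (perm_length r (adj s \<circ> w))"
  using perm_length_adj_ascent[OF assms] perm_length_adj_descent[OF assms]
    inv_adjacent_neq[OF assms(1), of s] by linarith

lemma perm_length_comp_adj:
  assumes "w permutes {1..r}" "1 \<le> s" "s < r"
  shows "perm_length r (w \<circ> adj s) = perm_length r (adj s \<circ> inv w)"
proof -
  have "inv (w \<circ> adj s) = adj s \<circ> inv w"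
    using assms by (subst o_inv_distrib) (auto intro: permutes_bij)
  then show ?thesis
    using perm_length_inv[OF permutes_compose[OF adj_permutes[OF assms(2,3)] assms(1)]] by simp
qed

subsection \<open>The elements \<open>x\<^sub>\<lambda>\<close>\<close>

text \<open>
  \<open>T_eigen N lam z\<close> says that right multiplication by the Hecke algebra of the Young subgroup acts
  on \<open>z\<close> by the index representation.
\<close>

definition T_eigen :: "nat \<Rightarrow> comp \<Rightarrow> 'r::finite hc \<Rightarrow> bool"
  where "T_eigen N lam z \<longleftrightarrow> (\<forall>s. 1 \<le> s \<and> s < CARD('r) \<and> adj s \<in> young CARD('r) N lam \<longrightarrow>
    z * hc_T s = hc_scale qq z)"

lemma sum_over_involution:
  fixes f :: "'a \<Rightarrow> 'b::comm_monoid_add"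
  assumes "finite W" and "\<And>w. w \<in> W \<Longrightarrow> \<phi> w \<in> W" and "\<And>w. w \<in> W \<Longrightarrow> \<phi> (\<phi> w) = w"
    and "\<And>w. w \<in> W \<Longrightarrow> P (\<phi> w) \<longleftrightarrow> \<not> P w"
  shows "sum f W = (\<Sum>w | w \<in> W \<and> P w. f w + f (\<phi> w))"
proof -
  have "(\<Sum>w | w \<in> W \<and> P w. f (\<phi> w)) = (\<Sum>w | w \<in> W \<and> \<not> P w. f w)"
    by (rule sum.reindex_bij_witness[of _ \<phi> \<phi>]) (use assms in auto)
  moreover have "sum f W = (\<Sum>w | w \<in> W \<and> P w. f w) + (\<Sum>w | w \<in> W \<and> \<not> P w. f w)"
    using assms(1) by (subst sum.union_disjoint[symmetric]) (auto intro: sum.cong)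
  ultimately show ?thesis by (simp add: sum.distrib)
qed

lemma one_plus_hc_T_eigen:
  assumes "1 \<le> s" and "s < CARD('r::finite)"
  shows "(1 + hc_T s) * hc_T s = hc_scale qq (1 + hc_T s :: 'r hc)"
    and "hc_T s * (1 + hc_T s) = hc_scale qq (1 + hc_T s :: 'r hc)"
  using hc_T_quadratic[OF assms]
  by (simp_all add: distrib_left distrib_right hc.scale_left_diff_distrib hc.scale_right_distrib)

text \<open>
  Multiplication by \<open>s\<close> pairs the elements of the Young subgroup, and a pair contributes
  \<open>T\<^sub>w (1 + T\<^sub>s)\<close> or \<open>(1 + T\<^sub>s) T\<^sub>w\<close> to \<open>x\<^sub>\<lambda>\<close>, according to the side.
\<close>

lemma xx_T_right:
  assumes s: "1 \<le> s" "s < CARD('r::finite)" and y: "adj s \<in> young CARD('r) N lam"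
  shows "(xx N lam :: 'r hc) * hc_T s = hc_scale qq (xx N lam)"
proof -
  let ?l = "perm_length CARD('r)" and ?W = "young CARD('r) N lam"
  let ?P = "\<lambda>w. ?l (w \<circ> adj s) = Suc (?l w)"
  have adj2: "w \<circ> adj s \<circ> adj s = w" for w by (simp add: comp_assoc)
  have cases: "?P w \<or> ?l w = Suc (?l (w \<circ> adj s))" if "w \<in> ?W" for w
  proof -
    have w: "w permutes {1..CARD('r)}" using that by (rule young_permutes)
    show ?thesis
      using perm_length_adj_cases[OF permutes_inv[OF w] s] perm_length_comp_adj[OF w s]
        perm_length_inv[OF w] by simp
  qed
  have T: "(Tperm (w \<circ> adj s) :: 'r hc) = Tperm w * hc_T s" if "w \<in> ?W" "?P w" for w
    using Tperm_comp[OF young_permutes[OF that(1)] adj_permutes[OF s]] that(2)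
    by (simp add: Tperm_adj[OF s] perm_length_adj[OF s])
  have "(xx N lam :: 'r hc) = (\<Sum>w | w \<in> ?W \<and> ?P w. Tperm w + Tperm (w \<circ> adj s))"
    unfolding xx_def
  proof (rule sum_over_involution)
    fix w assume w: "w \<in> ?W"
    show "w \<circ> adj s \<in> ?W" using w y by (rule young_comp)
    show "w \<circ> adj s \<circ> adj s = w" by (rule adj2)
    show "?P (w \<circ> adj s) \<longleftrightarrow> \<not> ?P w"
      using cases[OF w] unfolding adj2 by linarith
  qed simp
  also have "\<dots> = (\<Sum>w | w \<in> ?W \<and> ?P w. Tperm w) * (1 + hc_T s)"
    by (simp add: T sum_distrib_right distrib_left sum.distrib)
  finally show ?thesis
    by (simp only: mult.assoc one_plus_hc_T_eigen[OF s] hc_scale_mult_right)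
qed

lemma T_eigen_xx: "T_eigen N lam (xx N lam :: 'r::finite hc)"
  by (auto simp: T_eigen_def intro!: xx_T_right)

lemma xx_T_left:
  assumes s: "1 \<le> s" "s < CARD('r::finite)" and y: "adj s \<in> young CARD('r) N lam"
  shows "hc_T s * (xx N lam :: 'r hc) = hc_scale qq (xx N lam)"
proof -
  let ?l = "perm_length CARD('r)" and ?W = "young CARD('r) N lam"
  let ?P = "\<lambda>w. ?l (adj s \<circ> w) = Suc (?l w)"
  have T: "(Tperm (adj s \<circ> w) :: 'r hc) = hc_T s * Tperm w" if "w \<in> ?W" "?P w" for w
    using Tperm_comp[OF adj_permutes[OF s] young_permutes[OF that(1)]] that(2)
    by (simp add: Tperm_adj[OF s] perm_length_adj[OF s])
  have "(xx N lam :: 'r hc) = (\<Sum>w | w \<in> ?W \<and> ?P w. Tperm w + Tperm (adj s \<circ> w))"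
    unfolding xx_def
  proof (rule sum_over_involution)
    fix w assume w: "w \<in> ?W"
    show "adj s \<circ> w \<in> ?W" using y w by (rule young_comp)
    show "adj s \<circ> (adj s \<circ> w) = w" by (rule adj_adj)
    show "?P (adj s \<circ> w) \<longleftrightarrow> \<not> ?P w"
      using perm_length_adj_cases[OF young_permutes[OF w] s] unfolding adj_adj by linarith
  qed simp
  also have "\<dots> = (1 + hc_T s) * (\<Sum>w | w \<in> ?W \<and> ?P w. Tperm w)"
    by (simp add: T sum_distrib_left distrib_right sum.distrib)
  finally show ?thesis
    by (simp only: one_plus_hc_T_eigen[OF s] hc_scale_mult_left flip: mult.assoc)
qed

definition poincare :: "nat \<Rightarrow> nat \<Rightarrow> comp \<Rightarrow> qv"
  where "poincare r N lam = (\<Sum>w\<in>young r N lam. qq ^ perm_length r w)"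

lemma poincare_neq_0: "poincare r N lam \<noteq> 0"
  unfolding poincare_def by (rule sum_qq_powers_neq_0) (use id_in_young[of r N lam] in \<open>auto simp del: id_in_young\<close>)

text \<open>
  If every \<open>T\<^sub>s\<close> of a Young subgroup acts on \<open>z\<close> from the right by \<open>q\<close>, then \<open>T\<^sub>w\<close> acts by
  \<open>q\<^bsup>l(w)\<^esup>\<close>. Since the Poincare polynomial does not vanish, such a \<open>z\<close> lies in the left ideal
  \<open>H x\<^sub>\<lambda>\<close>; this criterion is used twice below.
\<close>

lemma T_eigen_mult_xx:
  fixes z :: "'r::finite hc"
  assumes lam: "psum lam N = CARD('r)" and z: "T_eigen N lam z"
  shows "z * xx N lam = hc_scale (poincare CARD('r) N lam) z"
proof -
  have word: "z * prod_list (map hc_T ws) = hc_scale (qq ^ length ws) z"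
    if "\<forall>s\<in>set ws. z * hc_T s = hc_scale qq z" for ws
    using that
  proof (induction ws)
    case (Cons s ws)
    then show ?case
      by (simp add: hc_scale_mult_left flip: mult.assoc)
  qed simp
  have "z * Tperm w = hc_scale (qq ^ perm_length CARD('r) w) z" if w: "w \<in> young CARD('r) N lam" for w
  proof -
    obtain ws where ws: "reduced_expression CARD('r) w ws"
      using exists_reduced_expression young_permutes[OF w] by blast
    have "\<forall>s\<in>set ws. z * hc_T s = hc_scale qq z"
      using young_reduced_expression_letters[OF lam w ws] z unfolding T_eigen_def by blast
    then show ?thesis
      using word ws by (simp add: Tperm_eq_prod_list[OF ws] reduced_expression_def)
  qed
  then show ?thesis
    by (simp add: xx_def poincare_def sum_distrib_left hc.scale_sum_left)
qed

lemma xx_factor: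
  assumes nu: "psum nu N' = CARD('r::finite)"
    and sub: "young CARD('r) N' nu \<subseteq> young CARD('r) N mu"
  shows "xx N' nu * (\<Sum>w \<in> shortest_right_reps CARD('r) N' nu \<inter> young CARD('r) N mu. Tperm w) =
    (xx N mu :: 'r hc)"
proof -
  let ?Y = "young CARD('r) N' nu"
  let ?D = "shortest_right_reps CARD('r) N' nu \<inter> young CARD('r) N mu"
  have "xx N' nu * (\<Sum>w\<in>?D. Tperm w) = (\<Sum>(x, sg)\<in>?Y \<times> ?D. Tperm x * Tperm sg :: 'r hc)"
    by (simp add: xx_def sum_product sum.cartesian_product)
  also have "\<dots> = (\<Sum>p\<in>?Y \<times> ?D. Tperm (case p of (x, sg) \<Rightarrow> x \<circ> sg))"
  proof (rule sum.cong[OF refl], clarify)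
    fix x sg assume x: "x \<in> ?Y" and sg: "sg \<in> shortest_right_reps CARD('r) N' nu"
      "sg \<in> young CARD('r) N mu"
    show "Tperm x * Tperm sg = (Tperm (x \<circ> sg) :: 'r hc)"
      by (rule Tperm_comp[symmetric, OF young_permutes[OF x] young_permutes[OF sg(2)]])
        (rule perm_length_young_comp_rep[OF nu x sg(1)])
  qed
  also have "\<dots> = xx N mu"
    unfolding xx_def
    by (rule sum.reindex_bij_betw[OF bij_betw_young_coset_decomposition[OF nu sub]])
  finally show ?thesis .
qed

subsection \<open>The Clifford elements \<open>c\<^sub>q\<close>\<close>

lemma T_eigen_step_c:
  fixes y :: "'r::finite hc"
  assumes s: "1 \<le> s" "s < CARD('r)" and y: "y * hc_T s = hc_scale qq y"
  shows "y * hc_c (Suc s) * hc_T s = hc_scale qq (y * hc_c s)"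
    and "y * hc_c s * hc_T s = y * hc_c (Suc s) + hc_scale (qq - 1) (y * hc_c s)"
    and "t \<noteq> s \<Longrightarrow> t \<noteq> Suc s \<Longrightarrow> y * hc_c t * hc_T s = hc_scale qq (y * hc_c t)"
proof -
  have push: "y * (hc_T s * g) = hc_scale qq (y * g)" for g
    by (simp add: y hc_scale_mult_left flip: mult.assoc)
  show "y * hc_c (Suc s) * hc_T s = hc_scale qq (y * hc_c s)"
    by (simp add: mult.assoc hc_T_c_left[symmetric] push)
  have "hc_c s * hc_T s = hc_T s * hc_c (Suc s) + hc_scale (qq - 1) (hc_c s - hc_c (Suc s) :: 'r hc)"
    by (simp add: hc_T_c_right[OF s])
  then show "y * hc_c s * hc_T s = y * hc_c (Suc s) + hc_scale (qq - 1) (y * hc_c s)"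
    by (simp add: mult.assoc distrib_left right_diff_distrib push hc_scale_mult_right
        hc.scale_right_diff_distrib hc.scale_left_diff_distrib)
  show "y * hc_c t * hc_T s = hc_scale qq (y * hc_c t)" if "t \<noteq> s" "t \<noteq> Suc s"
    by (simp add: mult.assoc hc_T_c_commute[OF that, symmetric] push)
qed

text \<open>
  \<open>c\<^sub>q\<close> does not commute with \<open>T\<^sub>s\<close>, but right multiplication by it preserves the eigenvalue
  equation: the weights \<open>q\<^bsup>j-t\<^esup>\<close> are in the ratio that the relations of \<open>T\<^sub>s\<close> with
  \<open>c\<^sub>s, c\<^bsub>s+1\<^esub>\<close> demand.
\<close>

lemma T_eigen_mult_cq:
  fixes y :: "'r::finite hc"
  assumes s: "1 \<le> s" "s < CARD('r)" and y: "y * hc_T s = hc_scale qq y"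
    and ij: "s \<in> {i..j} \<longleftrightarrow> Suc s \<in> {i..j}"
  shows "y * cq i j * hc_T s = hc_scale qq (y * cq i j)"
proof -
  let ?g = "\<lambda>t. hc_scale (qq ^ (j - t)) (y * hc_c t)"
  have expand: "y * cq i j = (\<Sum>t=i..j. ?g t)"
    by (simp add: cq_def sum_distrib_left hc_scale_mult_right)
  note c = T_eigen_step_c[OF s y]
  have other: "?g t * hc_T s = hc_scale qq (?g t)" if "t \<noteq> s" "t \<noteq> Suc s" for t
    using c(3)[OF that] by (simp add: hc_scale_mult_left mult.commute)
  show ?thesis
  proof (cases "s \<in> {i..j}")
    case False
    then have "t \<noteq> s \<and> t \<noteq> Suc s" if "t \<in> {i..j}" for t
      using ij that by metis
    then show ?thesis
      unfolding expand sum_distrib_right hc.scale_sum_right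
      by (intro sum.cong refl other) auto
  next
    case True
    then have js: "j - s = Suc (j - Suc s)" using ij by auto
    have split: "(\<Sum>t=i..j. f t) = (\<Sum>t\<in>{i..j} - {s, Suc s}. f t) + (f s + f (Suc s))"
      for f :: "nat \<Rightarrow> 'r hc"
      using True ij sum.subset_diff[of "{s, Suc s}" "{i..j}" f] by auto
    define a Y Z where "a = qq ^ (j - Suc s)" and "Y = y * hc_c (Suc s)" and "Z = y * hc_c s"
    have "hc_scale (a * qq * (qq - 1)) Z + hc_scale (a * qq) Z = hc_scale (qq * (a * qq)) Z"
      unfolding hc.scale_left_distrib[symmetric] by (simp add: algebra_simps)
    moreover have "?g s = hc_scale (a * qq) Z" "?g (Suc s) = hc_scale a Y"
      by (simp_all add: js a_def Y_def Z_def mult.commute)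
    moreover have "Z * hc_T s = Y + hc_scale (qq - 1) Z" "Y * hc_T s = hc_scale qq Z"
      using c(1,2) by (simp_all add: Y_def Z_def)
    ultimately have "(?g s + ?g (Suc s)) * hc_T s = hc_scale qq (?g s + ?g (Suc s))"
      by (simp add: distrib_right hc_scale_mult_left hc.scale_right_distrib mult.commute[of qq a]
          add.assoc)
    moreover have "(\<Sum>t\<in>{i..j} - {s, Suc s}. ?g t) * hc_T s =
        hc_scale qq (\<Sum>t\<in>{i..j} - {s, Suc s}. ?g t)"
      unfolding sum_distrib_right hc.scale_sum_right
      by (intro sum.cong refl other) auto
    ultimately show ?thesis
      unfolding expand split by (simp only: distrib_right hc.scale_right_distrib)
  qed
qed

lemma T_eigen_mult_cpow:
  fixes z :: "'r::finite hc"
  assumes z: "T_eigen N lam z"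
  shows "T_eigen N lam (z * cpow N lam alpha)"
  unfolding T_eigen_def
proof (intro allI impI, elim conjE)
  fix s assume s: "1 \<le> s" "s < CARD('r)" and y: "adj s \<in> young CARD('r) N lam"
  let ?cq = "\<lambda>k. cq (psum lam (k - 1) + 1) (psum lam k) :: 'r hc"
  have same: "s \<in> block lam k \<longleftrightarrow> Suc s \<in> block lam k" if "k \<in> {1..N}" for k
  proof -
    have "adj s ` block lam k = block lam k"
      using y that by (simp add: young_def)
    then show ?thesis
      by (metis image_eqI transpose_apply_first transpose_apply_second)
  qed
  have cq: "g * ?cq k ^ m * hc_T s = hc_scale qq (g * ?cq k ^ m)"
    if "k \<in> {1..N}" "g * hc_T s = hc_scale qq g" for k m g
  proof (induction m)
    case (Suc m)
    show ?case
      using T_eigen_mult_cq[OF s Suc, of "psum lam (k - 1) + 1" "psum lam k"] same[OF that(1)]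
      by (simp add: block_def power_Suc2 mult.assoc del: power_Suc)
  qed (simp add: that)
  have "g * prod_list (map (\<lambda>k. ?cq k ^ alpha k) ks) * hc_T s =
      hc_scale qq (g * prod_list (map (\<lambda>k. ?cq k ^ alpha k) ks))"
    if "set ks \<subseteq> {1..N}" "g * hc_T s = hc_scale qq g" for ks g
    using that
  proof (induction ks arbitrary: g)
    case (Cons k ks)
    then show ?case
      using Cons.IH[OF _ cq[of k g "alpha k"]] by (simp add: mult.assoc)
  qed simp
  then show "z * cpow N lam alpha * hc_T s = hc_scale qq (z * cpow N lam alpha)"
    unfolding cpow_def by this (use z s y in \<open>auto simp: T_eigen_def\<close>)
qed

subsection \<open>Compression by a two-sided eigenvector\<close>

definition cword :: "nat list \<Rightarrow> 'r::finite hc"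
  where "cword ws = prod_list (map hc_c ws)"

lemma cword_simps [simp]:
  "cword [] = 1" "cword (j # ws) = hc_c j * cword ws" "cword (us @ vs) = cword us * cword vs"
  by (simp_all add: cword_def)

lemma hc_span_mult:
  assumes "z \<in> hc.span B" and "\<And>b. b \<in> B \<Longrightarrow> l * b * g \<in> hc.span S"
  shows "l * z * g \<in> hc.span S"
proof (rule hc.span_induct[OF assms(1)])
  show "hc.subspace {z. l * z * g \<in> hc.span S}"
    by (auto simp: hc.subspace_def distrib_left distrib_right hc_scale_mult_left hc_scale_mult_right
        hc.span_zero hc.span_add hc.span_scale)
qed (use assms(2) in auto)

lemma hc_span_mult_right:
  "z \<in> hc.span B \<Longrightarrow> (\<And>b. b \<in> B \<Longrightarrow> b * g \<in> hc.span S) \<Longrightarrow> z * g \<in> hc.span S"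
  using hc_span_mult[of z B 1 g S] by simp

lemma hc_span_mult_left:
  "z \<in> hc.span B \<Longrightarrow> (\<And>b. b \<in> B \<Longrightarrow> l * b \<in> hc.span S) \<Longrightarrow> l * z \<in> hc.span S"
  using hc_span_mult[of z B l 1 S] by simp

text \<open>
  A letter \<open>T\<^sub>i\<close> moves to the front of any product of Clifford generators, up to products of
  Clifford generators alone.
\<close>

lemma cword_mult_T:
  "(cword ws * hc_T i :: 'r::finite hc) \<in> hc.span (range cword \<union> range (\<lambda>us. hc_T i * cword us))"
    (is "_ \<in> hc.span ?S")
proof (cases "1 \<le> i \<and> i < CARD('r)")
  case False
  then have "(hc_T i :: 'r hc) = 0" by (rule hc_T_out)
  then show ?thesis by (simp add: hc.span_zero)
next
  case True
  have base: "cword us \<in> hc.span ?S" "hc_T i * cword us \<in> hc.span ?S" for us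
    by (auto intro: hc.span_base)
  have base_c: "hc_c j * cword us \<in> hc.span ?S" "hc_T i * (hc_c j * cword us) \<in> hc.span ?S" for j us
    using base[of "j # us"] by simp_all
  have step: "hc_c j * (hc_T i * cword us) \<in> hc.span ?S" for j us
  proof -
    consider "j = i" | "j = Suc i" | "j \<noteq> i" "j \<noteq> Suc i" by blast
    then show ?thesis
    proof cases
      case 1
      have "hc_c i * hc_T i = hc_T i * hc_c (Suc i) + hc_scale (qq - 1) (hc_c i - hc_c (Suc i) :: 'r hc)"
        using True by (simp add: hc_T_c_right)
      then have "hc_c j * (hc_T i * cword us) = hc_T i * (hc_c (Suc i) * cword us) +
          hc_scale (qq - 1) (hc_c i * cword us - hc_c (Suc i) * cword us :: 'r hc)"
        by (simp add: 1 distrib_right left_diff_distrib hc_scale_mult_left flip: mult.assoc)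
      then show ?thesis
        by (simp add: base_c hc.span_add hc.span_scale hc.span_diff)
    next
      case 2
      then have "hc_c j * (hc_T i * cword us) = (hc_T i * (hc_c i * cword us) :: 'r hc)"
        by (simp add: hc_T_c_left flip: mult.assoc)
      then show ?thesis by (simp add: base_c)
    next
      case 3
      then have "hc_c j * (hc_T i * cword us) = (hc_T i * (hc_c j * cword us) :: 'r hc)"
        by (simp add: hc_T_c_commute flip: mult.assoc)
      then show ?thesis by (simp add: base_c)
    qed
  qed
  show ?thesis
  proof (induction ws)
    case Nil
    then show ?case using base(2)[of "[]"] by simp
  next
    case (Cons j ws)
    have "hc_c j * (cword ws * hc_T i) \<in> hc.span ?S"
      using Cons by (rule hc_span_mult_left) (auto simp: step base_c)
    then show ?case by (simp add: mult.assoc)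
  qed
qed

text \<open>
  By anticommutation and \<open>c\<^sub>j\<^sup>2 = -1\<close>, words in the Clifford generators reduce to strictly
  increasing ones.
\<close>

lemma cword_insert:
  assumes "sorted_wrt (<) us"
  shows "\<exists>vs. sorted_wrt (<) vs \<and> set vs \<subseteq> insert j (set us) \<and>
    ((hc_c j * cword us :: 'r::finite hc) = cword vs \<or> hc_c j * cword us = (- cword vs :: 'r hc) \<or>
      hc_c j * cword us = (0 :: 'r hc))"
  using assms
proof (induction us)
  case Nil
  then show ?case by (intro exI[of _ "[j]"]) simp
next
  case (Cons i us)
  consider "j < i" | "j = i" | "i < j" by linarith
  then show ?case
  proof cases
    case 1
    then show ?thesis using Cons.prems by (intro exI[of _ "j # i # us"]) auto
  next
    case 2
    have "(hc_c j * cword (i # us) :: 'r hc) = - cword us \<or> (hc_c j * cword (i # us) :: 'r hc) = 0"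
    proof (cases "1 \<le> j \<and> j \<le> CARD('r)")
      case True
      then show ?thesis using 2 hc_c_square[of j, where 'r = 'r] by (simp flip: mult.assoc)
    next
      case False
      then have "(hc_c j :: 'r hc) = 0" by (rule hc_c_out)
      then show ?thesis by simp
    qed
    then show ?thesis using Cons.prems by (intro exI[of _ us]) auto
  next
    case 3
    obtain vs where vs: "sorted_wrt (<) vs" "set vs \<subseteq> insert j (set us)"
      "(hc_c j * cword us :: 'r hc) = cword vs \<or> hc_c j * cword us = (- cword vs :: 'r hc) \<or>
        hc_c j * cword us = (0 :: 'r hc)"
      using Cons by auto
    have "hc_c j * cword (i # us) = - (hc_c i * (hc_c j * cword us) :: 'r hc)"
      using hc_c_anticommute[of j i, where 'r = 'r] 3 by (simp flip: mult.assoc)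
    then show ?thesis
      using vs 3 Cons.prems by (intro exI[of _ "i # vs"]) auto
  qed
qed

lemma cword_in_span_sorted:
  "(cword ws :: 'r::finite hc) \<in> hc.span (cword ` {us. sorted_wrt (<) us})"
proof (induction ws)
  case Nil
  then show ?case by (intro hc.span_base image_eqI[of _ _ "[]"]) auto
next
  case (Cons j ws)
  have "hc_c j * cword ws \<in> hc.span (cword ` {us. sorted_wrt (<) us} :: 'r hc set)"
    using Cons
  proof (rule hc_span_mult_left)
    fix b :: "'r hc" assume "b \<in> cword ` {us. sorted_wrt (<) us}"
    then obtain us where us: "b = cword us" "sorted_wrt (<) us" by blast
    then obtain vs where "sorted_wrt (<) vs"
      "hc_c j * b = cword vs \<or> hc_c j * b = - cword vs \<or> hc_c j * b = 0"
      using cword_insert by blast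
    then show "hc_c j * b \<in> hc.span (cword ` {us. sorted_wrt (<) us})"
      by (auto simp: hc.span_base hc.span_neg hc.span_zero)
  qed
  then show ?case by simp
qed

text \<open>
  Let every \<open>T\<^sub>s\<close> act on \<open>x\<close> by \<open>q\<close> from both sides. Commuting \<open>T\<^sub>s\<close> through \<open>x \<dots> x\<close> in two ways
  shows that a Clifford generator may be moved to an adjacent free index, and that two generators
  at adjacent indices can be removed. So a product of Clifford generators between two copies of
  \<open>x\<close> reduces to one with at most one factor.
\<close>

lemma cword_T_commute:
  "s \<notin> set us \<Longrightarrow> Suc s \<notin> set us \<Longrightarrow> hc_T s * cword us = (cword us * hc_T s :: 'r::finite hc)"
proof (induction us)
  case (Cons j us)
  have "hc_T s * hc_c j = (hc_c j * hc_T s :: 'r hc)"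
    using Cons.prems by (intro hc_T_c_commute) auto
  then have "hc_T s * (hc_c j * cword us) = (hc_c j * (hc_T s * cword us) :: 'r hc)"
    by (simp only: mult.assoc[symmetric])
  also have "hc_T s * cword us = (cword us * hc_T s :: 'r hc)"
    using Cons by simp
  finally show ?case by (simp add: mult.assoc)
qed simp

context
  fixes x :: "'r::finite hc"
  assumes right: "\<And>s. 1 \<le> s \<Longrightarrow> s < CARD('r) \<Longrightarrow> x * hc_T s = hc_scale qq x"
    and left: "\<And>s. 1 \<le> s \<Longrightarrow> s < CARD('r) \<Longrightarrow> hc_T s * x = hc_scale qq x"
begin

lemma sandwich_shift:
  assumes s: "1 \<le> s" "s < CARD('r)" and u: "hc_T s * u = u * hc_T s"
  shows "x * (hc_c s * u) * x = x * (hc_c (Suc s) * u) * x"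
proof -
  have "hc_scale qq (x * (hc_c (Suc s) * u) * x) = x * hc_c (Suc s) * (u * hc_T s) * x"
    by (simp add: mult.assoc left[OF s] hc_scale_mult_right)
  also have "\<dots> = x * hc_c (Suc s) * hc_T s * u * x"
    by (simp add: u[symmetric] mult.assoc)
  also have "\<dots> = hc_scale qq (x * (hc_c s * u) * x)"
    by (simp only: T_eigen_step_c(1)[OF s right[OF s]] hc_scale_mult_left) (simp only: mult.assoc)
  finally show ?thesis by simp
qed

lemma sandwich_remove:
  assumes s: "1 \<le> s" "s < CARD('r)" and u: "hc_T s * u = u * hc_T s"
  shows "x * (hc_c s * (hc_c (Suc s) * u)) * x = hc_scale (- (qq - 1) / (qq + 1)) (x * u * x)"
proof -
  let ?X = "x * (hc_c s * (hc_c (Suc s) * u)) * x"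
  have swap: "hc_c (Suc s) * hc_c s = - (hc_c s * hc_c (Suc s) :: 'r hc)"
    by (rule hc_c_anticommute) simp
  have sq: "hc_c s * hc_c s = (- 1 :: 'r hc)"
    using s by (intro hc_c_square) auto
  have "hc_scale qq ?X = x * hc_c s * hc_c (Suc s) * (u * hc_T s) * x"
    by (simp add: mult.assoc left[OF s] hc_scale_mult_right)
  also have "\<dots> = x * hc_c s * (hc_c (Suc s) * hc_T s) * u * x"
    by (simp add: u[symmetric] mult.assoc)
  also have "\<dots> = (x * hc_c s * hc_T s) * hc_c s * u * x"
    by (simp add: hc_T_c_left[symmetric] mult.assoc)
  also have "\<dots> = (x * (hc_c (Suc s) * hc_c s) + hc_scale (qq - 1) (x * (hc_c s * hc_c s))) * u * x"
    by (simp only: T_eigen_step_c(2)[OF s right[OF s]])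
      (simp only: distrib_right hc_scale_mult_left mult.assoc)
  also have "\<dots> = - ?X - hc_scale (qq - 1) (x * u * x)"
    by (simp add: swap sq left_diff_distrib hc_scale_mult_left mult.assoc)
  finally have "hc_scale (qq + 1) ?X = - hc_scale (qq - 1) (x * u * x)"
    by (simp add: hc.scale_left_distrib)
  then have "hc_scale (1 / (qq + 1)) (hc_scale (qq + 1) ?X) =
      hc_scale (1 / (qq + 1)) (- hc_scale (qq - 1) (x * u * x))"
    by simp
  then show ?thesis
    using qq_plus_1_neq_0 by (simp flip: hc.scale_minus_left)
qed

lemma sandwich_c: "1 \<le> j \<Longrightarrow> j \<le> CARD('r) \<Longrightarrow> x * hc_c j * x = x * hc_c 1 * x"
proof (induction j rule: nat_induct_at_least[of 1])
  case (Suc j)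
  then show ?case using sandwich_shift[of j 1] by simp
qed simp

lemma sandwich_cword:
  "sorted_wrt (<) us \<Longrightarrow> x * cword us * x \<in> hc.span {x * x, x * hc_c 1 * x}"
proof (induction "length us" arbitrary: us rule: less_induct)
  case less
  \<comment> \<open>The gap \<open>d\<close> between the two smallest indices is closed step by step. The index \<open>j + 1\<close> is
    free as long as \<open>d\<close> is positive, and generators with indices outside \<open>{1..r}\<close> vanish.\<close>
  have pair: "x * cword (j # k # vs) * x \<in> hc.span {x * x, x * hc_c 1 * x}"
    if "sorted_wrt (<) (j # k # vs)" "k = Suc (j + d)" "length us = length (j # k # vs)" for j k d vs
    using that
  proof (induction d arbitrary: j)
    case 0
    show ?case
    proof (cases "1 \<le> j \<and> j < CARD('r)")
      case True
      have "j \<notin> set vs" "Suc j \<notin> set vs" using 0 by auto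
      then show ?thesis
        using sandwich_remove[of j "cword vs"] True 0 less.hyps[of vs]
        by (simp add: cword_T_commute hc.span_scale)
    next
      case False
      then have "(hc_c j :: 'r hc) = 0 \<or> (hc_c k :: 'r hc) = 0"
        using 0 hc_c_out by (metis Suc_leI add_0_right not_less_eq_eq not_le)
      then show ?thesis by (auto simp: hc.span_zero)
    qed
  next
    case (Suc d)
    have rest: "x * cword (Suc j # k # vs) * x \<in> hc.span {x * x, x * hc_c 1 * x}"
      using Suc by (intro Suc.IH) auto
    show ?case
    proof (cases "1 \<le> j \<and> j < CARD('r)")
      case True
      have "j \<notin> set (k # vs)" "Suc j \<notin> set (k # vs)" using Suc.prems by auto
      from cword_T_commute[OF this] show ?thesis
        using sandwich_shift[of j "cword (k # vs)"] True rest
        by (metis cword_simps(2))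
    next
      case False
      then have "(hc_c j :: 'r hc) = 0 \<or> (hc_c k :: 'r hc) = 0"
        using Suc.prems hc_c_out[where 'r = 'r] by (cases "1 \<le> j") auto
      then show ?thesis by (auto simp: hc.span_zero)
    qed
  qed
  consider "us = []" | j where "us = [j]" | j k vs where "us = j # k # vs"
    by (cases us; cases "tl us") auto
  then show ?case
  proof cases
    case 1
    then show ?thesis by (simp add: hc.span_base)
  next
    case (2 j)
    show ?thesis
    proof (cases "1 \<le> j \<and> j \<le> CARD('r)")
      case True
      then show ?thesis using 2 sandwich_c[of j] by (simp add: hc.span_base)
    next
      case False
      then have "(hc_c j :: 'r hc) = 0" by (rule hc_c_out)
      then show ?thesis using 2 by (simp add: hc.span_zero)
    qed
  next
    case (3 j k vs)
    then show ?thesis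
      using pair[of j k vs "k - Suc j"] less.prems by auto
  qed
qed

lemma ideal_in_span_cwords: "x * h \<in> hc.span (range (\<lambda>ws. x * cword ws))"
proof -
  let ?S = "range (\<lambda>ws. x * cword ws)"
  have "z * h \<in> hc.span ?S" if "z \<in> hc.span ?S" for z
    using that
  proof (induction h arbitrary: z rule: hc_induct)
    case (scalar a)
    then show ?case
      by (metis hc_of_scalar_central hc_of_scalar_mult_eq hc.span_scale)
  next
    case (T i)
    then show ?case
    proof (rule hc_span_mult_right)
      fix b assume "b \<in> ?S"
      then obtain ws where b: "b = x * cword ws" by blast
      have "x * (cword ws * hc_T i) \<in> hc.span ?S"
      proof (rule hc_span_mult_left[OF cword_mult_T[of ws i]])
        fix b' :: "'r hc" assume "b' \<in> range cword \<union> range (\<lambda>us. hc_T i * cword us)"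
        then consider us where "b' = cword us" | us where "b' = hc_T i * cword us" by blast
        then show "x * b' \<in> hc.span ?S"
        proof cases
          case 1
          then show ?thesis by (simp add: hc.span_base)
        next
          case (2 us)
          show ?thesis
          proof (cases "1 \<le> i \<and> i < CARD('r)")
            case True
            then have "x * b' = hc_scale qq (x * cword us)"
              using right by (simp add: 2 hc_scale_mult_left flip: mult.assoc)
            then show ?thesis by (simp add: hc.span_base hc.span_scale)
          next
            case False
            then have "(hc_T i :: 'r hc) = 0" by (rule hc_T_out)
            then show ?thesis by (simp add: 2 hc.span_zero)
          qed
        qed
      qed
      then show "b * hc_T i \<in> hc.span ?S" by (simp add: b mult.assoc)
    qed
  next
    case (c j)
    then show ?case
    proof (rule hc_span_mult_right)
      fix b assume "b \<in> ?S"
      then obtain ws where "b = x * cword ws" by blast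
      then have "b * hc_c j = x * cword (ws @ [j])" by (simp add: mult.assoc)
      then show "b * hc_c j \<in> hc.span ?S" by (simp add: hc.span_base del: cword_simps)
    qed
  next
    case (add g h)
    then show ?case by (simp add: distrib_left hc.span_add)
  next
    case (mult g h)
    then show ?case by (simp flip: mult.assoc)
  qed
  moreover have "x \<in> hc.span ?S"
    by (rule hc.span_base, rule range_eqI[of _ _ "[]"]) simp
  ultimately show ?thesis by blast
qed

lemma sandwich_in_span: "x * h * x \<in> hc.span {x * x, x * hc_c 1 * x}"
proof (rule hc_span_mult_right[OF ideal_in_span_cwords])
  fix b assume "b \<in> range (\<lambda>ws. x * cword ws)"
  then obtain ws where b: "b = x * cword ws" by blast
  have "x * cword ws * x \<in> hc.span {x * x, x * hc_c 1 * x}"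
  proof (rule hc_span_mult[OF cword_in_span_sorted])
    fix b' :: "'r hc" assume "b' \<in> cword ` {us. sorted_wrt (<) us}"
    then show "x * b' * x \<in> hc.span {x * x, x * hc_c 1 * x}"
      using sandwich_cword by blast
  qed
  then show "b * x \<in> hc.span {x * x, x * hc_c 1 * x}" by (simp add: b)
qed

end

text \<open>
  Multiplying a \<open>T\<close>-eigenvector \<open>z = x h\<close> by \<open>x\<close> once more changes it only by the Poincare
  polynomial, so the description of \<open>x H x\<close> applies; \<open>x c\<^sub>1 x\<close> and \<open>x c\<^sub>q\<close> are proportional by
  the same argument.
\<close>

lemma T_eigen_in_full_ideal:
  fixes h :: "'r::finite hc"
  assumes lam: "psum lam N = CARD('r)"
    and full: "\<And>s. 1 \<le> s \<Longrightarrow> s < CARD('r) \<Longrightarrow> adj s \<in> young CARD('r) N lam"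
    and z: "T_eigen N lam (xx N lam * h)"
  shows "xx N lam * h \<in> hc.span {xx N lam, xx N lam * cq 1 CARD('r)}"
proof -
  define X :: "'r hc" where "X = xx N lam"
  define P where "P = poincare CARD('r) N lam"
  let ?Y = "hc.span {X, X * cq 1 CARD('r)}"
  have right: "X * hc_T s = hc_scale qq X" if "1 \<le> s" "s < CARD('r)" for s
    unfolding X_def using that full by (intro xx_T_right)
  have left: "hc_T s * X = hc_scale qq X" if "1 \<le> s" "s < CARD('r)" for s
    unfolding X_def using that full by (intro xx_T_left)
  have P: "P \<noteq> 0" unfolding P_def by (rule poincare_neq_0)
  have XX: "y * X = hc_scale P y" if "T_eigen N lam y" for y
    unfolding X_def P_def by (rule T_eigen_mult_xx[OF lam that])
  have eX: "T_eigen N lam X" unfolding X_def by (rule T_eigen_xx)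
  have "T_eigen N lam (X * cq 1 CARD('r))"
    unfolding T_eigen_def by (intro allI impI T_eigen_mult_cq right) auto
  then have "hc_scale P (X * cq 1 CARD('r)) = X * cq 1 CARD('r) * X"
    by (rule XX[symmetric])
  also have "\<dots> = (\<Sum>t=1..CARD('r). hc_scale (qq ^ (CARD('r) - t)) (X * hc_c t * X))"
    by (simp add: cq_def sum_distrib_left sum_distrib_right hc_scale_mult_left hc_scale_mult_right)
  also have "\<dots> = hc_scale (\<Sum>t=1..CARD('r). qq ^ (CARD('r) - t)) (X * hc_c 1 * X)"
    unfolding hc.scale_sum_left
    by (intro sum.cong refl arg_cong2[of _ _ _ _ hc_scale] sandwich_c[OF right left]) auto
  finally have c1: "hc_scale P (X * cq 1 CARD('r)) =
      hc_scale (\<Sum>t=1..CARD('r). qq ^ (CARD('r) - t)) (X * hc_c 1 * X)" .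
  define R where "R = (\<Sum>t=1..CARD('r). qq ^ (CARD('r) - t))"
  have "R \<noteq> 0" unfolding R_def
    by (rule sum_qq_powers_neq_0) (use zero_less_card_finite[where 'a = 'r] in \<open>auto simp: Suc_le_eq\<close>)
  then have "X * hc_c 1 * X = hc_scale (1 / R) (hc_scale R (X * hc_c 1 * X))"
    by simp
  also have "\<dots> = hc_scale (1 / R) (hc_scale P (X * cq 1 CARD('r)))"
    by (simp only: c1 R_def)
  also have "\<dots> \<in> ?Y"
    by (intro hc.span_scale hc.span_base) simp
  finally have "{X * X, X * hc_c 1 * X} \<subseteq> ?Y"
    using XX[OF eX] by (simp add: hc.span_scale hc.span_base)
  then have "hc.span {X * X, X * hc_c 1 * X} \<subseteq> ?Y"
    by (rule hc.span_minimal) (rule hc.subspace_span)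
  then have "X * h * X \<in> ?Y"
    using sandwich_in_span[OF right left, of h] by blast
  then have "hc_scale P (X * h) \<in> ?Y"
    using XX[of "X * h"] z by (simp add: X_def)
  then have "hc_scale (1 / P) (hc_scale P (X * h)) \<in> ?Y"
    by (rule hc.span_scale)
  then show ?thesis using P by (simp add: X_def)
qed

section \<open>The parity automorphism\<close>

text \<open>
  The parity automorphism negates the odd generators. It is first defined on formal expressions and
  respects the congruence because every defining relation is homogeneous.
\<close>

primrec parity_eval :: "hc_term \<Rightarrow> 'r::finite hc" where
  "parity_eval (Scal a) = hc_of_scalar a"
| "parity_eval (TGen i) = hc_T i"
| "parity_eval (CGen j) = - hc_c j"
| "parity_eval (s \<boxplus> t) = parity_eval s + parity_eval t"
| "parity_eval (s \<boxtimes> t) = parity_eval s * parity_eval t"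

lemma hc_of_scalar_diff: "hc_of_scalar (a - b) = hc_of_scalar a - hc_of_scalar b"
  using hc_of_scalar_add[of a "- b"] by (simp add: hc_of_scalar_uminus)

lemma parity_eval_rel:
  assumes "hc_rel CARD('r) s t"
  shows "parity_eval s = (parity_eval t :: 'r::finite hc)"
  using assms
proof cases
  case (rel_quadratic i)
  then show ?thesis
    using hc_T_quadratic[of i, where 'r = 'r]
    by (simp add: hc_of_scalar_0 hc_of_scalar_one hc_of_scalar_uminus distrib_left left_diff_distrib
        hc.scale_left_diff_distrib hc_scale_mult_left hc_of_scalar_mult_eq)
      (simp add: hc_scale_def)
next
  case (rel_TT_comm i j)
  then show ?thesis
    using hc_T_far_commute[of i j, where 'r = 'r] hc_T_far_commute[of j i, where 'r = 'r] by auto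
next
  case (rel_CC_anticomm i j)
  then show ?thesis
    using hc_c_anticommute[of i j, where 'r = 'r]
    by (simp add: hc_of_scalar_uminus hc_of_scalar_one)
next
  case (rel_TC_right i)
  then show ?thesis
    using hc_T_c_right[of i, where 'r = 'r]
    by (simp add: hc_of_scalar_uminus hc_of_scalar_one hc_of_scalar_diff hc_scale_def
        right_diff_distrib left_diff_distrib)
qed (simp_all add: hc_T_out hc_c_out hc_of_scalar_0 hc_T_braid hc_c_square hc_of_scalar_uminus
    hc_of_scalar_one hc_T_c_commute hc_T_c_left)

lemma parity_eval_cong:
  "hc_cong CARD('r) s t \<Longrightarrow> parity_eval s = (parity_eval t :: 'r::finite hc)"
  by (induction rule: hc_cong.induct)
    (auto simp: parity_eval_rel algebra_simps hc_of_scalar_0 hc_of_scalar_one hc_of_scalar_uminus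
      hc_of_scalar_add hc_of_scalar_mult intro: hc_of_scalar_central)

definition hc_parity :: "'r::finite hc \<Rightarrow> 'r hc"
  where "hc_parity h = parity_eval (rep_hc h)"

lemma hc_parity_abs: "hc_parity (abs_hc t :: 'r::finite hc) = parity_eval t"
  unfolding hc_parity_def
  by (rule parity_eval_cong) (rule Quotient3_rep_abs[OF Quotient3_hc hcc_refl])

lemma hc_parity_simps [simp]:
  "hc_parity (hc_of_scalar a) = (hc_of_scalar a :: 'r::finite hc)"
  "hc_parity (hc_T i) = (hc_T i :: 'r hc)"
  "hc_parity (hc_c j) = (- hc_c j :: 'r hc)"
  by (simp_all add: hc_of_scalar.abs_eq hc_T.abs_eq hc_c.abs_eq hc_parity_abs)

lemma hc_parity_add: "hc_parity (g + h) = hc_parity g + (hc_parity h :: 'r::finite hc)"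
  by (induction g rule: hc.abs_induct, induction h rule: hc.abs_induct)
    (simp add: plus_hc.abs_eq hc_parity_abs)

lemma hc_parity_mult: "hc_parity (g * h) = hc_parity g * (hc_parity h :: 'r::finite hc)"
  by (induction g rule: hc.abs_induct, induction h rule: hc.abs_induct)
    (simp add: times_hc.abs_eq hc_parity_abs)

lemma hc_parity_scale: "hc_parity (hc_scale a h) = hc_scale a (hc_parity h)"
  by (simp add: hc_scale_def hc_parity_mult)

lemma hc_homogeneous_parity:
  "hc_homogeneous p h \<Longrightarrow> p \<in> {0, 1} \<and> hc_parity h = hc_scale ((- 1) ^ p) (h :: 'r::finite hc)"
proof (induction rule: hc_homogeneous.induct)
  case (hom_mult p g p' h)
  then show ?case
    by (auto simp: hc_parity_mult hc_scale_mult_left hc_scale_mult_right)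
qed (auto simp: hc_parity_add hc.scale_right_distrib hc_scale_uminus_one)

lemma zero_homogeneous: "p \<in> {0, 1} \<Longrightarrow> hc_homogeneous p (0 :: 'r::finite hc)"
  using hom_scalar[of 0, where 'r = 'r] hom_c[of 0, where 'r = 'r] hc_c_out[of 0, where 'r = 'r]
  by (auto simp: hc_of_scalar_0)

lemma hc_homogeneous_scale: "hc_homogeneous p h \<Longrightarrow> hc_homogeneous p (hc_scale a (h :: 'r::finite hc))"
  using hom_mult[OF hom_scalar, of p h a] hc_homogeneous_parity[of p h]
  by (auto simp: hc_scale_def)

lemma hc_homogeneous_sum:
  "p \<in> {0, 1} \<Longrightarrow> (\<And>i. i \<in> I \<Longrightarrow> hc_homogeneous p (f i)) \<Longrightarrow>
    hc_homogeneous p (\<Sum>i\<in>I. f i :: 'r::finite hc)"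
  by (induction I rule: infinite_finite_induct) (auto intro: zero_homogeneous hom_add)

lemma hc_homogeneous_even_mult:
  "hc_homogeneous 0 g \<Longrightarrow> hc_homogeneous p h \<Longrightarrow> hc_homogeneous p (g * h :: 'r::finite hc)"
  "hc_homogeneous p h \<Longrightarrow> hc_homogeneous 0 g \<Longrightarrow> hc_homogeneous p (h * g :: 'r::finite hc)"
  using hom_mult[of 0 g p h] hom_mult[of p h 0 g] hc_homogeneous_parity[of p h] by auto

lemma ex_homogeneous_parts:
  "\<exists>g0 g1. hc_homogeneous 0 g0 \<and> hc_homogeneous 1 g1 \<and> h = g0 + (g1 :: 'r::finite hc)"
proof (induction h rule: hc_induct)
  case (scalar a)
  show ?case
    by (intro exI[of _ "hc_of_scalar a"] exI[of _ 0]) (auto intro: hom_scalar zero_homogeneous)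
next
  case (T i)
  show ?case
    by (intro exI[of _ "hc_T i"] exI[of _ 0]) (auto intro: hom_T zero_homogeneous)
next
  case (c j)
  show ?case
    by (intro exI[of _ 0] exI[of _ "hc_c j"]) (auto intro: hom_c[unfolded One_nat_def] zero_homogeneous)
next
  case (add g h)
  then obtain g0 g1 h0 h1 where "hc_homogeneous 0 g0" "hc_homogeneous 1 g1" "g = g0 + g1"
    "hc_homogeneous 0 h0" "hc_homogeneous 1 h1" "h = h0 + h1" by blast
  then show ?case
    by (intro exI[of _ "g0 + h0"] exI[of _ "g1 + h1"]) (auto intro: hom_add)
next
  case (mult g h)
  then obtain g0 g1 h0 h1 where *: "hc_homogeneous 0 g0" "hc_homogeneous 1 g1" "g = g0 + g1"
    "hc_homogeneous 0 h0" "hc_homogeneous 1 h1" "h = h0 + h1" by blast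
  then have "hc_homogeneous 0 (g0 * h0 + g1 * h1)" "hc_homogeneous 1 (g0 * h1 + g1 * h0)"
    using hom_mult[of 0 g0 0 h0] hom_mult[of 1 g1 1 h1] hom_mult[of 0 g0 1 h1] hom_mult[of 1 g1 0 h0]
    by (auto intro: hom_add)
  then show ?case using *
    by (intro exI[of _ "g0 * h0 + g1 * h1"] exI[of _ "g0 * h1 + g1 * h0"])
      (auto simp: distrib_left distrib_right add_ac)
qed

lemma hc_homogeneous_one: "hc_homogeneous 0 (1 :: 'r::finite hc)"
  using hom_scalar[of 1, where 'r = 'r] by (simp add: hc_of_scalar_one)

lemma hc_homogeneous_Tperm: "hc_homogeneous 0 (Tperm w :: 'r::finite hc)"
proof -
  have "hc_homogeneous 0 (prod_list (map hc_T ws) :: 'r hc)" for ws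
    by (induction ws) (auto intro: hc_homogeneous_one hc_homogeneous_even_mult hom_T)
  then show ?thesis by (simp add: Tperm_def)
qed

lemma hc_homogeneous_xx: "hc_homogeneous 0 (xx N lam :: 'r::finite hc)"
  unfolding xx_def by (rule hc_homogeneous_sum) (auto intro: hc_homogeneous_Tperm)

lemma hc_homogeneous_cq: "hc_homogeneous 1 (cq i j :: 'r::finite hc)"
  unfolding cq_def by (rule hc_homogeneous_sum) (auto intro: hc_homogeneous_scale hom_c[unfolded One_nat_def])

lemma hc_homogeneous_cpow:
  "hc_homogeneous ((\<Sum>k=1..N. alpha k) mod 2) (cpow N lam alpha :: 'r::finite hc)"
proof -
  have power: "hc_homogeneous (m mod 2) (cq i j ^ m :: 'r hc)" for i j m
  proof (induction m)
    case (Suc m)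
    then show ?case
      using hom_mult[OF hc_homogeneous_cq Suc, of i j] by (simp add: mod_Suc_eq)
  qed (simp add: hc_homogeneous_one)
  have "hc_homogeneous (sum_list (map alpha ks) mod 2)
      (prod_list (map (\<lambda>k. cq (psum lam (k - 1) + 1) (psum lam k) ^ alpha k) ks) :: 'r hc)" for ks
  proof (induction ks)
    case (Cons k ks)
    then show ?case
      using hom_mult[OF power[of "alpha k" "psum lam (k - 1) + 1" "psum lam k"] Cons]
      by (simp add: mod_add_eq)
  qed (simp add: hc_homogeneous_one)
  moreover have "(\<Sum>k=1..N. alpha k) = sum_list (map alpha [1..<N + 1])"
    unfolding interv_sum_list_conv_sum_set_nat set_upt by (simp add: atLeastLessThanSuc_atLeastAtMost)
  ultimately show ?thesis
    unfolding cpow_def by (simp only:)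
qed

section \<open>Endomorphisms of the sum of the ideals\<close>

lemma zero_in_range_mult: "(0 :: 'a::mult_zero) \<in> range ((*) x)"
  by (metis mult_zero_right rangeI)

lemma vspace_0 [simp]: "0 \<in> vspace n"
  by (simp add: vspace_def zero_in_range_mult)

lemma vspace_add: "m \<in> vspace n \<Longrightarrow> m' \<in> vspace n \<Longrightarrow> m + m' \<in> vspace n"
  unfolding vspace_def
  by (auto simp: distrib_left[symmetric] image_iff) (metis distrib_left)

lemma vspace_scale: "m \<in> vspace n \<Longrightarrow> vscale a m \<in> vspace n"
  by (auto simp: vspace_def vscale_def image_iff) (metis hc_scale_mult_right)

lemma vspace_act: "m \<in> vspace n \<Longrightarrow> vact m h \<in> vspace n"
  by (auto simp: vspace_def vact_def image_iff) (metis mult.assoc)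

lemma vspace_sum: "(\<And>i. i \<in> I \<Longrightarrow> f i \<in> vspace n) \<Longrightarrow> (\<Sum>i\<in>I. f i) \<in> vspace n"
  by (induction I rule: infinite_finite_induct) (auto intro: vspace_add)

lemma vspace_single: "mu \<in> Lam n CARD('r) \<Longrightarrow> vsingle mu (xx n mu * h :: 'r::finite hc) \<in> vspace n"
  by (simp add: vspace_def vsingle_def zero_in_range_mult)

lemma zero_homogeneous_mod: "hc_homogeneous (k mod 2) (0 :: 'r::finite hc)"
  by (rule zero_homogeneous) (cases "even k"; simp add: odd_iff_mod_2_eq_one)

lemma vpart_add:
  "m \<in> vpart n p \<Longrightarrow> m' \<in> vpart n p \<Longrightarrow> m + m' \<in> vpart n p"
  by (auto simp: vpart_def hc_part_def intro: vspace_add hom_add)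

lemma vpart_scale: "m \<in> vpart n p \<Longrightarrow> vscale a m \<in> vpart n p"
  by (simp add: vpart_def hc_part_def vspace_scale) (simp add: vscale_def hc_homogeneous_scale)

lemma vscale_add: "vscale a (m + m') = vscale a m + vscale a m'"
  by (simp add: vscale_def fun_eq_iff hc.scale_right_distrib)

lemma vscale_vscale: "vscale a (vscale b m) = vscale (a * b) m"
  by (simp add: vscale_def)

lemma vscale_1 [simp]: "vscale 1 m = m"
  by (simp add: vscale_def)

lemma finite_Lam: "finite (Lam n r)"
proof -
  have "Lam n r \<subseteq> {f. \<forall>i. (i \<in> {1..n} \<longrightarrow> f i \<in> {..r}) \<and> (i \<notin> {1..n} \<longrightarrow> f i = 0)}"
  proof (intro subsetI CollectI allI conjI impI)
    fix f i assume f: "f \<in> Lam n r"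
    show "f i \<in> {..r}" if "i \<in> {1..n}"
      using f member_le_sum[OF that, of f] by (auto simp: Lam_def)
    show "f i = 0" if "i \<notin> {1..n}"
      using f that by (auto simp: Lam_def)
  qed
  then show ?thesis
    by (rule finite_subset) (rule finite_set_of_finite_funs; simp)
qed

lemma vspace_decompose:
  assumes "m \<in> vspace n"
  shows "m = (\<Sum>mu\<in>Lam n CARD('r). vsingle mu (m mu :: 'r::finite hc))"
proof
  fix lam
  have "(\<Sum>mu\<in>Lam n CARD('r). vsingle mu (m mu)) lam = (\<Sum>mu\<in>Lam n CARD('r). vsingle mu (m mu) lam)"
    by (induction rule: infinite_finite_induct) auto
  also have "\<dots> = m lam"
    using assms finite_Lam[of n "CARD('r)"] by (auto simp: vsingle_def vspace_def)
  finally show "m lam = (\<Sum>mu\<in>Lam n CARD('r). vsingle mu (m mu)) lam" ..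
qed

lemma super_endoD:
  assumes "f \<in> super_endo n p"
  shows "m \<notin> vspace n \<Longrightarrow> f m = 0"
    and "f m \<in> vspace n"
    and "m \<in> vspace n \<Longrightarrow> m' \<in> vspace n \<Longrightarrow> f (m + m') = f m + f m'"
    and "m \<in> vspace n \<Longrightarrow> f (vscale a m) = vscale a (f m)"
    and "b \<in> {0, 1} \<Longrightarrow> m \<in> vpart n b \<Longrightarrow> f m \<in> vpart n ((p + b) mod 2)"
    and "b \<in> {0, 1} \<Longrightarrow> m \<in> vspace n \<Longrightarrow> h \<in> hc_part b \<Longrightarrow>
      f (vact m h) = vscale ((- 1) ^ (p * b)) (vact (f m) h)"
proof -
  show "f m = 0" if "m \<notin> vspace n" using assms that unfolding super_endo_def by blast
  then show "f m \<in> vspace n"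
    using assms unfolding super_endo_def by (cases "m \<in> vspace n") auto
  show "f (m + m') = f m + f m'" if "m \<in> vspace n" "m' \<in> vspace n"
    using assms that unfolding super_endo_def by blast
  show "f (vscale a m) = vscale a (f m)" if "m \<in> vspace n"
    using assms that unfolding super_endo_def by blast
  show "f m \<in> vpart n ((p + b) mod 2)" if "b \<in> {0, 1}" "m \<in> vpart n b"
    using assms that unfolding super_endo_def by blast
  show "f (vact m h) = vscale ((- 1) ^ (p * b)) (vact (f m) h)"
    if "b \<in> {0, 1}" "m \<in> vspace n" "h \<in> hc_part b"
    using assms that unfolding super_endo_def by blast
qed

lemma super_endo_subspace:
  assumes p: "p \<in> {0, 1}"
  shows "endo.subspace (super_endo n p :: 'r::finite endo set)"
  unfolding endo.subspace_def
proof (intro conjI ballI allI)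
  have "0 \<in> vpart n (k mod 2)" for k
    by (simp add: vpart_def hc_part_def zero_homogeneous_mod)
  then show "(0 :: 'r endo) \<in> super_endo n p"
    by (auto simp: super_endo_def vscale_def vact_def fun_eq_iff)
next
  fix f g :: "'r endo" assume f: "f \<in> super_endo n p" and g: "g \<in> super_endo n p"
  show "f + g \<in> super_endo n p"
    unfolding super_endo_def
  proof (intro CollectI conjI ballI allI impI)
    fix a and m :: "'r vfam" assume "a \<in> {0, 1 :: nat}" "m \<in> vpart n a"
    then show "(f + g) m \<in> vpart n ((p + a) mod 2)"
      using super_endoD(5)[OF f, of a m] super_endoD(5)[OF g, of a m]
      by (simp add: vpart_add)
  next
    fix a and h :: "'r hc" and m :: "'r vfam" assume *: "a \<in> {0, 1 :: nat}" "m \<in> vspace n" "h \<in> (hc_part a :: 'r hc set)"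
    show "(f + g) (vact m h) = vscale ((- 1) ^ (p * a)) (vact ((f + g) m) h)"
      using super_endoD(6)[OF f *] super_endoD(6)[OF g *]
      by (simp add: vscale_add[symmetric]) (simp add: vscale_def vact_def distrib_right fun_eq_iff)
  qed (auto simp: super_endoD[OF f] super_endoD[OF g] vscale_add add_ac intro: vspace_add)
next
  fix c and f :: "'r endo" assume f: "f \<in> super_endo n p"
  show "endo_scale c f \<in> super_endo n p"
    unfolding super_endo_def
  proof (intro CollectI conjI ballI allI impI)
    fix a and m :: "'r vfam" assume "a \<in> {0, 1 :: nat}" "m \<in> vpart n a"
    then show "endo_scale c f m \<in> vpart n ((p + a) mod 2)"
      using super_endoD(5)[OF f, of a m] by (simp add: vpart_scale endo_scale_def)
  next
    fix a and h :: "'r hc" and m :: "'r vfam" assume *: "a \<in> {0, 1 :: nat}" "m \<in> vspace n" "h \<in> (hc_part a :: 'r hc set)"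
    show "endo_scale c f (vact m h) = vscale ((- 1) ^ (p * a)) (vact (endo_scale c f m) h)"
      using super_endoD(6)[OF f *]
      by (simp add: endo_scale_def vscale_vscale)
        (simp add: vscale_def vact_def hc_scale_mult_left fun_eq_iff mult.commute)
  next
    fix m :: "'r vfam" assume "m \<notin> vspace n"
    then show "endo_scale c f m = 0"
      by (simp add: endo_scale_def super_endoD(1)[OF f]) (simp add: vscale_def fun_eq_iff)
  next
    fix a and m :: "'r vfam" assume "m \<in> vspace n"
    then show "endo_scale c f (vscale a m) = vscale a (endo_scale c f m)"
      by (simp add: endo_scale_def super_endoD(4)[OF f] vscale_vscale mult.commute)
  qed (auto simp: endo_scale_def super_endoD[OF f] vscale_add intro: vspace_scale)
qed

lemma qschur_iff:
  "(f :: 'a::finite endo) \<in> qschur n \<longleftrightarrow> (\<exists>f0 f1. f0 \<in> super_endo n 0 \<and> f1 \<in> super_endo n 1 \<and> f = f0 + f1)"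
proof -
  have "endo.span (super_endo n p) = (super_endo n p :: 'a endo set)" if "p \<in> {0, 1}" for p
    using super_endo_subspace[OF that] by (simp only: endo.span_eq_iff)
  then have "endo.span (super_endo n 0) = (super_endo n 0 :: 'a endo set)"
    "endo.span (super_endo n 1) = (super_endo n 1 :: 'a endo set)" by blast+
  then show ?thesis
    unfolding qschur_def endo.span_Un by (simp only:) blast
qed

lemma super_endo_subset_qschur: "p \<in> {0, 1} \<Longrightarrow> super_endo n p \<subseteq> qschur n"
  unfolding qschur_def using endo.span_superset by fastforce

lemma qschur_subspace: "endo.subspace (qschur n)"
  unfolding qschur_def by (rule endo.subspace_span)

lemma qschurD:
  assumes "f \<in> qschur n"
  shows "m \<notin> vspace n \<Longrightarrow> f m = 0"
    and "f m \<in> vspace n"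
    and "m \<in> vspace n \<Longrightarrow> m' \<in> vspace n \<Longrightarrow> f (m + m') = f m + f m'"
    and "m \<in> vspace n \<Longrightarrow> f (vscale a m) = vscale a (f m)"
proof -
  obtain f0 f1 where f: "f0 \<in> super_endo n 0" "f1 \<in> super_endo n 1" "f = f0 + f1"
    using assms qschur_iff by blast
  note D = super_endoD[OF f(1)] super_endoD[OF f(2)]
  show "f m = 0" if "m \<notin> vspace n" using that D by (simp add: f(3))
  show "f m \<in> vspace n" using D by (simp add: f(3) vspace_add)
  show "f (m + m') = f m + f m'" if "m \<in> vspace n" "m' \<in> vspace n"
    using that D by (simp add: f(3) add_ac)
  show "f (vscale a m) = vscale a (f m)" if "m \<in> vspace n"
    using that D by (simp add: f(3) vscale_add)
qed

lemma qschur_0: "f \<in> qschur n \<Longrightarrow> f 0 = 0"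
  using qschurD(3)[of f n 0 0] by simp

lemma qschur_sum:
  "f \<in> qschur n \<Longrightarrow> (\<And>i. i \<in> I \<Longrightarrow> m i \<in> vspace n) \<Longrightarrow> f (\<Sum>i\<in>I. m i) = (\<Sum>i\<in>I. f (m i))"
  by (induction I rule: infinite_finite_induct) (auto simp: qschur_0 qschurD vspace_sum)

lemma super_endo_comp:
  fixes f g :: "'r::finite endo"
  assumes f: "f \<in> super_endo n p" and g: "g \<in> super_endo n p'"
    and p: "p \<in> {0, 1}" "p' \<in> {0, 1}"
  shows "f \<circ> g \<in> super_endo n ((p + p') mod 2)"
  unfolding super_endo_def
proof (intro CollectI conjI ballI allI impI)
  have f0: "f 0 = 0" using super_endoD(3)[OF f, of 0 0] by simp
  show "(f \<circ> g) m = 0" if "m \<notin> vspace n" for m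
    using that by (simp add: super_endoD(1)[OF g] f0)
  show "(f \<circ> g) m \<in> vspace n" for m
    by (simp add: super_endoD(2)[OF f])
  show "(f \<circ> g) (m + m') = (f \<circ> g) m + (f \<circ> g) m'" if "m \<in> vspace n" "m' \<in> vspace n" for m m' :: "'r vfam"
    using that by (simp add: super_endoD[OF g] super_endoD[OF f])
  show "(f \<circ> g) (vscale a m) = vscale a ((f \<circ> g) m)" if "m \<in> vspace n" for a and m :: "'r vfam"
    using that by (simp add: super_endoD[OF g] super_endoD[OF f])
next
  fix a and m :: "'r vfam" assume a: "a \<in> {0, 1 :: nat}" and m: "m \<in> vpart n a"
  have "f (g m) \<in> vpart n ((p + (p' + a) mod 2) mod 2)"
    by (rule super_endoD(5)[OF f _ super_endoD(5)[OF g a m]]) auto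
  then show "(f \<circ> g) m \<in> vpart n (((p + p') mod 2 + a) mod 2)"
    by (simp add: mod_simps add.assoc)
next
  fix a and h :: "'r hc" and m :: "'r vfam" assume *: "a \<in> {0, 1 :: nat}" "m \<in> vspace n" "h \<in> hc_part a"
  have "f (g (vact m h)) = vscale ((- 1) ^ (p' * a)) (vscale ((- 1) ^ (p * a)) (vact (f (g m)) h))"
    by (simp add: super_endoD(6)[OF g *] super_endoD(4)[OF f] vspace_act super_endoD(2)[OF g]
        super_endoD(6)[OF f *(1) _ *(3)])
  then show "(f \<circ> g) (vact m h) = vscale ((- 1) ^ ((p + p') mod 2 * a)) (vact ((f \<circ> g) m) h)"
    using p *(1) by (auto simp: vscale_vscale)
qed

lemma qschur_comp:
  assumes f: "f \<in> qschur n" and g: "g \<in> qschur n"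
  shows "f \<circ> g \<in> qschur n"
proof -
  obtain f0 f1 where f01: "f0 \<in> super_endo n 0" "f1 \<in> super_endo n 1" "f = f0 + f1"
    using f qschur_iff by blast
  obtain g0 g1 where g01: "g0 \<in> super_endo n 0" "g1 \<in> super_endo n 1" "g = g0 + g1"
    using g qschur_iff by blast
  have "f \<circ> g = ((f0 \<circ> g0) + (f1 \<circ> g1)) + ((f0 \<circ> g1) + (f1 \<circ> g0))"
    by (rule ext) (simp add: f01(3) g01(3) super_endoD(2,3)[OF f01(1)] super_endoD(2,3)[OF f01(2)]
        super_endoD(2)[OF g01(1)] super_endoD(2)[OF g01(2)] add_ac)
  moreover have "(f0 \<circ> g0) + (f1 \<circ> g1) \<in> super_endo n 0"
    using super_endo_comp[OF f01(1) g01(1)] super_endo_comp[OF f01(2) g01(2)]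
    by (intro endo.subspace_add super_endo_subspace) auto
  moreover have "(f0 \<circ> g1) + (f1 \<circ> g0) \<in> super_endo n 1"
    using super_endo_comp[OF f01(1) g01(2)] super_endo_comp[OF f01(2) g01(1)]
    by (intro endo.subspace_add super_endo_subspace) auto
  ultimately show ?thesis unfolding qschur_iff by blast
qed

text \<open>The elements \<open>x\<^sub>\<mu> h\<close> with homogeneous \<open>h\<close> span the sum of the ideals.\<close>

lemma qschur_ext:
  fixes f g :: "'r::finite endo"
  assumes f: "f \<in> qschur n" and g: "g \<in> qschur n"
    and eq: "\<And>mu a h. mu \<in> Lam n CARD('r) \<Longrightarrow> a \<in> {0, 1} \<Longrightarrow> h \<in> hc_part a \<Longrightarrow>
      f (vsingle mu (xx n mu * h)) = g (vsingle mu (xx n mu * h))"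
  shows "f = g"
proof
  fix m
  show "f m = g m"
  proof (cases "m \<in> vspace n")
    case True
    have single: "f (vsingle mu (m mu)) = g (vsingle mu (m mu)) \<and> vsingle mu (m mu) \<in> vspace n"
      if mu: "mu \<in> Lam n CARD('r)" for mu
    proof -
      obtain h where h: "m mu = xx n mu * h"
        using True mu by (auto simp: vspace_def)
      obtain h0 h1 where h01: "hc_homogeneous 0 h0" "hc_homogeneous 1 h1" "h = h0 + h1"
        using ex_homogeneous_parts by blast
      have "vsingle mu (m mu) = vsingle mu (xx n mu * h0) + vsingle mu (xx n mu * h1)"
        by (auto simp: h h01(3) vsingle_def fun_eq_iff distrib_left)
      then show ?thesis
        using eq[OF mu, of 0 h0] eq[OF mu, of 1 h1] vspace_single[OF mu] h01
        by (simp add: hc_part_def qschurD[OF f] qschurD[OF g] vspace_add)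
    qed
    show ?thesis
      using single by (subst (1 2) vspace_decompose[OF True])
        (simp add: qschur_sum[OF f] qschur_sum[OF g])
  qed (simp add: qschurD[OF f] qschurD[OF g])
qed

text \<open>
  If \<open>T\<^bsub>A\<^esub> = g x\<^sub>\<mu>\<close>, left multiplication by \<open>g\<close>, twisted by the parity automorphism when \<open>g\<close> is
  odd, is a well defined endomorphism with the values that characterise \<open>\<Phi>\<^bsub>A\<^esub>\<close>.
\<close>

lemma Phi_eqI:
  fixes g :: "'r::finite hc"
  assumes ro: "ro n (A0 + A1) \<in> Lam n CARD('r)" and co: "co n (A0 + A1) \<in> Lam n CARD('r)"
    and T: "Tmat n A0 A1 = g * xx n (co n (A0 + A1))"
    and g: "hc_homogeneous (mparity n A1) g"
  shows "Phi n A0 A1 = (\<lambda>m. if m \<in> vspace n then vsingle (ro n (A0 + A1))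
      (g * (hc_parity ^^ mparity n A1) (m (co n (A0 + A1)))) else 0)" (is "_ = ?f")
    and "(Phi n A0 A1 :: 'r endo) \<in> super_endo n (mparity n A1)"
proof -
  define p where "p = mparity n A1"
  have p: "p \<in> {0, 1}" by (auto simp: p_def mparity_def)
  let ?l = "ro n (A0 + A1)" and ?mu = "co n (A0 + A1)"
  have par: "(hc_parity ^^ p) (a + b) = (hc_parity ^^ p) a + (hc_parity ^^ p) b"
    "(hc_parity ^^ p) (a * b) = (hc_parity ^^ p) a * (hc_parity ^^ p) b"
    "(hc_parity ^^ p) (hc_scale c a) = hc_scale c ((hc_parity ^^ p) a)"
    "hc_homogeneous d a \<Longrightarrow> (hc_parity ^^ p) a = hc_scale ((- 1) ^ (p * d)) a"
    for a b :: "'r hc" and c d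
    using p hc_homogeneous_parity[of d a]
    by (auto simp: hc_parity_add hc_parity_mult hc_parity_scale)
  have par_0: "(hc_parity ^^ p) 0 = (0 :: 'r hc)"
    using par(3)[of 0 0] by simp
  have par_xx: "(hc_parity ^^ p) (xx n lam * h) = xx n lam * (hc_parity ^^ p) h" for lam and h :: "'r hc"
    using par(4)[OF hc_homogeneous_xx, of n lam] by (simp add: par(2))
  have comp: "g * (hc_parity ^^ p) (xx n ?mu * h) = Tmat n A0 A1 * (hc_parity ^^ p) h" for h
    by (simp add: par_xx T mult.assoc)
  have T_in: "\<exists>h'. g * (hc_parity ^^ p) (xx n ?mu * h) = xx n ?l * h'" for h
    unfolding comp Tmat_def Let_def mult.assoc by blast
  have f: "?f \<in> super_endo n p"
    unfolding super_endo_def p_def[symmetric]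
  proof (intro CollectI conjI ballI allI impI)
    fix m :: "'r vfam" assume m: "m \<in> vspace n"
    then obtain h where h: "m ?mu = xx n ?mu * h"
      using co by (auto simp: vspace_def)
    then obtain h' where "g * (hc_parity ^^ p) (m ?mu) = xx n ?l * h'"
      using T_in by metis
    then show "(if m \<in> vspace n then vsingle ?l (g * (hc_parity ^^ p) (m ?mu)) else 0) \<in> vspace n"
      using m vspace_single[OF ro] by simp
  next
    fix m m' :: "'r vfam" assume "m \<in> vspace n" "m' \<in> vspace n"
    then show "(if m + m' \<in> vspace n then vsingle ?l (g * (hc_parity ^^ p) ((m + m') ?mu)) else 0) =
      (if m \<in> vspace n then vsingle ?l (g * (hc_parity ^^ p) (m ?mu)) else 0) +
      (if m' \<in> vspace n then vsingle ?l (g * (hc_parity ^^ p) (m' ?mu)) else 0)"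
      by (simp add: vspace_add par(1)) (simp add: vsingle_def fun_eq_iff distrib_left)
  next
    fix a and m :: "'r vfam" assume "m \<in> vspace n"
    then show "(if vscale a m \<in> vspace n then vsingle ?l (g * (hc_parity ^^ p) (vscale a m ?mu)) else 0) =
      vscale a (if m \<in> vspace n then vsingle ?l (g * (hc_parity ^^ p) (m ?mu)) else 0)"
      by (simp add: vspace_scale)
        (simp add: vscale_def vsingle_def fun_eq_iff par(3) hc_scale_mult_right)
  next
    fix a and m :: "'r vfam" assume a: "a \<in> {0, 1 :: nat}" and m: "m \<in> vpart n a"
    then have mv: "m \<in> vspace n" and hom: "hc_homogeneous a (m ?mu)"
      by (auto simp: vpart_def hc_part_def)
    then obtain h where h: "m ?mu = xx n ?mu * h"
      using co by (auto simp: vspace_def)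
    then obtain h' where h': "g * (hc_parity ^^ p) (m ?mu) = xx n ?l * h'"
      using T_in by metis
    have "hc_homogeneous ((p + a) mod 2) (g * (hc_parity ^^ p) (m ?mu))"
      unfolding par(4)[OF hom] using g hom by (intro hom_mult hc_homogeneous_scale) (simp add: p_def)
    then have "vsingle ?l (g * (hc_parity ^^ p) (m ?mu)) \<in> vpart n ((p + a) mod 2)"
      using vspace_single[OF ro, of h']
      by (auto simp: vpart_def hc_part_def h') (simp add: vsingle_def zero_homogeneous_mod)
    then show "(if m \<in> vspace n then vsingle ?l (g * (hc_parity ^^ p) (m ?mu)) else 0)
        \<in> vpart n ((p + a) mod 2)"
      using mv by simp
  next
    fix a and h :: "'r hc" and m :: "'r vfam" assume "a \<in> {0, 1 :: nat}" and m: "m \<in> vspace n" and "h \<in> hc_part a"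
    then have h: "hc_homogeneous a h" by (simp add: hc_part_def)
    show "(if vact m h \<in> vspace n then vsingle ?l (g * (hc_parity ^^ p) (vact m h ?mu)) else 0) =
      vscale ((- 1) ^ (p * a)) (vact (if m \<in> vspace n then vsingle ?l (g * (hc_parity ^^ p) (m ?mu)) else 0) h)"
      using m par(4)[OF h] by (simp add: vspace_act)
        (simp add: vact_def vscale_def vsingle_def fun_eq_iff par(2) hc_scale_mult_right mult.assoc)
  qed auto
  show "Phi n A0 A1 = ?f"
    unfolding Phi_def
  proof (rule the_equality)
    have val: "?f (vsingle mu (xx n mu * h)) = (if mu = ?mu
        then vscale ((- 1) ^ (mparity n A1 * a)) (vsingle ?l (Tmat n A0 A1 * h)) else 0)"
      if "mu \<in> Lam n CARD('r)" "a \<in> {0, 1}" "h \<in> hc_part a" for mu a h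
      using that comp[of h] par(4)[of a h] vspace_single[OF that(1), of h]
      by (auto simp: hc_part_def p_def[symmetric])
        (auto simp: vsingle_def vscale_def fun_eq_iff hc_scale_mult_right par_xx par_0)
    show 1: "?f \<in> qschur n \<and> (\<forall>mu\<in>Lam n CARD('r). \<forall>a\<in>{0,1}. \<forall>h\<in>hc_part a.
      ?f (vsingle mu (xx n mu * h)) = (if mu = ?mu
        then vscale ((- 1) ^ (mparity n A1 * a)) (vsingle ?l (Tmat n A0 A1 * h)) else 0))"
      using f super_endo_subset_qschur[OF p, of n] val by blast
    fix f' :: "'r endo" assume f': "f' \<in> qschur n \<and> (\<forall>mu\<in>Lam n CARD('r). \<forall>a\<in>{0,1}. \<forall>h\<in>hc_part a.
      f' (vsingle mu (xx n mu * h)) = (if mu = ?mu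
        then vscale ((- 1) ^ (mparity n A1 * a)) (vsingle ?l (Tmat n A0 A1 * h)) else 0))"
    show "f' = ?f"
    proof (rule qschur_ext)
      show "f' \<in> qschur n" using f' by blast
      show "?f \<in> qschur n" using 1 by blast
      show "f' (vsingle mu (xx n mu * h)) = ?f (vsingle mu (xx n mu * h))"
        if "mu \<in> Lam n CARD('r)" "a \<in> {0, 1}" "h \<in> hc_part a" for mu a h
        using f' that by (simp only: val)
    qed
  qed
  then show "(Phi n A0 A1 :: 'r endo) \<in> super_endo n (mparity n A1)"
    using f by (simp only: p_def)
qed

section \<open>Double cosets represented by the identity\<close>

text \<open>
  The matrices of the generators of the quantum queer superalgebra are diagonal up to at most one entry
  next to the diagonal. For such a matrix the blocks of the row and column sums meet in sets of the
  prescribed sizes before any permutation is applied, so \<open>d\<^sub>A\<close> is the identity.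
\<close>

definition identity_coset :: "nat \<Rightarrow> matr \<Rightarrow> bool"
  where "identity_coset n A \<longleftrightarrow>
    (\<forall>i\<in>{1..n}. \<forall>j\<in>{1..n}. card (block (ro n A) i \<inter> block (co n A) j) = A i j)"

lemma young_if_preserves_blocks:
  assumes r: "psum lam N = r" and w: "w permutes {1..r}"
    and *: "\<And>a k. k \<in> {1..N} \<Longrightarrow> a \<in> block lam k \<Longrightarrow> w a \<in> block lam k"
  shows "w \<in> young r N lam"
  unfolding young_iff[OF r]
proof (intro conjI ballI w)
  fix a assume a: "a \<in> {1..r}"
  obtain k where k: "k \<in> {1..N}" "a \<in> block lam k"
    using ex_block[OF r a] by blast
  then show "block_index N lam (w a) = block_index N lam a"
    using * block_index_eq by metis
qed

lemma young_preserves_blocks: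
  "w \<in> young r N lam \<Longrightarrow> k \<in> {1..N} \<Longrightarrow> a \<in> block lam k \<Longrightarrow> w a \<in> block lam k"
  unfolding young_def by blast

text \<open>
  Any \<open>d\<close> with the same intersection numbers as the identity lies in the double coset of the
  identity: a permutation \<open>x\<close> that maps each intersection of blocks onto its counterpart for \<open>d\<close>
  preserves the row blocks, and \<open>d\<^sup>-\<^sup>1 x\<close> preserves the column blocks.
\<close>

lemma dperm_identity_coset:
  assumes ro: "psum (ro n A) n = r" and co: "psum (co n A) n = r" and A: "identity_coset n A"
  shows "dperm r n A = id"
proof -
  let ?R = "block (ro n A)" and ?C = "block (co n A)"
  define Q where "Q d \<longleftrightarrow> d permutes {1..r} \<and>
    (\<forall>i\<in>{1..n}. \<forall>j\<in>{1..n}. card (?R i \<inter> d ` ?C j) = A i j) \<and>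
    (\<forall>x\<in>young r n (ro n A). \<forall>y\<in>young r n (co n A). perm_length r d \<le> perm_length r (x \<circ> d \<circ> y))" for d
  define d where "d = dperm r n A"
  have "Q id"
    using A unfolding Q_def identity_coset_def by (simp add: permutes_id)
  then have "Q d"
    unfolding d_def dperm_def Q_def[symmetric] by (rule someI[of Q])
  then have d: "d permutes {1..r}"
    and card: "\<And>i j. i \<in> {1..n} \<Longrightarrow> j \<in> {1..n} \<Longrightarrow> card (?R i \<inter> d ` ?C j) = A i j"
    and min: "\<And>x y. x \<in> young r n (ro n A) \<Longrightarrow> y \<in> young r n (co n A) \<Longrightarrow>
      perm_length r d \<le> perm_length r (x \<circ> d \<circ> y)"
    unfolding Q_def by blast+
  have "\<exists>f. bij_betw f (?R i \<inter> ?C j) (?R i \<inter> d ` ?C j)" if "i \<in> {1..n}" "j \<in> {1..n}" for i j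
    using card[OF that] A that unfolding identity_coset_def
    by (intro finite_same_card_bij) (auto simp: block_def)
  then obtain f where f: "\<And>i j. i \<in> {1..n} \<Longrightarrow> j \<in> {1..n} \<Longrightarrow>
      bij_betw (f i j) (?R i \<inter> ?C j) (?R i \<inter> d ` ?C j)"
    by metis
  define bi bj where "bi a = Suc (block_index n (ro n A) a)"
    and "bj a = Suc (block_index n (co n A) a)" for a
  have bi: "bi a = k" if "k \<in> {1..n}" "a \<in> ?R k" for a k
    using block_index_eq[OF that] that(1) by (simp add: bi_def)
  have bj: "bj a = k" if "k \<in> {1..n}" "a \<in> ?C k" for a k
    using block_index_eq[OF that] that(1) by (simp add: bj_def)
  have in_R: "bi a \<in> {1..n} \<and> a \<in> ?R (bi a)" if "a \<in> {1..r}" for a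
    using ex_block[OF ro that] bi by auto
  have in_C: "bj a \<in> {1..n} \<and> a \<in> ?C (bj a)" if "a \<in> {1..r}" for a
    using ex_block[OF co that] bj by auto
  define x where "x a = (if a \<in> {1..r} then f (bi a) (bj a) a else a)" for a
  have x: "x a \<in> ?R (bi a) \<and> x a \<in> d ` ?C (bj a)" if "a \<in> {1..r}" for a
    using bij_betw_apply[OF f[of "bi a" "bj a"], of a] in_R[OF that] in_C[OF that] that
    by (simp add: x_def)
  have "x permutes {1..r}"
  proof (rule bij_imp_permutes)
    have "inj_on x {1..r}"
    proof (rule inj_onI)
      fix a b assume ab: "a \<in> {1..r}" "b \<in> {1..r}" "x a = x b"
      have i: "bi a = bi b"
        using x[OF ab(1)] x[OF ab(2)] ab(3) block_disjoint by metis
      obtain a' b' where "x a = d a'" "a' \<in> ?C (bj a)" "x b = d b'" "b' \<in> ?C (bj b)"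
        using x[OF ab(1)] x[OF ab(2)] by auto
      then have j: "bj a = bj b"
        using ab(3) permutes_inj[OF d] block_disjoint by (metis injD)
      have "inj_on (f (bi a) (bj a)) (?R (bi a) \<inter> ?C (bj a))"
        using f in_R[OF ab(1)] in_C[OF ab(1)] bij_betw_imp_inj_on by blast
      then show "a = b"
        using ab in_R[OF ab(1)] in_C[OF ab(1)] in_R[OF ab(2)] in_C[OF ab(2)] i j
        by (auto simp: x_def dest: inj_onD)
    qed
    moreover have "x ` {1..r} \<subseteq> {1..r}"
      using x in_R block_subset[OF ro] by fastforce
    ultimately show "bij_betw x {1..r} {1..r}"
      by (simp add: bij_betw_def endo_inj_surj)
    show "x a = a" if "a \<notin> {1..r}" for a using that by (simp only: x_def if_False)
  qed
  then have xp: "x permutes {1..r}" .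
  have "x \<in> young r n (ro n A)"
  proof (rule young_if_preserves_blocks[OF ro xp])
    fix a k assume k: "k \<in> {1..n}" "a \<in> ?R k"
    then have "a \<in> {1..r}" using block_subset[OF ro, of k] by auto
    then show "x a \<in> ?R k" using x bi[OF k] by auto
  qed
  then have x_in: "inv x \<in> young r n (ro n A)" by (rule young_inv)
  have y_in: "inv d \<circ> x \<in> young r n (co n A)"
  proof (rule young_if_preserves_blocks[OF co])
    show "inv d \<circ> x permutes {1..r}"
      using xp permutes_inv[OF d] by (rule permutes_compose)
    fix a k assume k: "k \<in> {1..n}" "a \<in> ?C k"
    then have "a \<in> {1..r}" using block_subset[OF co, of k] by auto
    then obtain c where "x a = d c" "c \<in> ?C k" using x bj[OF k] by blast
    then show "(inv d \<circ> x) a \<in> ?C k" using permutes_inverses(2)[OF d] by simp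
  qed
  have "inv x \<circ> d \<circ> (inv d \<circ> x) = inv x \<circ> (d \<circ> inv d) \<circ> x"
    by (simp only: comp_assoc)
  also have "\<dots> = id"
    by (simp add: permutes_inv_o[OF d] permutes_inv_o[OF xp])
  finally have "perm_length r d \<le> 0"
    using min[OF x_in y_in] by (simp only: perm_length_id)
  then show ?thesis
    using perm_length_eq_0_iff[OF d] by (simp add: d_def)
qed

lemma colread_entry:
  assumes "m < n" and "i < n"
  shows "colread n A (Suc (m * n + i)) = A (Suc i) (Suc m)"
proof -
  have "m * n + i < Suc m * n" using assms by simp
  also have "\<dots> \<le> n * n" using assms by (intro mult_le_mono1) simp
  finally have "m * n + i < n * n" .
  then show ?thesis
    using assms by (simp add: colread_def Suc_le_eq)
qed

lemma psum_colread_column: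
  "m < n \<Longrightarrow> i \<le> n \<Longrightarrow>
    psum (colread n A) (m * n + i) = psum (colread n A) (m * n) + (\<Sum>i'=1..i. A i' (Suc m))"
  by (induction i) (simp_all add: psum_Suc colread_entry)

lemma psum_colread_multiple: "m \<le> n \<Longrightarrow> psum (colread n A) (m * n) = psum (co n A) m"
proof (induction m)
  case (Suc m)
  then show ?case
    using psum_colread_column[of m n n A] by (simp add: psum_Suc co_def add.commute)
qed simp

text \<open>
  The row blocks are consecutive intervals, so they cut a column block into consecutive intervals
  whose lengths are the entries of that column from top to bottom.
\<close>

lemma block_colread:
  assumes ro: "psum (ro n A) n = r" and co: "psum (co n A) n = r" and A: "identity_coset n A"
    and i: "i \<in> {1..n}" and j: "j \<in> {1..n}"
  shows "block (colread n A) ((j - 1) * n + i) = block (ro n A) i \<inter> block (co n A) j"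
proof -
  let ?a = "psum (co n A) (j - 1)" and ?b = "psum (co n A) j" and ?p = "psum (ro n A)"
  define S where "S i = (\<Sum>i'=1..i. A i' j)" for i
  have card: "card (block (co n A) j \<inter> {..?p i}) = S i" if "i \<le> n" for i
    using that
  proof (induction i)
    case 0
    have "block (co n A) j \<inter> {..?p 0} = {}" by (auto simp: block_def)
    then show ?case by (simp add: S_def)
  next
    case (Suc i)
    have "block (co n A) j \<inter> {..?p (Suc i)} =
        (block (co n A) j \<inter> {..?p i}) \<union> (block (ro n A) (Suc i) \<inter> block (co n A) j)"
      using psum_mono[of i "Suc i" "ro n A"] by (auto simp: block_def)
    moreover have "(block (co n A) j \<inter> {..?p i}) \<inter> (block (ro n A) (Suc i) \<inter> block (co n A) j) = {}"
      by (auto simp: block_def)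
    ultimately have "card (block (co n A) j \<inter> {..?p (Suc i)}) =
        card (block (co n A) j \<inter> {..?p i}) + card (block (ro n A) (Suc i) \<inter> block (co n A) j)"
      by (simp only:) (intro card_Un_disjoint; simp add: block_def)
    then show ?case
      using Suc A j unfolding identity_coset_def by (simp add: S_def)
  qed
  have initial: "block (co n A) j \<inter> {..?p i} = {?a + 1..?a + S i}" if "i \<le> n" for i
  proof -
    have eq: "block (co n A) j \<inter> {..?p i} = {?a + 1..min ?b (?p i)}"
      by (auto simp: block_def)
    then have "S i = min ?b (?p i) - ?a"
      using card[OF that] by simp
    then show ?thesis unfolding eq by auto
  qed
  have k: "psum (colread n A) ((j - 1) * n + i) = ?a + S i" if "i \<le> n" for i
  proof -
    have "j - 1 < n" "Suc (j - 1) = j" using j by auto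
    then show ?thesis
      using psum_colread_column[of "j - 1" n i A] psum_colread_multiple[of "j - 1" n A] that
      by (simp add: S_def)
  qed
  have i1: "i - 1 \<le> n" and "(j - 1) * n + i - 1 = (j - 1) * n + (i - 1)" using i by auto
  then have "block (colread n A) ((j - 1) * n + i) = {?a + S (i - 1) + 1..?a + S i}"
    using k[of i] k[OF i1] i by (simp add: block_def)
  also have "\<dots> = {?a + 1..?a + S i} - {?a + 1..?a + S (i - 1)}"
    by auto
  also have "\<dots> = (block (co n A) j \<inter> {..?p i}) - (block (co n A) j \<inter> {..?p (i - 1)})"
    using initial[of i] initial[OF i1] i by simp
  also have "\<dots> = block (ro n A) i \<inter> block (co n A) j"
    by (auto simp: block_def)
  finally show ?thesis .
qed

lemma young_colread:
  assumes ro: "psum (ro n A) n = r" and co: "psum (co n A) n = r" and A: "identity_coset n A"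
  shows "young r (n * n) (colread n A) = young r n (ro n A) \<inter> young r n (co n A)"
proof -
  have nu: "psum (colread n A) (n * n) = r"
    using psum_colread_multiple[of n n A] co by simp
  have index: "(j - 1) * n + i \<in> {1..n * n}" if "i \<in> {1..n}" "j \<in> {1..n}" for i j
  proof -
    have "(j - 1) * n + i \<le> (j - 1) * n + n" using that by simp
    also have "\<dots> = j * n" using that by (cases j) auto
    also have "\<dots> \<le> n * n" using that by simp
    finally show ?thesis using that by simp
  qed
  show ?thesis
  proof (intro equalityI subsetI IntI)
    fix w assume w: "w \<in> young r (n * n) (colread n A)"
    then have p: "w permutes {1..r}" by (rule young_permutes)
    have *: "w a \<in> block (ro n A) i \<inter> block (co n A) j"
      if "i \<in> {1..n}" "j \<in> {1..n}" "a \<in> block (ro n A) i \<inter> block (co n A) j" for a i j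
      using young_preserves_blocks[OF w index[OF that(1,2)], of a] that(3)
      unfolding block_colread[OF ro co A that(1,2)] by blast
    show "w \<in> young r n (ro n A)"
    proof (rule young_if_preserves_blocks[OF ro p])
      fix a i assume i: "i \<in> {1..n}" "a \<in> block (ro n A) i"
      then have "a \<in> {1..r}" using block_subset[OF ro, of i] by auto
      then obtain j where "j \<in> {1..n}" "a \<in> block (co n A) j" using ex_block[OF co] by blast
      then show "w a \<in> block (ro n A) i" using *[of i j a] i by blast
    qed
    show "w \<in> young r n (co n A)"
    proof (rule young_if_preserves_blocks[OF co p])
      fix a j assume j: "j \<in> {1..n}" "a \<in> block (co n A) j"
      then have "a \<in> {1..r}" using block_subset[OF co, of j] by auto
      then obtain i where "i \<in> {1..n}" "a \<in> block (ro n A) i" using ex_block[OF ro] by blast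
      then show "w a \<in> block (co n A) j" using *[of i j a] j by blast
    qed
  next
    fix w assume w: "w \<in> young r n (ro n A) \<inter> young r n (co n A)"
    then have p: "w permutes {1..r}" using young_permutes by blast
    show "w \<in> young r (n * n) (colread n A)"
    proof (rule young_if_preserves_blocks[OF nu p])
      fix a k assume k: "k \<in> {1..n * n}" "a \<in> block (colread n A) k"
      define i j where "i = (k - 1) mod n + 1" and "j = (k - 1) div n + 1"
      have n: "0 < n" using k by (cases n) auto
      have ij: "i \<in> {1..n}" "j \<in> {1..n}"
        using n k by (auto simp: i_def j_def Suc_le_eq less_mult_imp_div_less)
      have "k = (j - 1) * n + i"
        using k by (simp add: i_def j_def)
      then have B: "block (colread n A) k = block (ro n A) i \<inter> block (co n A) j"
        using block_colread[OF ro co A ij] by simp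
      then show "w a \<in> block (colread n A) k"
        using k(2) w young_preserves_blocks[OF _ ij(1)] young_preserves_blocks[OF _ ij(2)] by blast
    qed
  qed
qed

text \<open>
  \<open>x\<^sub>\<lambda> c\<^bsub>A\<^esub>\<close> is a \<open>T\<close>-eigenvector for the common refinement \<open>\<nu>\<close> of \<open>\<lambda>\<close> and \<open>\<mu>\<close>. So it equals
  \<open>x\<^sub>\<lambda> c\<^bsub>A\<^esub> x\<^sub>\<nu>\<close> up to a scalar, and the sum over coset representatives completes \<open>x\<^sub>\<nu>\<close> to
  \<open>x\<^sub>\<mu>\<close>.
\<close>

lemma Tmat_in_left_ideal:
  assumes ro: "psum (ro n (A0 + A1)) n = CARD('r::finite)"
    and co: "psum (co n (A0 + A1)) n = CARD('r)" and A: "identity_coset n (A0 + A1)"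
  shows "\<exists>g. hc_homogeneous (mparity n A1) g \<and>
    (Tmat n A0 A1 :: 'r hc) = g * xx n (co n (A0 + A1))"
proof -
  let ?nu = "colread n (A0 + A1)" and ?lam = "ro n (A0 + A1)" and ?mu = "co n (A0 + A1)"
  define y :: "'r hc" where "y = xx n ?lam * cpow (n * n) ?nu (colread n A1)"
  have nu: "psum ?nu (n * n) = CARD('r)"
    using psum_colread_multiple[of n n "A0 + A1"] co by simp
  note Y = young_colread[OF ro co A]
  have "T_eigen (n * n) ?nu (xx n ?lam :: 'r hc)"
    using T_eigen_xx[of n ?lam, where 'r = 'r] by (simp add: T_eigen_def Y)
  then have y: "T_eigen (n * n) ?nu y"
    unfolding y_def by (rule T_eigen_mult_cpow)
  define c where "c = 1 / poincare CARD('r) (n * n) ?nu"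
  have "hc_scale c (y * xx (n * n) ?nu) = y"
    using T_eigen_mult_xx[OF nu y] poincare_neq_0 by (simp add: c_def)
  moreover have "Tmat n A0 A1 = y *
      (\<Sum>w \<in> shortest_right_reps CARD('r) (n * n) ?nu \<inter> young CARD('r) n ?mu. Tperm w)"
    by (simp add: Tmat_def Let_def y_def dperm_identity_coset[OF ro co A])
  ultimately have "Tmat n A0 A1 = hc_scale c y * (xx (n * n) ?nu *
      (\<Sum>w \<in> shortest_right_reps CARD('r) (n * n) ?nu \<inter> young CARD('r) n ?mu. Tperm w))"
    by (simp add: hc_scale_mult_left mult.assoc[symmetric])
  also have "\<dots> = hc_scale c y * xx n ?mu"
    by (subst xx_factor[OF nu]) (simp_all add: Y)
  finally have T: "Tmat n A0 A1 = hc_scale c y * xx n ?mu" .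
  have "(\<Sum>k=1..n * n. colread n A1 k) = psum (co n A1) n"
    using psum_colread_multiple[of n n A1] by (simp add: psum_def)
  also have "\<dots> = (\<Sum>i=1..n. \<Sum>j=1..n. A1 i j)"
    unfolding psum_def co_def by (rule sum.swap)
  finally have "hc_homogeneous (mparity n A1) y"
    unfolding y_def mparity_def
    by (metis hc_homogeneous_cpow hc_homogeneous_even_mult(1) hc_homogeneous_xx)
  then show ?thesis using T hc_homogeneous_scale by blast
qed

lemma Lam_psum: "lam \<in> Lam n r \<Longrightarrow> psum lam n = r"
  by (simp add: Lam_def psum_def)

lemma Phi_in_super_endo:
  assumes "ro n (A0 + A1) \<in> Lam n CARD('r::finite)" and "co n (A0 + A1) \<in> Lam n CARD('r)"
    and "identity_coset n (A0 + A1)"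
  shows "(Phi n A0 A1 :: 'r endo) \<in> super_endo n (mparity n A1)"
  using Tmat_in_left_ideal[OF Lam_psum[OF assms(1)] Lam_psum[OF assms(2)] assms(3)]
    Phi_eqI(2)[OF assms(1,2)] by blast

section \<open>The generators of the quantum queer superalgebra\<close>

definition unit_comp :: "nat \<Rightarrow> comp"
  where "unit_comp a = (\<lambda>i. if i = a then 1 else 0)"

lemma psum_add: "psum (lam + mu) k = psum lam k + psum mu k"
  by (simp add: psum_def sum.distrib)

lemma psum_unit_comp: "psum (unit_comp a) k = (if 1 \<le> a \<and> a \<le> k then 1 else 0)"
  by (simp add: psum_def unit_comp_def)

lemma ro_add: "ro n (A + B) = ro n A + ro n B" and co_add: "co n (A + B) = co n A + co n B"
  by (simp_all add: ro_def co_def fun_eq_iff sum.distrib)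

lemma ro_diagm: "lam \<in> Lam n r \<Longrightarrow> ro n (diagm lam) = lam"
  and co_diagm: "lam \<in> Lam n r \<Longrightarrow> co n (diagm lam) = lam"
  by (auto simp: ro_def co_def diagm_def fun_eq_iff Lam_def)

lemma ro_munit: "b \<in> {1..n} \<Longrightarrow> ro n (munit a b) = unit_comp a"
  and co_munit: "a \<in> {1..n} \<Longrightarrow> co n (munit a b) = unit_comp b"
  by (auto simp: ro_def co_def munit_def unit_comp_def fun_eq_iff)

lemma Lam_add_unit_comp: "lam \<in> Lam n r \<Longrightarrow> a \<in> {1..n} \<Longrightarrow> lam + unit_comp a \<in> Lam n (Suc r)"
  by (auto simp: Lam_def unit_comp_def sum.distrib)

lemma identity_coset_diagm:
  assumes lam: "lam \<in> Lam n r"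
  shows "identity_coset n (diagm lam)"
  unfolding identity_coset_def ro_diagm[OF lam] co_diagm[OF lam]
proof (intro ballI)
  fix i j assume "i \<in> {1..n}" "j \<in> {1..n}"
  show "card (block lam i \<inter> block lam j) = diagm lam i j"
  proof (cases "i = j")
    case True
    then show ?thesis
      using psum_Suc[of lam "i - 1"] \<open>i \<in> {1..n}\<close> by (simp add: block_def diagm_def)
  next
    case False
    then have "block lam i \<inter> block lam j = {}"
      using block_disjoint by blast
    then show ?thesis using False by (simp add: diagm_def)
  qed
qed

text \<open>
  Adding the entry at \<open>(a, b)\<close> shifts the ends of the row blocks from \<open>a\<close> on and of the column
  blocks from \<open>b\<close> on by one; as \<open>a\<close> and \<open>b\<close> are neighbours, only the blocks \<open>a\<close> and \<open>b\<close> can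
  acquire a new common point.
\<close>

lemma identity_coset_diagm_munit:
  assumes lam: "lam \<in> Lam n r" and ab: "a \<in> {1..n}" "b \<in> {1..n}"
    and near: "a = b \<or> a = Suc b \<or> b = Suc a"
  shows "identity_coset n (diagm lam + munit a b)"
proof -
  let ?A = "diagm lam + munit a b"
  have ro: "psum (ro n ?A) k = psum lam k + (if a \<le> k then 1 else 0)" for k
    using ab by (simp add: ro_add ro_diagm[OF lam] ro_munit psum_add psum_unit_comp)
  have co: "psum (co n ?A) k = psum lam k + (if b \<le> k then 1 else 0)" for k
    using ab by (simp add: co_add co_diagm[OF lam] co_munit psum_add psum_unit_comp)
  have "card (block (ro n ?A) i \<inter> block (co n ?A) j) = ?A i j"
    if i: "i \<in> {1..n}" and j: "j \<in> {1..n}" for i j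
  proof -
    have "block (ro n ?A) i \<inter> block (co n ?A) j =
        {max (psum (ro n ?A) (i - 1)) (psum (co n ?A) (j - 1)) + 1..
          min (psum (ro n ?A) i) (psum (co n ?A) j)}"
      by (auto simp: block_def)
    then have card: "card (block (ro n ?A) i \<inter> block (co n ?A) j) =
        min (psum (ro n ?A) i) (psum (co n ?A) j) -
          max (psum (ro n ?A) (i - 1)) (psum (co n ?A) (j - 1))"
      by simp
    consider "i = j" | "i < j" | "j < i" by linarith
    then show ?thesis
    proof cases
      case 1
      have p: "psum lam i = psum lam (i - 1) + lam i"
        using psum_Suc[of lam "i - 1"] i by simp
      have "a \<le> i - 1 \<longleftrightarrow> a < i" "b \<le> i - 1 \<longleftrightarrow> b < i" using i by auto
      then show ?thesis
        unfolding card ro co using near p 1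
        by (cases a i rule: linorder_cases; cases b i rule: linorder_cases)
          (simp_all add: diagm_def munit_def)
    next
      case 2
      then have p: "psum lam i \<le> psum lam (j - 1)" "psum lam (i - 1) \<le> psum lam i"
        "psum lam (j - 1) \<le> psum lam j"
        by (auto intro: psum_mono)
      show ?thesis
      proof (cases "i = a \<and> j = b")
        case True
        then have "j - 1 = i" "\<not> a \<le> i - 1" "\<not> b \<le> j - 1" using near 2 i by auto
        then show ?thesis
          unfolding card ro co using True p 2 by (simp add: diagm_def munit_def)
      next
        case False
        have "a \<le> i \<Longrightarrow> b \<le> j - 1" using False near 2 by auto
        then have "psum (ro n ?A) i \<le> psum (co n ?A) (j - 1)"
          unfolding ro co using p(1) by simp
        then show ?thesis
          unfolding card using False 2 by (simp add: diagm_def munit_def)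
      qed
    next
      case 3
      then have p: "psum lam j \<le> psum lam (i - 1)" "psum lam (i - 1) \<le> psum lam i"
        "psum lam (j - 1) \<le> psum lam j"
        by (auto intro: psum_mono)
      show ?thesis
      proof (cases "i = a \<and> j = b")
        case True
        then have "i - 1 = j" "\<not> a \<le> i - 1" "\<not> b \<le> j - 1" using near 3 j by auto
        then show ?thesis
          unfolding card ro co using True p 3 by (simp add: diagm_def munit_def)
      next
        case False
        have "b \<le> j \<Longrightarrow> a \<le> i - 1" using False near 3 by auto
        then have "psum (co n ?A) j \<le> psum (ro n ?A) (i - 1)"
          unfolding ro co using p(1) by simp
        then show ?thesis
          unfolding card using False 3 by (simp add: diagm_def munit_def)
      qed
    qed
  qed
  then show ?thesis unfolding identity_coset_def by blast
qed

lemma std_in_qschur: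
  assumes "Phi n A0 A1 \<in> (super_endo n (mparity n A1) :: 'r::finite endo set)"
  shows "(std n A0 A1 :: 'r endo) \<in> qschur n"
  unfolding std_def
proof (rule endo.subspace_scale[OF qschur_subspace])
  have "mparity n A1 \<in> {0, 1}" by (auto simp: mparity_def)
  from super_endo_subset_qschur[OF this] show "(Phi n A0 A1 :: 'r endo) \<in> qschur n"
    using assms by blast
qed

lemma std_diagm_in_qschur:
  assumes lam: "lam \<in> Lam n CARD('r::finite)"
  shows "(std n (diagm lam) 0 :: 'r endo) \<in> qschur n"
  using lam identity_coset_diagm[OF lam]
  by (intro std_in_qschur Phi_in_super_endo) (simp_all add: ro_diagm co_diagm)

lemma std_diagm_munit_in_qschur:
  assumes lam: "lam \<in> Lam n (CARD('r::finite) - 1)" and ab: "a \<in> {1..n}" "b \<in> {1..n}"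
    and near: "a = b \<or> a = Suc b \<or> b = Suc a"
  shows "(std n (diagm lam + munit a b) 0 :: 'r endo) \<in> qschur n"
    and "(std n (diagm lam) (munit a b) :: 'r endo) \<in> qschur n"
proof -
  have "lam + unit_comp c \<in> Lam n CARD('r)" if "c \<in> {1..n}" for c
    using Lam_add_unit_comp[OF lam that] by simp
  then have "ro n (diagm lam + munit a b) \<in> Lam n CARD('r)" "co n (diagm lam + munit a b) \<in> Lam n CARD('r)"
    using ab by (simp_all add: ro_add co_add ro_diagm[OF lam] co_diagm[OF lam] ro_munit co_munit)
  note * = this identity_coset_diagm_munit[OF lam ab near]
  show "(std n (diagm lam + munit a b) 0 :: 'r endo) \<in> qschur n"
    using * by (intro std_in_qschur Phi_in_super_endo) simp_all
  show "(std n (diagm lam) (munit a b) :: 'r endo) \<in> qschur n"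
    using * by (intro std_in_qschur Phi_in_super_endo)
qed

lemma Uv_gens_subset_qschur: "Uv_gens n \<subseteq> (qschur n :: 'r::finite endo set)"
proof -
  note sub = endo.subspace_sum[OF qschur_subspace] endo.subspace_scale[OF qschur_subspace]
  have "K_gen n i \<in> (qschur n :: 'r endo set)" "Kinv_gen n i \<in> (qschur n :: 'r endo set)" for i
    unfolding K_gen_def Kinv_gen_def by (intro sub std_diagm_in_qschur; assumption)+
  moreover have "Kbar_gen n i \<in> (qschur n :: 'r endo set)" if "i \<in> {1..n}" for i
    unfolding Kbar_gen_def by (intro sub std_diagm_munit_in_qschur) (use that in auto)
  moreover have "E_gen n j \<in> (qschur n :: 'r endo set)" "Ebar_gen n j \<in> (qschur n :: 'r endo set)"
      "F_gen n j \<in> (qschur n :: 'r endo set)" "Fbar_gen n j \<in> (qschur n :: 'r endo set)"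
    if "j \<in> {1..n - 1}" for j
    unfolding E_gen_def Ebar_gen_def F_gen_def Fbar_gen_def
    by (intro sub std_diagm_munit_in_qschur; use that in auto)+
  ultimately show ?thesis unfolding Uv_gens_def by blast
qed

lemma fun_sum_apply: "(\<Sum>i\<in>I. f i) x = (\<Sum>i\<in>I. f i x)"
  by (induction I rule: infinite_finite_induct) auto

lemma Tmat_diagm:
  assumes lam: "lam \<in> Lam n CARD('r::finite)" and A: "A0 + A1 = diagm lam"
  shows "(Tmat n A0 A1 :: 'r hc) =
    xx n lam * cpow (n * n) (colread n (diagm lam)) (colread n A1)"
proof -
  note s = Lam_psum[OF lam]
  have "dperm CARD('r) n (diagm lam) = id"
    by (rule dperm_identity_coset) (simp_all add: ro_diagm[OF lam] co_diagm[OF lam] s identity_coset_diagm[OF lam])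
  moreover have "young CARD('r) (n * n) (colread n (diagm lam)) = young CARD('r) n lam"
    using young_colread[of n "diagm lam" "CARD('r)"]
    by (simp add: ro_diagm[OF lam] co_diagm[OF lam] s identity_coset_diagm[OF lam])
  then have "shortest_right_reps CARD('r) (n * n) (colread n (diagm lam)) \<inter> young CARD('r) n lam = {id}"
    using shortest_right_reps_inter_young by metis
  ultimately show ?thesis
    by (simp add: Tmat_def Let_def A ro_diagm[OF lam] co_diagm[OF lam])
qed

lemma pdeg_diagm: "pdeg n (diagm lam) 0 = 0"
  by (simp add: pdeg_def Let_def diagm_def)

lemma mparity_0 [simp]: "mparity n 0 = 0"
  by (simp add: mparity_def)

lemma cpow_0: "cpow N lam (colread n 0) = (1 :: 'r::finite hc)"
proof -
  have "prod_list (map (\<lambda>k. cq (psum lam (k - 1) + 1) (psum lam k) ^ colread n 0 k) ks) = (1 :: 'r hc)" for ks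
    by (induction ks) (simp_all add: colread_def)
  then show ?thesis by (simp only: cpow_def)
qed

lemma Phi_diagm:
  assumes lam: "lam \<in> Lam n CARD('r::finite)"
  shows "(Phi n (diagm lam) 0 :: 'r endo) = (\<lambda>m. if m \<in> vspace n then vsingle lam (m lam) else 0)"
  using Phi_eqI(1)[of n "diagm lam" 0 "1 :: 'r hc"] Tmat_diagm[of lam n "diagm lam" 0, where 'r = 'r] lam
  by (simp add: ro_diagm co_diagm cpow_0 hc_homogeneous_one cong: if_cong)

lemma K_gen_apply:
  assumes m: "m \<in> vspace n" and mu: "mu \<in> Lam n CARD('r::finite)"
  shows "(K_gen n i m :: 'r vfam) mu = hc_scale (vv ^ mu i) (m mu)"
proof -
  have "(K_gen n i m :: 'r vfam) mu =
      (\<Sum>lam\<in>Lam n CARD('r). hc_scale (vv ^ lam i) (vsingle lam (m lam) mu))"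
    unfolding K_gen_def fun_sum_apply
  proof (rule sum.cong[OF refl])
    fix lam assume "lam \<in> Lam n CARD('r)"
    then show "endo_scale (vv powi int (lam i)) (std n (diagm lam) 0) m mu =
        hc_scale (vv ^ lam i) (vsingle lam (m lam) mu)"
      using m by (simp add: std_def endo_scale_def vscale_def pdeg_diagm Phi_diagm)
  qed
  also have "\<dots> = (\<Sum>lam\<in>Lam n CARD('r). if lam = mu then hc_scale (vv ^ mu i) (m mu) else 0)"
    by (intro sum.cong) (auto simp: vsingle_def)
  finally show ?thesis
    using mu finite_Lam by simp
qed

section \<open>The highest weight space\<close>

lemma omega_Lam: "0 < n \<Longrightarrow> omega r \<in> Lam n r"
  by (auto simp: Lam_def omega_def)

lemma Lam_omegaI:
  assumes "lam \<in> Lam n r" and "\<And>i. i \<in> {1..n} \<Longrightarrow> lam i = omega r i" and "0 < n"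
  shows "lam = omega r"
proof
  fix i
  show "lam i = omega r i"
  proof (cases "i \<in> {1..n}")
    case False
    then have "lam i = 0" using assms(1) by (simp add: Lam_def)
    then show ?thesis using False assms(3) by (auto simp: omega_def)
  qed (rule assms(2))
qed

lemma young_omega:
  assumes "0 < n" and s: "1 \<le> s" "s < r"
  shows "adj s \<in> young r n (omega r)"
proof (rule young_if_preserves_blocks)
  have psum: "psum (omega r) k = (if k = 0 then 0 else r)" for k
    by (cases k) (simp_all add: psum_def omega_def)
  show "psum (omega r) n = r" using assms(1) psum by simp
  show "adj s permutes {1..r}" using s by (rule adj_permutes)
  fix a k assume "k \<in> {1..n}" "a \<in> block (omega r) k"
  then show "adj s a \<in> block (omega r) k"
    using s by (auto simp: block_def psum transpose_def split: if_splits)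
qed

text \<open>
  \<open>K\<^sub>i\<close> multiplies the component of index \<open>\<lambda>\<close> by \<open>v\<^bsup>\<lambda>\<^sub>i\<^esup>\<close>, and these scalars separate the
  compositions.
\<close>

lemma weight_space_omega_iff:
  fixes M :: "'r::finite endo set"
  assumes n: "0 < n" and M: "M \<subseteq> qschur n"
  shows "f \<in> weight_space n M (omega CARD('r)) \<longleftrightarrow>
    f \<in> M \<and> (\<forall>m lam. lam \<noteq> omega CARD('r) \<longrightarrow> f m lam = 0)"
proof safe
  let ?w = "omega CARD('r)"
  fix m lam assume f: "f \<in> weight_space n M ?w" and lam: "lam \<noteq> ?w"
  then have fq: "f \<in> qschur n" using M by (auto simp: weight_space_def)
  show "f m lam = 0"
  proof (cases "lam \<in> Lam n CARD('r)")
    case True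
    then obtain i where i: "i \<in> {1..n}" "lam i \<noteq> ?w i"
      using Lam_omegaI[OF True _ n] lam by blast
    have "(K_gen n i \<circ> f) m lam = endo_scale (vv ^ ?w i) f m lam"
      using f i(1) by (simp add: weight_space_def)
    then have "hc_scale (vv ^ lam i) (f m lam) = hc_scale (vv ^ ?w i) (f m lam)"
      using K_gen_apply[OF qschurD(2)[OF fq] True] by (simp add: endo_scale_def vscale_def)
    then show ?thesis
      using i(2) vv_power_inj by (auto simp: hc.scale_cancel_right)
  next
    case False
    then show ?thesis using qschurD(2)[OF fq, of m] by (simp add: vspace_def)
  qed
next
  let ?w = "omega CARD('r)"
  assume f: "f \<in> M" and supp: "\<forall>m lam. lam \<noteq> ?w \<longrightarrow> f m lam = 0"
  then have fq: "f \<in> qschur n" using M by blast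
  have "K_gen n i \<circ> f = endo_scale (vv ^ ?w i) f" if i: "i \<in> {1..n}" for i
  proof (intro ext)
    fix m lam
    have K: "(K_gen n i :: 'r endo) \<in> qschur n"
      using Uv_gens_subset_qschur[of n] i unfolding Uv_gens_def by blast
    show "(K_gen n i \<circ> f) m lam = endo_scale (vv ^ ?w i) f m lam"
    proof (cases "lam \<in> Lam n CARD('r)")
      case True
      then show ?thesis
        using supp K_gen_apply[OF qschurD(2)[OF fq] True, of i m]
        by (cases "lam = ?w") (simp_all add: endo_scale_def vscale_def)
    next
      case False
      then show ?thesis
        using qschurD(2)[OF fq, of m] qschurD(2)[OF K, of "f m"]
        by (simp add: vspace_def endo_scale_def vscale_def)
    qed
  qed
  then show "f \<in> weight_space n M ?w"
    using f by (simp add: weight_space_def)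
qed (simp add: weight_space_def)

lemma hc_parity_uminus: "hc_parity (- h) = - hc_parity (h :: 'r::finite hc)"
  using hc_parity_scale[of "- 1" h] by (simp only: hc_scale_uminus_one)

lemma hc_parity_parity: "hc_parity (hc_parity h) = (h :: 'r::finite hc)"
  by (induction h rule: hc_induct) (simp_all add: hc_parity_add hc_parity_mult hc_parity_uminus)

lemma hc_parity_cq: "hc_parity (cq i j :: 'r::finite hc) = - cq i j"
  using hc_homogeneous_parity[OF hc_homogeneous_cq] by (simp add: hc_scale_uminus_one)

lemma hc_parity_xx: "hc_parity (xx N lam :: 'r::finite hc) = xx N lam"
  using hc_homogeneous_parity[OF hc_homogeneous_xx] by simp

lemma clifford_sum_square:
  assumes "finite A" and "A \<subseteq> {1..CARD('r::finite)}"
  shows "(\<Sum>t\<in>A. hc_scale (a t) (hc_c t)) * (\<Sum>t\<in>A. hc_scale (a t) (hc_c t)) =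
    hc_scale (- (\<Sum>t\<in>A. a t ^ 2)) (1 :: 'r hc)"
  using assms
proof (induction rule: finite_induct)
  case (insert u A)
  define s where "s = (\<Sum>t\<in>A. hc_scale (a t) (hc_c t) :: 'r hc)"
  have "hc_c u * s = - (s * hc_c u)"
    unfolding s_def sum_distrib_left sum_distrib_right sum_negf[symmetric]
  proof (intro sum.cong refl)
    fix t assume "t \<in> A"
    then have ut: "u \<noteq> t" using insert by blast
    show "hc_c u * hc_scale (a t) (hc_c t) = - (hc_scale (a t) (hc_c t) * hc_c u :: 'r hc)"
      by (simp add: hc_scale_mult_left hc_scale_mult_right hc_c_anticommute[OF ut])
  qed
  moreover have "hc_c u * hc_c u = (- 1 :: 'r hc)"
    using insert by (intro hc_c_square) auto
  ultimately have "(hc_scale (a u) (hc_c u) + s) * (hc_scale (a u) (hc_c u) + s) =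
      hc_scale (- (a u ^ 2)) 1 + s * s"
    by (simp add: distrib_left distrib_right hc_scale_mult_left hc_scale_mult_right
        hc.scale_right_diff_distrib power2_eq_square)
  then show ?case
    using insert by (simp add: s_def hc.scale_left_diff_distrib)
qed simp

lemma cq_square:
  "cq 1 CARD('r::finite) * cq 1 CARD('r) = hc_scale (- (\<Sum>k<CARD('r). vv ^ (4 * k))) (1 :: 'r hc)"
proof -
  have "(\<Sum>t=1..CARD('r). (qq ^ (CARD('r) - t)) ^ 2) = (\<Sum>k<CARD('r). vv ^ (4 * k))"
    by (rule sum.reindex_bij_witness[of _ "\<lambda>k. CARD('r) - k" "\<lambda>t. CARD('r) - t"])
      (auto simp: qq_def mult.commute simp flip: power_mult)
  then show ?thesis
    unfolding cq_def by (subst clifford_sum_square) auto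
qed

lemma cpow_first_block_only:
  assumes "0 < N" and "alpha 1 = 1" and "\<And>k. k \<noteq> 1 \<Longrightarrow> alpha k = 0"
  shows "cpow N lam alpha = (cq 1 (lam 1) :: 'r::finite hc)"
proof -
  let ?c = "\<lambda>k. cq (psum lam (k - 1) + 1) (psum lam k) ^ alpha k :: 'r hc"
  have "prod_list (map ?c ks) = 1" if "1 \<notin> set ks" for ks
    using that assms(3) by (induction ks) auto
  moreover have "[1..<N + 1] = 1 # [2..<N + 1]"
    using assms(1) by (simp add: upt_conv_Cons numeral_2_eq_2 del: upt_Suc)
  ultimately have "prod_list (map ?c [1..<N + 1]) = ?c 1"
    by (simp del: upt_Suc)
  then show ?thesis
    using assms(2) by (simp add: cpow_def psum_def)
qed

lemma eq_vsingle: "(\<And>lam. lam \<noteq> mu \<Longrightarrow> m lam = 0) \<Longrightarrow> m = vsingle mu (m mu)"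
  by (rule ext) (simp add: vsingle_def)

lemma vsingle_simps:
  "vsingle mu g mu = g" "lam \<noteq> mu \<Longrightarrow> vsingle mu g lam = 0"
  "vscale a (vsingle mu g) = vsingle mu (hc_scale a g)" "vact (vsingle mu g) h = vsingle mu (g * h)"
  "vsingle mu (g + h) = vsingle mu g + vsingle mu h" "vsingle mu 0 = 0" "vscale a 0 = 0"
  by (rule ext | simp add: vsingle_def vscale_def vact_def)+

lemma vspace_component:
  "m \<in> vspace n \<Longrightarrow> mu \<in> Lam n CARD('r) \<Longrightarrow> \<exists>h. m mu = xx n mu * (h :: 'r::finite hc)"
  by (auto simp: vspace_def)

lemma vspace_single_component:
  assumes "m \<in> vspace n" and "mu \<in> Lam n CARD('r)" and "\<And>lam. lam \<noteq> mu \<Longrightarrow> m lam = 0"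
  shows "\<exists>h. m = vsingle mu (xx n mu * (h :: 'r::finite hc))"
  using vspace_component[OF assms(1,2)] eq_vsingle[of mu m, OF assms(3)] by metis

lemma mparity_munit: "a \<in> {1..n} \<Longrightarrow> b \<in> {1..n} \<Longrightarrow> mparity n (munit a b) = 1"
  using fun_cong[OF ro_munit[of b n a]] psum_unit_comp[of a n]
  by (simp add: mparity_def ro_def psum_def)

text \<open>
  Among the summands of the odd generator only the one of \<open>\<lambda> = (r - 1, 0, \<dots>, 0)\<close> starts at
  \<open>\<omega>\<close>; its matrix has \<open>T\<^bsub>A\<^esub> = x\<^sub>\<omega> c\<^sub>q\<close>. The scalar \<open>c\<close> is the normalising power of \<open>v\<close>.
\<close>

lemma Kbar_gen_omega:
  assumes n: "0 < n"
  shows "\<exists>c. c \<noteq> 0 \<and> (\<forall>h. (Kbar_gen n 1 :: 'r::finite endo)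
      (vsingle (omega CARD('r)) (xx n (omega CARD('r)) * h)) =
    vsingle (omega CARD('r)) (hc_scale c (xx n (omega CARD('r)) * cq 1 CARD('r) * hc_parity h)))"
proof -
  let ?w = "omega CARD('r)" and ?lam0 = "omega (CARD('r) - 1)"
  define c where "c = vv powi (- int (pdeg n (diagm ?lam0) (munit 1 1)))"
  have c: "c \<noteq> 0" by (simp add: c_def)
  have one: "1 \<in> {1..n}" using n by simp
  have w: "?w \<in> Lam n CARD('r)" and lam0: "?lam0 \<in> Lam n (CARD('r) - 1)"
    using omega_Lam[OF n] by blast+
  have w_eq: "?lam0 + unit_comp 1 = ?w"
    by (auto simp: omega_def unit_comp_def fun_eq_iff)
  have diag: "diagm ?lam0 + munit 1 1 = diagm ?w"
    by (auto simp: omega_def diagm_def munit_def fun_eq_iff)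
  have col: "colread n (munit 1 1) 1 = 1" "colread n (diagm ?w) 1 = CARD('r)"
    using n by (simp_all add: colread_def munit_def diagm_def omega_def)
  have "colread n (munit 1 1) k = 0" if "k \<noteq> 1" for k
  proof (cases "k \<in> {1..n * n} \<and> (k - 1) mod n = 0 \<and> (k - 1) div n = 0")
    case True
    then have "k - 1 = 0" using div_mult_mod_eq[of "k - 1" n] by (simp only: mult_0 add_0)
    then show ?thesis using True that by simp
  next
    case False
    then show ?thesis by (simp only: colread_def munit_def) auto
  qed
  note col = col this
  have "cpow (n * n) (colread n (diagm ?w)) (colread n (munit 1 1)) = (cq 1 CARD('r) :: 'r hc)"
    using cpow_first_block_only[of "n * n" "colread n (munit 1 1)" "colread n (diagm ?w)"] n col by simp
  then have T0: "Tmat n (diagm ?lam0) (munit 1 1) = (xx n ?w * cq 1 CARD('r) :: 'r hc)"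
    using Tmat_diagm[OF w diag] by simp
  have summand: "std n (diagm lam) (munit 1 1) (vsingle ?w (xx n ?w * h)) =
      (if lam = ?lam0 then vsingle ?w (hc_scale c (xx n ?w * cq 1 CARD('r) * hc_parity h)) else 0)"
    if lam: "lam \<in> Lam n (CARD('r) - 1)" for lam and h :: "'r hc"
  proof -
    let ?A = "diagm lam + munit 1 1"
    have ro: "ro n ?A = lam + unit_comp 1" and co: "co n ?A = lam + unit_comp 1"
      using one by (simp_all add: ro_add co_add ro_diagm[OF lam] co_diagm[OF lam] ro_munit co_munit)
    have L: "lam + unit_comp 1 \<in> Lam n CARD('r)"
      using Lam_add_unit_comp[OF lam one] by simp
    have "identity_coset n ?A"
      by (rule identity_coset_diagm_munit[OF lam one one]) simp
    then obtain g where g: "hc_homogeneous (mparity n (munit 1 1)) g"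
      "(Tmat n (diagm lam) (munit 1 1) :: 'r hc) = g * xx n (lam + unit_comp 1)"
      using Tmat_in_left_ideal[of n "diagm lam" "munit 1 1", where 'r = 'r] Lam_psum[OF L]
      unfolding ro co by blast
    have Phi: "Phi n (diagm lam) (munit 1 1) (vsingle ?w (xx n ?w * h)) =
        vsingle (lam + unit_comp 1) (g * hc_parity (vsingle ?w (xx n ?w * h) (lam + unit_comp 1)))"
      using vspace_single[OF w, of h]
      unfolding Phi_eqI(1)[of n "diagm lam" "munit 1 1" g,
          unfolded ro co mparity_munit[OF one one], OF L L g(2) g(1)[unfolded mparity_munit[OF one one]]]
      by simp
    show ?thesis
    proof (cases "lam = ?lam0")
      case True
      have gX: "g * xx n ?w = xx n ?w * cq 1 CARD('r)"
        using g(2) T0 unfolding True w_eq by (simp only:)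
      have "g * hc_parity (xx n ?w * h) = xx n ?w * cq 1 CARD('r) * hc_parity h"
        by (simp only: hc_parity_mult hc_parity_xx gX flip: mult.assoc)
      then show ?thesis
        using Phi unfolding True w_eq
        by (simp add: std_def endo_scale_def c_def vsingle_simps)
    next
      case False
      then have "lam + unit_comp 1 \<noteq> ?w"
        using w_eq by (metis add_right_cancel)
      then have "vsingle ?w (xx n ?w * h) (lam + unit_comp 1) = 0"
        by (simp add: vsingle_def)
      moreover have "hc_parity (0 :: 'r hc) = 0"
        using hc_parity_scale[of 0 0] by simp
      ultimately show ?thesis
        using Phi False by (simp add: std_def endo_scale_def vsingle_simps)
    qed
  qed
  have "(Kbar_gen n 1 :: 'r endo) (vsingle ?w (xx n ?w * h)) =
      vsingle ?w (hc_scale c (xx n ?w * cq 1 CARD('r) * hc_parity h))" for h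
  proof -
    let ?V = "vsingle ?w (hc_scale c (xx n ?w * cq 1 CARD('r) * hc_parity h))"
    have "(Kbar_gen n 1 :: 'r endo) (vsingle ?w (xx n ?w * h)) =
        (\<Sum>lam\<in>Lam n (CARD('r) - 1). std n (diagm lam) (munit 1 1) (vsingle ?w (xx n ?w * h)))"
      unfolding Kbar_gen_def by (rule fun_sum_apply)
    also have "\<dots> = (\<Sum>lam\<in>Lam n (CARD('r) - 1). if lam = ?lam0 then ?V else 0)"
      by (rule sum.cong[OF refl summand])
    also have "\<dots> = ?V"
      by (subst sum.delta[OF finite_Lam]) (simp only: lam0 if_True)
    finally show ?thesis .
  qed
  then show ?thesis using c by blast
qed

text \<open>
  A homogeneous endomorphism into the component of \<open>\<omega>\<close> is determined on that component by the image
  of \<open>x\<^sub>\<omega>\<close>, a \<open>T\<close>-eigenvector in \<open>x\<^sub>\<omega> H\<close>. The eigenvectors are spanned by \<open>x\<^sub>\<omega>\<close>, which is even,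
  and \<open>x\<^sub>\<omega> c\<^sub>q\<close>, which is odd.
\<close>

lemma super_endo_on_omega:
  fixes f :: "'r::finite endo"
  defines "w \<equiv> omega CARD('r)"
  assumes n: "0 < n" and f: "f \<in> super_endo n p" and p: "p \<in> {0, 1}"
    and supp: "\<And>m lam. lam \<noteq> w \<Longrightarrow> f m lam = 0"
  shows "\<exists>a. \<forall>h. f (vsingle w (xx n w * h)) =
    vsingle w (hc_scale a (xx n w * cq 1 CARD('r) ^ p * (hc_parity ^^ p) h))"
proof -
  define X :: "'r hc" where "X = xx n w"
  have w: "w \<in> Lam n CARD('r)" unfolding w_def by (rule omega_Lam[OF n])
  let ?y = "vsingle w X"
  define z where "z = f ?y w"
  have y: "?y \<in> vspace n" using vspace_single[OF w, of 1] by (simp add: X_def)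
  have fy: "f ?y = vsingle w z"
    unfolding z_def using supp by (rule eq_vsingle)
  obtain h0 where h0: "z = X * h0"
    unfolding z_def X_def using vspace_component[OF super_endoD(2)[OF f] w] by blast
  have "?y \<in> vpart n 0"
    using y hc_homogeneous_xx[of n w, where 'r = 'r] zero_homogeneous[of 0, where 'r = 'r]
    by (auto simp: vpart_def hc_part_def vsingle_def X_def)
  then have "f ?y \<in> vpart n ((p + 0) mod 2)"
    by (intro super_endoD(5)[OF f]) auto
  then have "hc_homogeneous (p mod 2) z"
    by (simp add: vpart_def hc_part_def z_def)
  then have par_z: "hc_parity z = hc_scale ((- 1) ^ p) z"
    using hc_homogeneous_parity p by fastforce
  have "z * hc_T s = hc_scale qq z" if s: "1 \<le> s" "s < CARD('r)" for s
  proof -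
    have "X * hc_T s = hc_scale qq X"
      unfolding X_def w_def using s young_omega[OF n s] by (rule xx_T_right)
    then have "vact ?y (hc_T s) = vscale qq ?y"
      by (simp add: vsingle_simps)
    moreover have "f (vact ?y (hc_T s)) = vact (f ?y) (hc_T s)"
      using super_endoD(6)[OF f, of 0 ?y "hc_T s"] y by (simp add: hc_part_def hom_T)
    ultimately have "vact (f ?y) (hc_T s) w = vscale qq (f ?y) w"
      using super_endoD(4)[OF f y] by metis
    then show ?thesis by (simp add: vact_def vscale_def z_def)
  qed
  then have "T_eigen n w (X * h0)" unfolding T_eigen_def h0 by blast
  then have "X * h0 \<in> hc.span {X, X * cq 1 CARD('r)}"
    unfolding X_def w_def by (intro T_eigen_in_full_ideal Lam_psum omega_Lam n young_omega)
  then obtain a b where ab: "z = hc_scale a X + hc_scale b (X * cq 1 CARD('r))"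
    unfolding h0 hc.span_breakdown_eq hc.span_singleton by (auto simp: algebra_simps)
  have "hc_scale a X - hc_scale b (X * cq 1 CARD('r)) = hc_scale ((- 1) ^ p) z"
    using par_z by (simp add: ab hc_parity_add hc_parity_scale hc_parity_mult hc_parity_cq X_def
        hc_parity_xx)
  moreover have "u = 0" if "u + u = 0" for u :: "'r hc"
  proof -
    have "hc_scale (1 / 2) (u + u) = u"
      by (simp add: hc.scale_right_distrib flip: hc.scale_left_distrib)
    then show ?thesis using that by simp
  qed
  ultimately have "\<exists>d. z = hc_scale d (X * cq 1 CARD('r) ^ p)"
    using p
  proof (elim insertE)
    assume dbl: "\<And>u. u + u = 0 \<Longrightarrow> u = (0 :: 'r hc)"
      and eq: "hc_scale a X - hc_scale b (X * cq 1 CARD('r)) = hc_scale ((- 1) ^ p) z"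
    show ?thesis if "p = 0"
    proof -
      have "hc_scale b (X * cq 1 CARD('r)) + hc_scale b (X * cq 1 CARD('r)) = 0"
        using eq that by (simp add: ab algebra_simps)
      from dbl[OF this] show ?thesis using that ab by auto
    qed
    show ?thesis if "p = 1"
    proof -
      have "hc_scale a X + hc_scale a X = 0"
        using eq that by (simp add: ab eq_neg_iff_add_eq_0)
      from dbl[OF this] show ?thesis using that ab by auto
    qed
  qed auto
  then obtain d where d: "z = hc_scale d (X * cq 1 CARD('r) ^ p)" by blast
  have hom: "f (vsingle w (X * h)) = vsingle w (z * (hc_parity ^^ p) h)"
    if a: "a \<in> {0, 1}" and h: "hc_homogeneous a h" for a h
  proof -
    have "vsingle w (X * h) = vact ?y h"
      by (simp add: vsingle_simps)
    moreover have "f (vact ?y h) = vscale ((- 1) ^ (p * a)) (vact (f ?y) h)"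
      using super_endoD(6)[OF f a y] h by (simp add: hc_part_def)
    moreover have "(hc_parity ^^ p) h = hc_scale ((- 1) ^ (p * a)) h"
      using p hc_homogeneous_parity[OF h] by auto
    ultimately show ?thesis
      by (simp add: fy vsingle_simps hc_scale_mult_right)
  qed
  have "f (vsingle w (X * h)) = vsingle w (hc_scale d (X * cq 1 CARD('r) ^ p * (hc_parity ^^ p) h))" for h
  proof -
    obtain h0 h1 where h: "hc_homogeneous 0 h0" "hc_homogeneous 1 h1" "h = h0 + h1"
      using ex_homogeneous_parts by blast
    have "vsingle w (X * h) = vsingle w (X * h0) + vsingle w (X * h1)"
      by (simp add: h(3) vsingle_simps distrib_left)
    then have "f (vsingle w (X * h)) = f (vsingle w (X * h0)) + f (vsingle w (X * h1))"
      unfolding X_def by (simp add: super_endoD(3)[OF f vspace_single[OF w] vspace_single[OF w]])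
    also have "\<dots> = vsingle w (z * (hc_parity ^^ p) h)"
      using p hom[of 0 h0] hom[of 1 h1] h
      by (auto simp: vsingle_simps distrib_left hc_parity_add)
    finally show ?thesis
      by (simp add: d hc_scale_mult_left)
  qed
  then show ?thesis unfolding X_def by blast
qed

text \<open>
  \<open>M \<inter> Q m\<close> is a submodule; it contains \<open>m\<close> because the projection onto the component of \<open>\<omega>\<close>
  belongs to \<open>Q\<close> and fixes \<open>m\<close>.
\<close>

lemma irreducible_subset_orbit:
  fixes M :: "'r::finite endo set"
  assumes n: "0 < n" and irr: "irreducible_Uv_submodule n M"
    and m: "m \<in> weight_space n M (omega CARD('r))" "m \<noteq> 0"
  shows "M \<subseteq> {g \<circ> m | g. g \<in> qschur n}"
proof -
  let ?N = "{g \<circ> m | g. g \<in> qschur n}"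
  have M: "Uv_submodule n M"
    and min: "\<And>N. Uv_submodule n N \<Longrightarrow> N \<subseteq> M \<Longrightarrow> N = {0} \<or> N = M"
    using irr unfolding irreducible_Uv_submodule_def by blast+
  then have Mq: "M \<subseteq> qschur n" and Ms: "endo.subspace M"
    and Mu: "\<And>u f. u \<in> Uv_gens n \<Longrightarrow> f \<in> M \<Longrightarrow> u \<circ> f \<in> M"
    unfolding Uv_submodule_def by blast+
  have mM: "m \<in> M" using m by (simp add: weight_space_def)
  then have mq: "m \<in> qschur n" using Mq by blast
  have supp: "lam \<noteq> omega CARD('r) \<Longrightarrow> m x lam = 0" for x lam
    using m(1) weight_space_omega_iff[OF n Mq] by blast
  have w: "omega CARD('r) \<in> Lam n CARD('r)" by (rule omega_Lam[OF n])
  define e :: "'r endo" where "e = Phi n (diagm (omega CARD('r))) 0"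
  have "e \<in> super_endo n 0"
    unfolding e_def using Phi_in_super_endo[of n "diagm (omega CARD('r))" 0, where 'r = 'r] w
      identity_coset_diagm[OF w] by (simp add: ro_diagm co_diagm)
  then have e: "e \<in> qschur n"
    using super_endo_subset_qschur[of 0 n] by blast
  have "e \<circ> m = m"
  proof
    fix x
    show "(e \<circ> m) x = m x"
      using eq_vsingle[of _ "m x", OF supp] qschurD(2)[OF mq, of x] by (simp add: e_def Phi_diagm[OF w])
  qed
  then have mN: "m \<in> ?N" using e by (metis (mono_tags, lifting) mem_Collect_eq)
  have "Uv_submodule n (M \<inter> ?N)"
    unfolding Uv_submodule_def
  proof (intro conjI ballI)
    show "M \<inter> ?N \<subseteq> qschur n" using Mq by blast
    have "endo.subspace ?N"
      unfolding endo.subspace_def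
    proof (intro conjI ballI allI)
      have "0 = 0 \<circ> m" by (simp add: fun_eq_iff)
      then show "0 \<in> ?N" using endo.subspace_0[OF qschur_subspace] by blast
    next
      fix f g assume "f \<in> ?N" "g \<in> ?N"
      then obtain f' g' where "f = f' \<circ> m" "g = g' \<circ> m" "f' \<in> qschur n" "g' \<in> qschur n" by blast
      moreover have "(f' \<circ> m) + (g' \<circ> m) = (f' + g') \<circ> m" for f' g' :: "'r endo"
        by (rule ext) simp
      ultimately show "f + g \<in> ?N"
        using endo.subspace_add[OF qschur_subspace] by blast
    next
      fix c f assume "f \<in> ?N"
      then obtain f' where "f = f' \<circ> m" "f' \<in> qschur n" by blast
      moreover have "endo_scale c (f' \<circ> m) = endo_scale c f' \<circ> m" for f' :: "'r endo"
        by (rule ext) (simp add: endo_scale_def)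
      ultimately show "endo_scale c f \<in> ?N"
        using endo.subspace_scale[OF qschur_subspace] by blast
    qed
    then show "endo.subspace (M \<inter> ?N)" using Ms by (intro endo.subspace_inter)
    fix u f :: "'r endo" assume u: "u \<in> Uv_gens n" and "f \<in> M \<inter> ?N"
    then obtain g where f: "f \<in> M" "f = g \<circ> m" "g \<in> qschur n" by blast
    have "u \<circ> g \<in> qschur n"
      using u Uv_gens_subset_qschur f(3) by (intro qschur_comp) auto
    then have "u \<circ> f \<in> ?N"
      using f(2) by (metis (mono_tags, lifting) comp_assoc mem_Collect_eq)
    then show "u \<circ> f \<in> M \<inter> ?N" using Mu[OF u f(1)] by blast
  qed
  then have "M \<inter> ?N = {0} \<or> M \<inter> ?N = M" by (intro min) auto
  then show ?thesis using mM mN m(2) by blast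
qed

text \<open>
  If \<open>f = g m\<close>, both homogeneous parts of \<open>g\<close>, followed by the projection, act on \<open>x\<^sub>\<omega> H\<close> by
  multiples of the identity and of the odd generator.
\<close>

lemma weight_space_omega_subset_span:
  fixes M :: "'r::finite endo set"
  assumes n: "0 < n" and irr: "irreducible_Uv_submodule n M"
    and m: "m \<in> weight_space n M (omega CARD('r))" "m \<noteq> 0"
  shows "weight_space n M (omega CARD('r)) \<subseteq> endo.span {m, Kbar_gen n 1 \<circ> m}"
proof
  let ?w = "omega CARD('r)"
  let ?X = "xx n ?w :: 'r hc" and ?K = "Kbar_gen n 1 :: 'r endo"
  fix f assume fw: "f \<in> weight_space n M ?w"
  have Mq: "M \<subseteq> qschur n"
    using irr unfolding irreducible_Uv_submodule_def Uv_submodule_def by blast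
  note supp = weight_space_omega_iff[OF n Mq]
  have w: "?w \<in> Lam n CARD('r)" by (rule omega_Lam[OF n])
  obtain g where g: "f = g \<circ> m" "g \<in> qschur n"
    using irreducible_subset_orbit[OF n irr m] fw by (auto simp: weight_space_def)
  obtain g0 g1 where g01: "g0 \<in> super_endo n 0" "g1 \<in> super_endo n 1" "g = g0 + g1"
    using g(2) qschur_iff by blast
  define e :: "'r endo" where "e = Phi n (diagm ?w) 0"
  have e: "e \<in> super_endo n 0"
    unfolding e_def using Phi_in_super_endo[of n "diagm ?w" 0, where 'r = 'r] w
      identity_coset_diagm[OF w] by (simp add: ro_diagm co_diagm)
  have e_supp: "e x lam = 0" if "lam \<noteq> ?w" for x lam
    using that by (simp add: e_def Phi_diagm[OF w] vsingle_def)
  have e0: "e \<circ> g0 \<in> super_endo n 0" and e1: "e \<circ> g1 \<in> super_endo n 1"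
    using super_endo_comp[OF e g01(1)] super_endo_comp[OF e g01(2)] by auto
  obtain a where a: "\<And>h. (e \<circ> g0) (vsingle ?w (?X * h)) = vsingle ?w (hc_scale a (?X * h))"
    using super_endo_on_omega[OF n e0] e_supp by auto
  obtain b where b: "\<And>h. (e \<circ> g1) (vsingle ?w (?X * h)) =
      vsingle ?w (hc_scale b (?X * cq 1 CARD('r) * hc_parity h))"
    using super_endo_on_omega[OF n e1] e_supp by auto
  obtain c where c: "c \<noteq> 0" "\<And>h. ?K (vsingle ?w (?X * h)) =
      vsingle ?w (hc_scale c (?X * cq 1 CARD('r) * hc_parity h))"
    using Kbar_gen_omega[OF n, where 'r = 'r] by blast
  have "f = endo_scale a m + endo_scale (b / c) (?K \<circ> m)"
  proof
    fix x
    have "m x \<in> vspace n" "\<And>lam. lam \<noteq> ?w \<Longrightarrow> m x lam = 0"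
      using m(1) supp Mq qschurD(2)[of m n x] by blast+
    then obtain h where h: "m x = vsingle ?w (?X * h)"
      using vspace_single_component[OF _ w] by blast
    have "f x \<in> vspace n" "\<And>lam. lam \<noteq> ?w \<Longrightarrow> f x lam = 0"
      using fw supp Mq qschurD(2)[of f n x] by blast+
    then have "f x = e (f x)"
      using eq_vsingle[of ?w "f x"] by (simp add: e_def Phi_diagm[OF w])
    also have "\<dots> = (e \<circ> g0) (m x) + (e \<circ> g1) (m x)"
      by (simp add: g(1) g01(3) super_endoD(3)[OF e] super_endoD(2)[OF g01(1)] super_endoD(2)[OF g01(2)])
    also have "\<dots> = vsingle ?w (hc_scale a (?X * h)) +
        vsingle ?w (hc_scale b (?X * cq 1 CARD('r) * hc_parity h))"
      unfolding h a b ..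
    also have "\<dots> = (endo_scale a m + endo_scale (b / c) (?K \<circ> m)) x"
      using c by (simp add: endo_scale_def h vsingle_simps)
    finally show "f x = (endo_scale a m + endo_scale (b / c) (?K \<circ> m)) x" .
  qed
  also have "\<dots> \<in> endo.span {m, ?K \<circ> m}"
    by (intro endo.span_add endo.span_scale endo.span_base) auto
  finally show "f \<in> endo.span {m, ?K \<circ> m}" .
qed

text \<open>Since \<open>c\<^sub>q\<close> is odd, the sign of \<open>c\<^sub>q\<^sup>2\<close> cancels in the square of the odd Cartan generator.\<close>

lemma Kbar_gen_square_omega:
  assumes n: "0 < n"
  shows "\<exists>c. c \<noteq> 0 \<and> (\<forall>m. m \<in> vspace n \<and> (\<forall>lam. lam \<noteq> omega CARD('r::finite) \<longrightarrow> m lam = 0) \<longrightarrow>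
    (\<forall>lam. lam \<noteq> omega CARD('r) \<longrightarrow> (Kbar_gen n 1 :: 'r endo) m lam = 0) \<and>
    (Kbar_gen n 1 :: 'r endo) (Kbar_gen n 1 m) =
      vscale (c\<^sup>2 * (\<Sum>k<CARD('r). vv ^ (4 * k))) m)"
proof -
  let ?w = "omega CARD('r)"
  let ?X = "xx n ?w :: 'r hc" and ?K = "Kbar_gen n 1 :: 'r endo"
  let ?S = "\<Sum>k<CARD('r). vv ^ (4 * k)"
  obtain c where c: "c \<noteq> 0" "\<And>h. ?K (vsingle ?w (?X * h)) =
      vsingle ?w (hc_scale c (?X * cq 1 CARD('r) * hc_parity h))"
    using Kbar_gen_omega[OF n, where 'r = 'r] by blast
  have "(\<forall>lam. lam \<noteq> ?w \<longrightarrow> ?K m lam = 0) \<and> ?K (?K m) = vscale (c\<^sup>2 * ?S) m"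
    if m: "m \<in> vspace n" "\<forall>lam. lam \<noteq> ?w \<longrightarrow> m lam = 0" for m
  proof -
    obtain h where h: "m = vsingle ?w (?X * h)"
      using vspace_single_component[OF m(1) omega_Lam[OF n]] m(2) by blast
    let ?h = "hc_scale c (cq 1 CARD('r) * hc_parity h)"
    have K: "?K m = vsingle ?w (?X * ?h)"
      by (simp only: h c(2) hc_scale_mult_right mult.assoc)
    have "cq 1 CARD('r) * hc_parity ?h = hc_scale (c * ?S) h"
    proof -
      have "cq 1 CARD('r) * hc_parity ?h = hc_scale c (- (cq 1 CARD('r) * cq 1 CARD('r) * h))"
        by (simp add: hc_parity_scale hc_parity_mult hc_parity_cq hc_parity_parity
            hc_scale_mult_right mult.assoc)
      also have "\<dots> = hc_scale c (- (hc_scale (- ?S) 1 * h))"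
        by (simp only: cq_square)
      finally show ?thesis by (simp add: hc_scale_mult_left)
    qed
    then have "?X * cq 1 CARD('r) * hc_parity ?h = ?X * hc_scale (c * ?S) h"
      by (simp only: mult.assoc)
    then have "?K (?K m) = vsingle ?w (hc_scale c (?X * hc_scale (c * ?S) h))"
      by (simp only: K c(2))
    also have "\<dots> = vsingle ?w (hc_scale (c\<^sup>2 * ?S) (?X * h))"
      by (simp add: hc_scale_mult_right power2_eq_square mult.assoc)
    also have "\<dots> = vscale (c\<^sup>2 * ?S) m"
      by (simp add: h vsingle_simps)
    finally show ?thesis using K by (simp add: vsingle_simps)
  qed
  then show ?thesis using c(1) by blast
qed

theorem proposition4p11:
  fixes n r :: nat and M :: "'r::finite endo set"
  assumes "n \<ge> 2" and "r \<ge> 1" and "CARD('r) = r"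
    and "irreducible_Uv_submodule n M"
    and "has_highest_weight n M (omega r)"
  shows "(r > 1 \<longrightarrow> endo.dim (weight_space n M (omega r)) = 2) \<and>
    (r = 1 \<longrightarrow> endo.dim (weight_space n M (omega r)) = 1)"
proof -
  define K :: "'r endo" where "K = Kbar_gen n 1"
  let ?S = "\<Sum>k<CARD('r). vv ^ (4 * k)"
  let ?W = "weight_space n M (omega CARD('r))"
  have n: "0 < n" using assms(1) by simp
  have irr: "irreducible_Uv_submodule n M" by fact
  then have Mq: "M \<subseteq> qschur n" and Ms: "endo.subspace M"
    and Mu: "\<And>u f. u \<in> Uv_gens n \<Longrightarrow> f \<in> M \<Longrightarrow> u \<circ> f \<in> M"
    unfolding irreducible_Uv_submodule_def Uv_submodule_def by blast+
  note supp = weight_space_omega_iff[OF n Mq]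
  have K_in: "K \<in> Uv_gens n"
    unfolding Uv_gens_def K_def using n by (intro UnI1 UN_I[of 1]) auto
  then have Kq: "K \<in> qschur n" using Uv_gens_subset_qschur by blast
  obtain c where c: "c \<noteq> 0" and cK: "\<And>m. m \<in> vspace n \<Longrightarrow>
      (\<forall>lam. lam \<noteq> omega CARD('r) \<longrightarrow> m lam = 0) \<Longrightarrow>
      (\<forall>lam. lam \<noteq> omega CARD('r) \<longrightarrow> K m lam = 0) \<and> K (K m) = vscale (c\<^sup>2 * ?S) m"
    using Kbar_gen_square_omega[OF n, where 'r = 'r] unfolding K_def by blast
  have KW: "K \<circ> f \<in> ?W" and KK: "K \<circ> (K \<circ> f) = endo_scale (c\<^sup>2 * ?S) f" if f: "f \<in> ?W" for f
  proof -
    have fv: "f x \<in> vspace n" "\<forall>lam. lam \<noteq> omega CARD('r) \<longrightarrow> f x lam = 0" for x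
      using f supp Mq qschurD(2)[of f n] by blast+
    have "K \<circ> f \<in> M" using f supp Mu[OF K_in] by blast
    then show "K \<circ> f \<in> ?W"
      using cK[OF fv] by (simp add: supp)
    show "K \<circ> (K \<circ> f) = endo_scale (c\<^sup>2 * ?S) f"
    proof
      fix x
      show "(K \<circ> (K \<circ> f)) x = endo_scale (c\<^sup>2 * ?S) f x"
        using cK[OF fv, of x] by (simp add: endo_scale_def)
    qed
  qed
  have Wq: "f \<in> qschur n" if "f \<in> ?W" for f using that Mq by (auto simp: weight_space_def)
  have K_scale: "K \<circ> endo_scale a f = endo_scale a (K \<circ> f)" if "f \<in> ?W" for a f
    by (rule ext) (simp add: endo_scale_def qschurD(4)[OF Kq] qschurD(2)[OF Wq[OF that]])
  have K_add: "K \<circ> (f + g) = (K \<circ> f) + (K \<circ> g)" if "f \<in> ?W" "g \<in> ?W" for f g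
    by (rule ext) (simp add: qschurD(3)[OF Kq] qschurD(2)[OF Wq[OF that(1)]] qschurD(2)[OF Wq[OF that(2)]])
  have Ws: "endo.subspace ?W"
  proof -
    have "?W = {f \<in> M. \<forall>x lam. lam \<noteq> omega CARD('r) \<longrightarrow> f x lam = 0}"
      using supp by blast
    then show ?thesis
      using Ms unfolding endo.subspace_def by (auto simp: endo_scale_def vscale_def)
  qed
  obtain m where m: "m \<in> ?W" "m \<noteq> 0"
    using assms(3,5) unfolding has_highest_weight_def highest_weight_vector_def by blast
  note upper = weight_space_omega_subset_span[OF n irr, folded K_def]
  have "endo.dim ?W = 2" if r: "1 < CARD('r)"
  proof (rule endo.dim_unique)
    show "{m, K \<circ> m} \<subseteq> ?W" using m KW by simp
    show "?W \<subseteq> endo.span {m, K \<circ> m}" by (rule upper[OF m])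
    have not_multiple: "K \<circ> m \<noteq> endo_scale a m" for a
    proof
      assume a: "K \<circ> m = endo_scale a m"
      then have "endo_scale (a * a) m = endo_scale (c\<^sup>2 * ?S) m"
        using KK[OF m(1)] K_scale[OF m(1), of a] by simp
      then have "a * a = c\<^sup>2 * ?S"
        using m(2) by simp
      then have "(a / c) * (a / c) = ?S"
        using c by (simp add: power2_eq_square)
      then show False using sum_fourth_powers_not_square[OF r] by blast
    qed
    then have "K \<circ> m \<notin> endo.span {m}"
      unfolding endo.span_singleton by blast
    then have "endo.independent {K \<circ> m, m}"
      using m(2) by (simp add: endo.independent_insert endo.span_base)
    then show "endo.independent {m, K \<circ> m}" by (simp add: insert_commute)
    show "card {m, K \<circ> m} = 2"
      using not_multiple[of 1] by (auto simp: card_insert_if)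
  qed
  moreover have "endo.dim ?W = 1" if r: "CARD('r) = 1"
  proof -
    have KK1: "K \<circ> (K \<circ> f) = endo_scale (c\<^sup>2) f" if "f \<in> ?W" for f
      using KK[OF that] by (simp add: r)
    \<comment> \<open>Because \<open>K\<^sup>2\<close> is \<open>c\<^sup>2\<close>, the vector \<open>K m + c m\<close> is fixed by \<open>K\<close> up to \<open>c\<close>; if it vanishes,
      then \<open>m\<close> itself is an eigenvector.\<close>
    have "\<exists>m'\<in>?W. m' \<noteq> 0 \<and> (\<exists>a. K \<circ> m' = endo_scale a m')"
    proof (cases "K \<circ> m = endo_scale (- c) m")
      case True
      then show ?thesis using m by blast
    next
      case False
      define m' where "m' = (K \<circ> m) + endo_scale c m"
      have "m' \<in> ?W" unfolding m'_def
        by (intro endo.subspace_add[OF Ws] endo.subspace_scale[OF Ws] KW m)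
      moreover have "m' \<noteq> 0"
        using False unfolding m'_def by (simp add: eq_neg_iff_add_eq_0)
      moreover have "K \<circ> m' = endo_scale c m'"
      proof -
        have "K \<circ> m' = endo_scale (c\<^sup>2) m + endo_scale c (K \<circ> m)"
          unfolding m'_def using K_add[OF KW[OF m(1)] endo.subspace_scale[OF Ws m(1)]] KK1[OF m(1)]
            K_scale[OF m(1)] by simp
        then show ?thesis
          by (simp add: m'_def endo.scale_right_distrib power2_eq_square add.commute)
      qed
      ultimately show ?thesis by blast
    qed
    then obtain m' a where m': "m' \<in> ?W" "m' \<noteq> 0" "K \<circ> m' = endo_scale a m'" by blast
    have "endo.span {m', K \<circ> m'} \<subseteq> endo.span {m'}"
      unfolding m'(3) by (intro endo.span_minimal endo.subspace_span)
        (auto intro: endo.span_base endo.span_scale)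
    then have "?W \<subseteq> endo.span {m'}" using upper[OF m'(1,2)] by blast
    then show ?thesis
      using m' by (intro endo.dim_unique[of "{m'}"]) auto
  qed
  ultimately show ?thesis using assms(3) by simp
qed

end
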